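(* Fix $1 \leq p<\infty$ and let $f\in\mathscr{H}^\infty$. Then the function $\kappa \mapsto M_p^p(f,\kappa)$ is continuously differentiable on $(0,\infty)$ and \[\frac{\partial}{\partial \kappa} M_p^p(f,\kappa) = -\lim_{T\to\infty} \frac{p^2}{2T} \int_\kappa^\infty \int_{-T}^T |f(\sigma+it)|^{p-2} |f'(\sigma+it)|^2 \,dt\,d\sigma.\] Moreover, for every fixed $\kappa_0>0$ the limit in $T$ converges uniformly for $\kappa\in(\kappa_0,\infty)$.
   Context: For $\kappa\in\mathbb{R}$ let $\mathbb{C}_\kappa=\{s=\sigma+it:\sigma>\kappa\}$. $\mathscr{H}^\infty$ denotes the set of bounded analytic functions $f$ on the right half-plane $\mathbb{C}_0$ that can be represented by a Dirichlet series $f(s)=\sum_{n\geq1}a_n n^{-s}$ converging in $\mathbb{C}_\kappa$ for some $\kappa>0$, with the supremum norm. For $f\in\mathscr{H}^\infty$, $1\le p<\infty$ and $\sigma_0>0$, the mean value $M_p^p(f,\sigma_0)=\lim_{T\to\infty}\frac{1}{2T}\int_{-T}^T|f(\sigma_0+it)|^p\,dt$ exists. *)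

theory Defs
  imports "HOL-Analysis.Analysis"
begin

definition halfplane :: "real \<Rightarrow> complex set" where
  "halfplane \<kappa> = {s. Re s > \<kappa>}"

definition Hinf :: "(complex \<Rightarrow> complex) set" where
  "Hinf = {f. f holomorphic_on halfplane 0 \<and> bounded (f ` halfplane 0) \<and>
     (\<exists>(a::nat \<Rightarrow> complex) \<kappa>. \<kappa> > 0 \<and>
        (\<forall>s\<in>halfplane \<kappa>. (\<lambda>n. a (Suc n) / (of_nat (Suc n) powr s)) sums f s))}"

definition Mpp :: "real \<Rightarrow> (complex \<Rightarrow> complex) \<Rightarrow> real \<Rightarrow> real" where
  "Mpp p f \<sigma>0 = Lim at_top
     (\<lambda>T::real. 1 / (2 * T) * (LBINT t:{-T..T}. norm (f (Complex \<sigma>0 t)) powr p))"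

end

theory Submission
  imports Defs "HOL-Complex_Analysis.Complex_Analysis"
begin

text \<open>
  Since \<open>\<Delta>\<bar>f\<bar>\<^sup>p = p\<^sup>2 \<bar>f\<bar>\<^bsup>p-2\<^esup> \<bar>f'\<bar>\<^sup>2\<close>, Green's formula on \<open>(\<kappa>,\<infinity>) \<times> [-T,T]\<close> turns the area integral into
  \<open>-\<integral> \<partial>\<^sub>\<sigma>\<bar>f\<bar>\<^sup>p dt\<close> along \<open>Re s = \<kappa>\<close> plus two horizontal integrals, which are bounded uniformly in \<open>T\<close>
  because \<open>f'\<close> decays exponentially; this uses \<open>p \<ge> 1\<close>. It remains to see that the means over
  \<open>[-T,T]\<close> of \<open>\<partial>\<^sub>\<sigma>\<bar>f\<bar>\<^sup>p\<close> converge uniformly in \<open>\<kappa>\<close>.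

  The zeros of \<open>f\<close> are handled by replacing \<open>\<bar>f\<bar>\<^sup>p\<close> with \<open>(\<bar>f\<bar>\<^sup>2 + e\<^sup>2)\<^bsup>p/2\<^esup>\<close> and letting \<open>e \<rightarrow> 0\<close>.
  For \<open>e > 0\<close> all quantities are continuous functions of \<open>(f, f')\<close>, which is almost periodic
  uniformly on \<open>Re s \<ge> \<kappa>\<^sub>0\<close>: far to the right this follows from absolute convergence of the Dirichlet series,
  and boundedness of \<open>f\<close> carries it over to the whole half-plane. The passage \<open>e \<rightarrow> 0\<close> is uniform in mean by
  Montel's theorem: a limit \<open>g\<close> of vertical translates of \<open>f\<close> has only countably many points with
  \<open>g = 0 \<noteq> g'\<close>, and elsewhere the regularised derivatives converge.
\<close>

section \<open>Means of almost periodic functions\<close>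

text \<open>The difficulty sits at simple zeros of f when p < 2. There |f|^(p-2) |f'|^2 is
  unbounded, and for p = 1 the gradient of |f|^p jumps, so it is not a continuous function of (f,
  f') and inherits no almost periodicity. Nor can the regularised gradient then approach it
  uniformly; what survives is smallness of the difference integrated over unit windows, uniformly in
  the position of the window. This controls the means for all T >= 1 at once, so the limits in T and
  in e may be interchanged. The Montel argument must include abscissae tending to infinity, where
  the limit function is constant and possibly identically zero. Then g' = 0, and a bound of the
  gradients by a multiple of |f'| takes over; that bound needs |f|^(p-1) to be bounded, hence p >=
  1. The exponential rate is that of 2^(-s), the first nonconstant term of the series: f itself
  tends to its constant coefficient, so integrals up to \<sigma> = infinity converge only thanks to
  the factor f'.\<close>

text \<open>Bochner's form of almost periodicity: the translates in \<open>t\<close> are totally bounded in the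
  supremum norm, uniformly in \<open>\<sigma>\<close>.\<close>

definition unif_almost_periodic :: "real set \<Rightarrow> (real \<Rightarrow> real \<Rightarrow> 'a::metric_space) \<Rightarrow> bool" where
  "unif_almost_periodic S g \<longleftrightarrow> (\<forall>e>0. \<exists>F. finite F \<and>
     (\<forall>a. \<exists>b\<in>F. \<forall>\<sigma>\<in>S. \<forall>t. dist (g \<sigma> (t + a)) (g \<sigma> (t + b)) < e))"

definition mean :: "real \<Rightarrow> (real \<Rightarrow> real) \<Rightarrow> real" where
  "mean T h = 1 / (2 * T) * (LBINT t:{-T..T}. h t)"

lemma unif_almost_periodic_compose:
  assumes "unif_almost_periodic S g" and "\<And>\<sigma> t. \<sigma> \<in> S \<Longrightarrow> g \<sigma> t \<in> K" and "compact K" and "continuous_on K \<Phi>"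
  shows "unif_almost_periodic S (\<lambda>\<sigma> t. \<Phi> (g \<sigma> t))"
  unfolding unif_almost_periodic_def
proof (intro allI impI)
  fix e :: real assume "e > 0"
  have "uniformly_continuous_on K \<Phi>"
    using assms by (intro compact_uniformly_continuous)
  then obtain d where d: "d > 0" "\<And>x y. x \<in> K \<Longrightarrow> y \<in> K \<Longrightarrow> dist y x < d \<Longrightarrow> dist (\<Phi> y) (\<Phi> x) < e"
    using \<open>e > 0\<close> unfolding uniformly_continuous_on_def by metis
  obtain F where "finite F" "\<And>a. \<exists>b\<in>F. \<forall>\<sigma>\<in>S. \<forall>t. dist (g \<sigma> (t + a)) (g \<sigma> (t + b)) < d"
    using assms(1) d(1) unfolding unif_almost_periodic_def by metis
  then show "\<exists>F. finite F \<and>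
     (\<forall>a. \<exists>b\<in>F. \<forall>\<sigma>\<in>S. \<forall>t. dist (\<Phi> (g \<sigma> (t + a))) (\<Phi> (g \<sigma> (t + b))) < e)"
    using d(2) assms(2) by meson
qed

lemma mean_eq_integral:
  assumes "continuous_on UNIV h"
  shows "mean T h = integral {-T..T} h / (2 * T)"
proof -
  have "set_integrable lborel {-T..T} h"
    using assms by (intro borel_integrable_atLeastAtMost' continuous_on_subset[OF assms]) auto
  then show ?thesis
    unfolding mean_def by (simp add: set_borel_integral_eq_integral(2))
qed

lemma integral_translate:
  fixes h :: "real \<Rightarrow> real"
  assumes "continuous_on UNIV h"
  shows "integral {-T..T} (\<lambda>t. h (t + a)) = integral {-T + a..T + a} h"
  using integral_shift[of "-T" a T h] continuous_on_subset[OF assms] by (simp add: o_def)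

lemma integral_bound_le:
  fixes h :: "real \<Rightarrow> real"
  assumes "continuous_on UNIV h" and "\<And>t. a \<le> t \<Longrightarrow> t \<le> b \<Longrightarrow> \<bar>h t\<bar> \<le> B" and "a \<le> b"
  shows "\<bar>integral {a..b} h\<bar> \<le> B * (b - a)"
  using integral_bound[of a b h B] assms by (auto intro: continuous_on_subset)

text \<open>The two intervals of integration differ by two end pieces of length |a|. The bound does
  not grow with T, so a fixed translation is invisible in the mean as T tends to infinity.\<close>

lemma integral_translate_diff:
  fixes h :: "real \<Rightarrow> real"
  assumes h: "continuous_on UNIV h" and B: "\<And>t. \<bar>h t\<bar> \<le> B" and T: "T \<ge> 0"
  shows "\<bar>integral {-T..T} (\<lambda>t. h (t + a)) - integral {-T..T} h\<bar> \<le> 2 * B * \<bar>a\<bar>"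
proof -
  have *: "\<bar>integral {-T..T} (\<lambda>t. h (t + a)) - integral {-T..T} h\<bar> \<le> 2 * B * a"
    if h: "continuous_on UNIV h" and B: "\<And>t. \<bar>h t\<bar> \<le> B" and a: "a \<ge> 0" for h a
  proof -
    have int: "h integrable_on {x..y}" for x y
      by (intro integrable_continuous_real continuous_on_subset[OF h]) auto
    have "integral {-T..-T+a} h + integral {-T+a..T+a} h = integral {-T..T+a} h"
      using a T by (intro Henstock_Kurzweil_Integration.integral_combine int) auto
    moreover have "integral {-T..T} h + integral {T..T+a} h = integral {-T..T+a} h"
      using a T by (intro Henstock_Kurzweil_Integration.integral_combine int) auto
    moreover have "\<bar>integral {-T..-T+a} h\<bar> \<le> B * a"
      using integral_bound_le[OF h, of "-T" "-T+a" B] B a by simp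
    moreover have "\<bar>integral {T..T+a} h\<bar> \<le> B * a"
      using integral_bound_le[OF h, of "T" "T+a" B] B a by simp
    ultimately show ?thesis
      unfolding integral_translate[OF h] by linarith
  qed
  show ?thesis
  proof (cases "a \<ge> 0")
    case True
    then show ?thesis using *[OF h B, of a] by simp
  next
    case False
    \<comment> \<open>For negative \<open>a\<close> the roles are exchanged: \<open>h\<close> is the
      translate by \<open>-a\<close> of the translated function.\<close>
    have "continuous_on UNIV (\<lambda>t. h (t + a))"
      by (intro continuous_on_compose2[OF h] continuous_intros) auto
    from *[OF this, of "-a"] B False show ?thesis by simp
  qed
qed

text \<open>Up to e/8 only the finitely many translations in \<open>F\<close> occur, and each
  changes the mean by O(1/T). So all translates of \<open>g \<sigma>\<close> have nearly the same
  mean over [-T, T], and averaging over the translations in [-T', T'] gives an expression symmetric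
  in T and T'. As \<open>F\<close> serves every \<sigma> at once, so does \<open>T0\<close>.\<close>

lemma unif_almost_periodic_mean_Cauchy:
  fixes g :: "real \<Rightarrow> real \<Rightarrow> real"
  assumes unif_almost_periodic: "unif_almost_periodic S g" and cont: "\<And>\<sigma>. \<sigma> \<in> S \<Longrightarrow> continuous_on UNIV (g \<sigma>)"
    and bd: "\<And>\<sigma> t. \<sigma> \<in> S \<Longrightarrow> \<bar>g \<sigma> t\<bar> \<le> B" and e: "e > 0"
  shows "\<exists>T0. \<forall>T\<ge>T0. \<forall>T'\<ge>T0. \<forall>\<sigma>\<in>S. dist (mean T (g \<sigma>)) (mean T' (g \<sigma>)) < e"
proof -
  obtain F where F: "finite F" "\<And>a. \<exists>b\<in>F. \<forall>\<sigma>\<in>S. \<forall>t. dist (g \<sigma> (t + a)) (g \<sigma> (t + b)) < e / 8"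
    using unif_almost_periodic e unfolding unif_almost_periodic_def by (metis divide_pos_pos zero_less_numeral)
  obtain L where L: "\<And>b. b \<in> F \<Longrightarrow> \<bar>b\<bar> \<le> L"
    using finite_imp_bounded[OF F(1)] unfolding bounded_iff by auto
  \<comment> \<open>From this \<open>T0\<close> on, the end correction 2 B L caused by a translation
    in \<open>F\<close> is at most T e / 4.\<close>
  define T0 where "T0 = max 1 (8 * \<bar>L\<bar> * \<bar>B\<bar> / e)"
  have shift: "\<bar>integral {-T..T} (\<lambda>t. g \<sigma> (t + a)) - integral {-T..T} (g \<sigma>)\<bar> \<le> e / 4 * (2 * T)"
    if "T \<ge> T0" "\<sigma> \<in> S" for T \<sigma> a
  proof -
    note c = cont[OF that(2)]
    have T: "T \<ge> 1" "8 * \<bar>L\<bar> * \<bar>B\<bar> / e \<le> T" using that by (auto simp: T0_def)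
    then have T2: "8 * \<bar>L\<bar> * \<bar>B\<bar> \<le> T * e" using e by (simp add: field_simps)
    from F(2) \<open>\<sigma> \<in> S\<close> obtain b
      where b: "b \<in> F" "\<And>t. dist (g \<sigma> (t + a)) (g \<sigma> (t + b)) < e / 8"
      by meson
    have ct: "continuous_on UNIV (\<lambda>t. g \<sigma> (t + x))" for x
      by (intro continuous_on_compose2[OF c] continuous_intros) auto
    have "\<bar>integral {-T..T} (\<lambda>t. g \<sigma> (t + a) - g \<sigma> (t + b))\<bar> \<le> e / 8 * (T - (- T))"
      using b(2) T by (intro integral_bound_le continuous_intros ct) (auto simp: dist_real_def less_imp_le)
    also have "integral {-T..T} (\<lambda>t. g \<sigma> (t + a) - g \<sigma> (t + b)) =
        integral {-T..T} (\<lambda>t. g \<sigma> (t + a)) - integral {-T..T} (\<lambda>t. g \<sigma> (t + b))"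
      by (intro Henstock_Kurzweil_Integration.integral_diff integrable_continuous_real
            continuous_on_subset[OF ct]) auto
    finally have 1: "\<bar>integral {-T..T} (\<lambda>t. g \<sigma> (t + a)) - integral {-T..T} (\<lambda>t. g \<sigma> (t + b))\<bar> \<le> T * e / 4"
      by (simp add: field_simps)
    have "\<bar>integral {-T..T} (\<lambda>t. g \<sigma> (t + b)) - integral {-T..T} (g \<sigma>)\<bar> \<le> 2 * B * \<bar>b\<bar>"
      using T bd[OF that(2)] by (intro integral_translate_diff c) auto
    also have "\<dots> \<le> 2 * \<bar>B\<bar> * \<bar>L\<bar>"
      using L[OF b(1)] by (intro mult_mono[of "2 * B"]) auto
    also have "\<dots> \<le> T * e / 4" using T2 by (simp add: mult_ac)
    finally have "\<bar>integral {-T..T} (\<lambda>t. g \<sigma> (t + a)) - integral {-T..T} (g \<sigma>)\<bar> \<le> T * e / 4 + T * e / 4"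
      using 1 by linarith
    then show ?thesis by (simp add: field_simps)
  qed
  txt \<open>The double average of \<open>g \<sigma> (s + t)\<close> over \<open>\<bar>s\<bar> \<le> T'\<close>, \<open>\<bar>t\<bar> \<le> T\<close> is close to both means.\<close>
  have double: "\<bar>integral {-T'..T'} (\<lambda>s. integral {-T..T} (\<lambda>t. g \<sigma> (t + s))) - 2 * T' * integral {-T..T} (g \<sigma>)\<bar>
      \<le> e / 4 * (2 * T) * (2 * T')"
    if "T \<ge> T0" "T' \<ge> T0" "\<sigma> \<in> S" for T T' \<sigma>
  proof -
    have pos: "T' \<ge> 1" using that by (auto simp: T0_def)
    have "continuous_on ({-T'..T'} \<times> cbox (-T) T) (\<lambda>(s, t). g \<sigma> (t + s))"
      unfolding split_beta
      by (intro continuous_on_compose2[OF cont[OF that(3)]] continuous_intros) auto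
    then have c: "continuous_on {-T'..T'} (\<lambda>s. integral {-T..T} (\<lambda>t. g \<sigma> (t + s)))"
      using integral_continuous_on_param[of "{-T'..T'}" "-T" T "\<lambda>s t. g \<sigma> (t + s)"] by simp
    have "norm (integral {-T'..T'} (\<lambda>s. integral {-T..T} (\<lambda>t. g \<sigma> (t + s)) - integral {-T..T} (g \<sigma>)))
       \<le> e / 4 * (2 * T) * (T' - (- T'))"
      using pos shift[OF that(1,3)] by (intro integral_bound continuous_intros c) auto
    then show ?thesis
      using pos by (subst (asm) Henstock_Kurzweil_Integration.integral_diff)
        (auto intro!: integrable_continuous_real c)
  qed
  have "dist (mean T (g \<sigma>)) (mean T' (g \<sigma>)) < e" if "T \<ge> T0" "T' \<ge> T0" "\<sigma> \<in> S" for T T' \<sigma>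
  proof -
    have pos: "T' \<ge> 1" "T \<ge> 1" using that by (auto simp: T0_def)
    let ?I = "integral {-T'..T'} (\<lambda>s. integral {-T..T} (\<lambda>t. g \<sigma> (t + s)))"
    have "continuous_on (cbox (-T', -T) (T', T)) (\<lambda>(s, t). g \<sigma> (t + s))"
      unfolding split_beta
      by (intro continuous_on_compose2[OF cont[OF that(3)]] continuous_intros) auto
    from integral_swap_continuous[OF this]
    have sw: "?I = integral {-T..T} (\<lambda>s. integral {-T'..T'} (\<lambda>t. g \<sigma> (t + s)))"
      by (simp add: add.commute)
    have "\<bar>?I - 2 * T' * integral {-T..T} (g \<sigma>)\<bar> \<le> e / 4 * (2 * T) * (2 * T')"
      using double that by blast
    moreover have "\<bar>?I - 2 * T * integral {-T'..T'} (g \<sigma>)\<bar> \<le> e / 4 * (2 * T) * (2 * T')"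
      unfolding sw using double[of T' T \<sigma>] that by (simp add: mult_ac)
    ultimately have "\<bar>2 * T' * integral {-T..T} (g \<sigma>) - 2 * T * integral {-T'..T'} (g \<sigma>)\<bar>
        \<le> e / 2 * (2 * T) * (2 * T')" by linarith
    then have "\<bar>2 * T' * integral {-T..T} (g \<sigma>) - 2 * T * integral {-T'..T'} (g \<sigma>)\<bar> / ((2 * T) * (2 * T'))
        \<le> e / 2"
      using pos by (simp add: divide_le_eq mult_ac)
    also have "\<bar>2 * T' * integral {-T..T} (g \<sigma>) - 2 * T * integral {-T'..T'} (g \<sigma>)\<bar> / ((2 * T) * (2 * T')) =
       \<bar>(2 * T' * integral {-T..T} (g \<sigma>) - 2 * T * integral {-T'..T'} (g \<sigma>)) / ((2 * T) * (2 * T'))\<bar>"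
      using pos by (simp add: abs_divide abs_mult)
    also have "(2 * T' * integral {-T..T} (g \<sigma>) - 2 * T * integral {-T'..T'} (g \<sigma>)) / ((2 * T) * (2 * T'))
        = mean T (g \<sigma>) - mean T' (g \<sigma>)"
      using pos by (simp add: mean_eq_integral[OF cont[OF that(3)]] field_simps)
    finally show ?thesis using e by (simp add: dist_real_def)
  qed
  then show ?thesis by blast
qed

text \<open>The limit is found along the integers, where completeness applies, and the Cauchy
  criterion carries it over to real T. It is named by \<open>Lim\<close> because \<open>Mpp\<close>
  is.\<close>

lemma uniform_limit_Lim_at_top:
  fixes Y :: "real \<Rightarrow> 'b \<Rightarrow> 'a::complete_space"
  assumes "\<And>e. e > 0 \<Longrightarrow> \<exists>T0. \<forall>T\<ge>T0. \<forall>T'\<ge>T0. \<forall>x\<in>S. dist (Y T x) (Y T' x) < e"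
  shows "uniform_limit S Y (\<lambda>x. Lim at_top (\<lambda>T. Y T x)) at_top"
proof -
  have lim: "((\<lambda>T. Y T x) \<longlongrightarrow> Lim at_top (\<lambda>T. Y T x)) at_top" if x: "x \<in> S" for x
  proof -
    have "Cauchy (\<lambda>n. Y (real n) x)"
      unfolding Cauchy_def
    proof (intro allI impI)
      fix e :: real assume "e > 0"
      then obtain T0 where "\<forall>T\<ge>T0. \<forall>T'\<ge>T0. dist (Y T x) (Y T' x) < e" using assms x by meson
      then have "\<forall>m\<ge>nat \<lceil>T0\<rceil>. \<forall>n\<ge>nat \<lceil>T0\<rceil>. dist (Y (real m) x) (Y (real n) x) < e"
        by (simp add: nat_ceiling_le_eq)
      then show "\<exists>M. \<forall>m\<ge>M. \<forall>n\<ge>M. dist (Y (real m) x) (Y (real n) x) < e" ..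
    qed
    then obtain l where l: "(\<lambda>n. Y (real n) x) \<longlonglongrightarrow> l"
      using Cauchy_convergent convergent_def by metis
    have "((\<lambda>T. Y T x) \<longlongrightarrow> l) at_top"
    proof (rule tendstoI)
      fix e :: real assume e: "e > 0"
      then obtain T0 where T0: "\<forall>T\<ge>T0. \<forall>T'\<ge>T0. dist (Y T x) (Y T' x) < e / 2"
        using assms[of "e/2"] x by (meson half_gt_zero)
      have "\<forall>\<^sub>F n in sequentially. dist (Y (real n) x) l < e / 2 \<and> real n \<ge> T0"
        using tendstoD[OF l, of "e/2"] e filterlim_real_sequentially
        by (auto simp: filterlim_at_top eventually_conj_iff)
      then obtain n where n: "dist (Y (real n) x) l < e / 2" "real n \<ge> T0"
        using eventually_happens sequentially_bot by blast
      have "dist (Y T x) l < e" if "T \<ge> T0" for T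
        using n T0 that dist_triangle_half_r[of "Y (real n) x" "Y T x" e l] by (metis dist_commute)
      then show "\<forall>\<^sub>F T in at_top. dist (Y T x) l < e"
        by (auto simp: eventually_at_top_linorder)
    qed
    then show ?thesis using tendsto_Lim trivial_limit_at_top_linorder by metis
  qed
  show ?thesis
  proof (rule uniform_limitI)
    fix e :: real assume e: "e > 0"
    then obtain T0 where T0: "\<And>T T' x. T \<ge> T0 \<Longrightarrow> T' \<ge> T0 \<Longrightarrow> x \<in> S \<Longrightarrow> dist (Y T x) (Y T' x) < e / 2"
      using assms[of "e/2"] by (meson half_gt_zero)
    have "dist (Y T x) (Lim at_top (\<lambda>T. Y T x)) \<le> e / 2" if "T \<ge> T0" "x \<in> S" for T x
    proof (rule tendsto_upperbound)
      show "((\<lambda>T'. dist (Y T x) (Y T' x)) \<longlongrightarrow> dist (Y T x) (Lim at_top (\<lambda>T. Y T x))) at_top"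
        by (intro tendsto_intros lim that)
      show "\<forall>\<^sub>F T' in at_top. dist (Y T x) (Y T' x) \<le> e / 2"
        using T0 that by (auto simp: eventually_at_top_linorder intro!: exI[of _ T0] less_imp_le)
    qed auto
    then show "\<forall>\<^sub>F T in at_top. \<forall>x\<in>S. dist (Y T x) (Lim at_top (\<lambda>T. Y T x)) < e"
      using e by (fastforce simp: eventually_at_top_linorder)
  qed
qed

section \<open>Almost periodicity of bounded Dirichlet series\<close>

lemma open_halfplane: "open (halfplane k)"
  unfolding halfplane_def by (rule open_halfspace_Re_gt)

lemma convex_halfplane: "convex (halfplane k)"
  unfolding halfplane_def by (rule convex_halfspace_Re_gt)

lemma connected_halfplane: "connected (halfplane k)"
  by (rule convex_connected[OF convex_halfplane])

lemma holomorphic_zero_on_halfplane: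
  assumes g: "g holomorphic_on halfplane k" and zero: "\<And>z. Re z > l \<Longrightarrow> g z = 0" and z: "Re z > k"
  shows "g z = 0"
proof -
  \<comment> \<open>The unit disc about \<open>u\<close> lies to the right of both k and l; the
    identity theorem starts from it.\<close>
  define u where "u = max k l + 1"
  have sub: "ball (of_real u) 1 \<subseteq> {z. Re z > max k l}"
  proof
    fix z assume "z \<in> ball (complex_of_real u) 1"
    then have "norm (of_real u - z) < 1" by (simp add: dist_norm)
    then have "\<bar>Re (of_real u - z)\<bar> < 1" using abs_Re_le_cmod[of "of_real u - z"] by linarith
    then show "z \<in> {z. Re z > max k l}" by (simp add: u_def abs_less_iff)
  qed
  show ?thesis
  proof (rule analytic_continuation_open[of "ball (of_real u) 1" "halfplane k" g "\<lambda>_. 0"])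
    show "ball (complex_of_real u) 1 \<subseteq> halfplane k" using sub by (auto simp: halfplane_def)
    show "g z = 0" if "z \<in> ball (complex_of_real u) 1" for z using sub that zero by force
  qed (use assms open_halfplane connected_halfplane in \<open>auto simp: halfplane_def\<close>)
qed

text \<open>Moving the half-plane Re z > -\<kappa> by \<open>c k\<close> lands in Re z > 0, so the
  translates form one bounded family on a fixed domain, in which the point 0, corresponding to
  \<open>c k\<close>, is interior if \<kappa> > 0. The real parts of \<open>c k\<close> may tend to
  infinity. Letting \<open>h k\<close> vary with k serves \<open>bounded_holomorphic_small\<close>;
  a constant sequence gives the translates of f.\<close>

lemma Montel_translates:
  fixes h :: "nat \<Rightarrow> complex \<Rightarrow> complex"
  assumes h: "\<And>k. h k holomorphic_on halfplane 0"
    and M: "\<And>k s. s \<in> halfplane 0 \<Longrightarrow> norm (h k s) \<le> M"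
    and c: "\<And>k. Re (c k) \<ge> \<kappa>"
  obtains g r where "g holomorphic_on halfplane (-\<kappa>)" "strict_mono (r :: nat \<Rightarrow> nat)"
    "\<And>z. z \<in> halfplane (-\<kappa>) \<Longrightarrow> (\<lambda>k. h (r k) (z + c (r k))) \<longlonglongrightarrow> g z"
    "\<And>z. z \<in> halfplane (-\<kappa>) \<Longrightarrow> (\<lambda>k. deriv (h (r k)) (z + c (r k))) \<longlonglongrightarrow> deriv g z"
proof -
  define H where "H = (\<lambda>k z. h k (z + c k))"
  have in0: "z + c k \<in> halfplane 0" if "z \<in> halfplane (-\<kappa>)" for z k
    using that c[of k] by (auto simp: halfplane_def)
  have hol: "H k holomorphic_on halfplane (-\<kappa>)" for k
    unfolding H_def using in0
    by (intro holomorphic_on_compose_gen[OF _ h, of _ _ k, unfolded o_def] holomorphic_intros) auto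
  have dH: "deriv (H k) z = deriv (h k) (z + c k)" if "z \<in> halfplane (-\<kappa>)" for k z
  proof -
    have "(h k has_field_derivative deriv (h k) (z + c k)) (at (z + c k))"
      using holomorphic_derivI[OF h open_halfplane in0[OF that]] .
    then have "(H k has_field_derivative deriv (h k) (z + c k)) (at z)"
      unfolding H_def by (simp add: DERIV_shift)
    then show ?thesis by (rule DERIV_imp_deriv)
  qed
  obtain g r where g: "g holomorphic_on halfplane (-\<kappa>)" and r: "strict_mono r"
    and pt: "\<And>x. x \<in> halfplane (-\<kappa>) \<Longrightarrow> ((\<lambda>n. H (r n) x) \<longlongrightarrow> g x) sequentially"
    and ul: "\<And>K. \<lbrakk>compact K; K \<subseteq> halfplane (-\<kappa>)\<rbrakk> \<Longrightarrow> uniform_limit K (H \<circ> r) g sequentially"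
  proof (rule Montel[of "halfplane (-\<kappa>)" "range H" H])
    show "\<exists>B. \<forall>h\<in>range H. \<forall>z\<in>K. cmod (h z) \<le> B" if "compact K" "K \<subseteq> halfplane (-\<kappa>)" for K
      using that in0 M by (intro exI[of _ M]) (auto simp: H_def)
  qed (use hol open_halfplane in auto)
  show thesis
  proof (rule that[OF g r])
    show "(\<lambda>k. h (r k) (z + c (r k))) \<longlonglongrightarrow> g z" if "z \<in> halfplane (-\<kappa>)" for z
      using pt[OF that] by (simp add: H_def)
    show "(\<lambda>k. deriv (h (r k)) (z + c (r k))) \<longlonglongrightarrow> deriv g z" if z: "z \<in> halfplane (-\<kappa>)" for z
    proof -
      obtain d where d: "d > 0" "cball z d \<subseteq> halfplane (-\<kappa>)"
        using z open_halfplane open_contains_cball by blast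
      have "uniform_limit (ball z d) (H \<circ> r) g sequentially"
        by (rule uniform_limit_on_subset[OF ul[OF compact_cball d(2)] ball_subset_cball])
      then have "(\<lambda>n. deriv ((H \<circ> r) n) z) \<longlonglongrightarrow> deriv g z"
        using d by (intro deriv_complex_uniform_limit[where A = "ball z d"])
          (auto simp: o_def intro!: always_eventually holomorphic_on_subset[OF hol])
      then show ?thesis using dH[OF z] by simp
    qed
  qed
qed

text \<open>A qualitative form of the three lines theorem, by compactness.\<close>

lemma bounded_holomorphic_small:
  assumes "\<kappa> > 0" and "c > 0"
  shows "\<exists>\<eta>>0. \<forall>h. h holomorphic_on halfplane 0 \<longrightarrow> (\<forall>s\<in>halfplane 0. norm (h s) \<le> M) \<longrightarrow>
    (\<forall>s\<in>halfplane K. norm (h s) \<le> \<eta>) \<longrightarrow> (\<forall>s. Re s \<ge> \<kappa> \<longrightarrow> norm (h s) < c)"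
proof (rule ccontr)
  assume neg: "\<not> ?thesis"
  have "\<exists>h s. h holomorphic_on halfplane 0 \<and> (\<forall>s\<in>halfplane 0. norm (h s) \<le> M) \<and>
    (\<forall>s\<in>halfplane K. norm (h s) \<le> inverse (real (Suc k))) \<and> Re s \<ge> \<kappa> \<and> norm (h s) \<ge> c" for k
  proof -
    have "inverse (real (Suc k)) > 0" by simp
    then show ?thesis using neg by (meson not_le)
  qed
  then obtain h s where h: "\<And>k. h k holomorphic_on halfplane 0"
    "\<And>k z. z \<in> halfplane 0 \<Longrightarrow> norm (h k z) \<le> M"
    "\<And>k z. z \<in> halfplane K \<Longrightarrow> norm (h k z) \<le> inverse (real (Suc k))"
    "\<And>k. Re (s k) \<ge> \<kappa>" "\<And>k. norm (h k (s k)) \<ge> c"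
    by metis
  obtain g r where g: "g holomorphic_on halfplane (-\<kappa>)" and r: "strict_mono (r :: nat \<Rightarrow> nat)"
    and lim: "\<And>z. z \<in> halfplane (-\<kappa>) \<Longrightarrow> (\<lambda>k. h (r k) (z + s (r k))) \<longlonglongrightarrow> g z"
    by (rule Montel_translates[where h = h and c = s, OF h(1,2,4)]) (assumption, rule that, assumption+)
  \<comment> \<open>Since Re (s k) is positive, the translated points lie in
    \<open>halfplane K\<close>, where \<open>h k\<close> tends to 0 uniformly.\<close>
  have zero: "g z = 0" if "Re z > \<bar>K\<bar>" for z
  proof -
    have z: "z \<in> halfplane (-\<kappa>)" using that assms by (simp add: halfplane_def)
    have "(\<lambda>k. h (r k) (z + s (r k))) \<longlonglongrightarrow> 0"
    proof (rule tendsto_norm_zero_cancel, rule tendsto_sandwich[OF _ _ tendsto_const])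
      show "\<forall>\<^sub>F k in sequentially. norm (h (r k) (z + s (r k))) \<le> inverse (real (Suc (r k)))"
      proof (intro always_eventually allI h(3))
        fix k show "z + s (r k) \<in> halfplane K"
          using that h(4)[of "r k"] assms by (simp add: halfplane_def)
      qed
      show "(\<lambda>k. inverse (real (Suc (r k)))) \<longlonglongrightarrow> 0"
        using LIMSEQ_subseq_LIMSEQ[OF LIMSEQ_inverse_real_of_nat r] by (simp add: o_def)
    qed simp
    then show ?thesis using lim[OF z] LIMSEQ_unique by blast
  qed
  \<comment> \<open>The limit vanishes far to the right and hence at 0; but the values of the
    translates at 0 are \<open>h k (s k)\<close>, of modulus at least c.\<close>
  have "g 0 = 0"
    by (rule holomorphic_zero_on_halfplane[OF g zero]) (use assms in auto)
  moreover have "(\<lambda>k. norm (h (r k) (0 + s (r k)))) \<longlonglongrightarrow> norm (g 0)"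
    by (intro tendsto_norm lim) (use assms in \<open>simp add: halfplane_def\<close>)
  then have "c \<le> norm (g 0)"
    by (rule LIMSEQ_le_const) (use h(5) in auto)
  ultimately show False using assms by simp
qed

section \<open>Finite nets of vertical translates far to the right\<close>

lemma finite_cis_net:
  fixes \<Lambda> :: "real set"
  assumes "finite \<Lambda>" and "e > 0"
  shows "\<exists>F. finite F \<and> (\<forall>a. \<exists>b\<in>F. \<forall>l\<in>\<Lambda>. dist (cis (a * l)) (cis (b * l)) < e)"
proof -
  obtain m :: nat where m: "2 / e < real m" using reals_Archimedean2 by blast
  have m0: "real m > 0" using m assms by (meson divide_pos_pos less_trans zero_less_numeral)
  \<comment> \<open>Pigeonhole on the torus: \<phi> records in which cell of side 1/m each point
    \<open>cis (a * l)\<close> lies. Only finitely many patterns occur, and one representative of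
    each makes up \<open>F\<close>. Two coordinates, each within 1/m, explain the choice 2/m < e;
    \<open>restrict\<close> puts the patterns into a finite set of extensional functions.\<close>
  define \<phi> where "\<phi> = (\<lambda>a. restrict (\<lambda>l. (\<lfloor>real m * cos (a * l)\<rfloor>, \<lfloor>real m * sin (a * l)\<rfloor>)) \<Lambda>)"
  have fl: "\<lfloor>real m * x\<rfloor> \<in> {-int m..int m}" if "-1 \<le> x" "x \<le> 1" for x
  proof -
    have "real m * x \<ge> real m * (-1)" "real m * x \<le> real m * 1"
      using that m0 by (intro mult_left_mono; simp)+
    then show ?thesis by (auto simp: le_floor_iff floor_le_iff)
  qed
  have "range \<phi> \<subseteq> PiE \<Lambda> (\<lambda>_. {-int m..int m} \<times> {-int m..int m})"
    using fl by (auto simp: \<phi>_def)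
  then have "finite (range \<phi>)"
    using assms(1) by (meson finite_PiE finite_SigmaI finite_atLeastAtMost_int finite_subset)
  then obtain F where F: "finite F" "range \<phi> = \<phi> ` F"
    using finite_subset_image[of "range \<phi>" \<phi> UNIV] by auto
  have close: "\<bar>x - y\<bar> < 1 / real m" if "\<lfloor>real m * x\<rfloor> = \<lfloor>real m * y\<rfloor>" for x y
  proof -
    have "\<bar>real m * x - real m * y\<bar> < 1" using that by linarith
    then have "real m * \<bar>x - y\<bar> < 1" by (metis abs_mult abs_of_nat right_diff_distrib)
    then show ?thesis using m0 by (simp add: field_simps)
  qed
  show ?thesis
  proof (intro exI[of _ F] conjI F(1) allI)
    fix a
    obtain b where b: "b \<in> F" "\<phi> a = \<phi> b" using F(2) by (metis imageE rangeI)
    have "dist (cis (a * l)) (cis (b * l)) < e" if "l \<in> \<Lambda>" for l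
    proof -
      have "\<lfloor>real m * cos (a * l)\<rfloor> = \<lfloor>real m * cos (b * l)\<rfloor>"
        "\<lfloor>real m * sin (a * l)\<rfloor> = \<lfloor>real m * sin (b * l)\<rfloor>"
        using fun_cong[OF b(2), of l] that by (auto simp: \<phi>_def)
      then have "\<bar>cos (a * l) - cos (b * l)\<bar> < 1 / real m" "\<bar>sin (a * l) - sin (b * l)\<bar> < 1 / real m"
        using close by auto
      moreover have "norm (cis (a * l) - cis (b * l)) \<le> \<bar>cos (a * l) - cos (b * l)\<bar> + \<bar>sin (a * l) - sin (b * l)\<bar>"
        using cmod_le[of "cis (a * l) - cis (b * l)"] by simp
      moreover have "2 / real m < e" using m m0 assms by (simp add: field_simps)
      ultimately show ?thesis by (simp add: dist_norm)
    qed
    then show "\<exists>b\<in>F. \<forall>l\<in>\<Lambda>. dist (cis (a * l)) (cis (b * l)) < e" using b(1) by blast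
  qed
qed

text \<open>At abscissa \<kappa> + 1 the terms tend to 0 and so are bounded; two further units to
  the right gain the summable factor n^(-2), whence \<kappa> + 3. The coefficients are reindexed so
  that \<open>a 0\<close> belongs to the constant term 1^(-s).\<close>

lemma Hinf_absolutely_convergent:
  assumes "f \<in> Hinf"
  obtains a :: "nat \<Rightarrow> complex" and K :: real where "K > 0" "summable (\<lambda>n. norm (a n) * real (Suc n) powr (-K))"
    "\<And>s. Re s \<ge> K \<Longrightarrow> (\<lambda>n. a n / (of_nat (Suc n) powr s)) sums f s"
proof -
  obtain a :: "nat \<Rightarrow> complex" and \<kappa> where \<kappa>: "\<kappa> > 0"
    and sums: "\<And>s. s \<in> halfplane \<kappa> \<Longrightarrow> (\<lambda>n. a (Suc n) / (of_nat (Suc n) powr s)) sums f s"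
    using assms unfolding Hinf_def by auto
  have nrm: "norm (a (Suc n) / (of_nat (Suc n) powr s)) = norm (a (Suc n)) * real (Suc n) powr (- Re s)" for n s
    using norm_powr_real_powr[of "of_nat (Suc n)" s]
    by (simp add: norm_divide powr_minus divide_simps del: of_nat_Suc)
  have "(\<lambda>n. a (Suc n) / (of_nat (Suc n) powr of_real (\<kappa> + 1))) \<longlonglongrightarrow> 0"
    by (intro summable_LIMSEQ_zero sums_summable[OF sums]) (simp add: halfplane_def)
  then have "Bseq (\<lambda>n. a (Suc n) / (of_nat (Suc n) powr of_real (\<kappa> + 1)))"
    by (intro convergent_imp_Bseq) (auto simp: convergent_def)
  then obtain B where "\<And>n. norm (a (Suc n) / (of_nat (Suc n) powr of_real (\<kappa> + 1))) \<le> B"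
    unfolding Bseq_def by blast
  then have B: "norm (a (Suc n)) * real (Suc n) powr (- (\<kappa> + 1)) \<le> B" for n
    unfolding nrm by simp
  show thesis
  proof (rule that[of "\<kappa> + 3" "\<lambda>n. a (Suc n)"])
    show "summable (\<lambda>n. norm (a (Suc n)) * real (Suc n) powr (-(\<kappa> + 3)))"
    proof (rule summable_comparison_test')
      have "summable (\<lambda>n. real n powr (-2))" by (subst summable_real_powr_iff) simp
      then have "summable (\<lambda>n. real (Suc n) powr (-2))" by (subst summable_Suc_iff)
      then show "summable (\<lambda>n. B * real (Suc n) powr (-2))" by (rule summable_mult)
      fix n
      have "real (Suc n) powr (-(\<kappa> + 3)) = real (Suc n) powr (-(\<kappa> + 1)) * real (Suc n) powr (-2)"
        by (simp add: algebra_simps flip: powr_add)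
      then show "norm (norm (a (Suc n)) * real (Suc n) powr (-(\<kappa> + 3))) \<le> B * real (Suc n) powr (-2)"
        using mult_right_mono[OF B[of n], of "real (Suc n) powr (-2)"] by (simp add: mult.assoc)
    qed
  qed (use \<kappa> sums in \<open>auto simp: halfplane_def\<close>)
qed

text \<open>A vertical translation rotates n^s by a phase that does not depend on s. This is why
  closeness of finitely many phases gives closeness of translates uniformly in s.\<close>

lemma powr_translate:
  "(of_nat (Suc n) :: complex) powr (s + \<i> * of_real x) = of_nat (Suc n) powr s * cis (x * ln (real (Suc n)))"
proof -
  have "Ln (of_nat (Suc n)) = of_real (ln (real (Suc n)))"
    using Ln_of_real[of "real (Suc n)"] by simp
  then show ?thesis
    by (simp add: powr_def cis_conv_exp ring_distribs exp_add mult_ac del: of_nat_Suc)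
qed

text \<open>The difference of two translates is dominated by the sum of \<open>b n * w n\<close>,
  where \<open>b\<close> majorises the terms on Re s >= K and \<open>w\<close> is the distance of
  the phases. The tail uses w <= 2, the head a net for the phases of log 1, ..., log N.\<close>

lemma Hinf_translates_net_right:
  assumes "f \<in> Hinf"
  obtains K where "K > 0" "\<And>e. e > 0 \<Longrightarrow> \<exists>F. finite F \<and>
     (\<forall>x. \<exists>y\<in>F. \<forall>s. Re s \<ge> K \<longrightarrow> dist (f (s + \<i> * of_real x)) (f (s + \<i> * of_real y)) \<le> e)"
proof -
  obtain a :: "nat \<Rightarrow> complex" and K :: real where K: "K > 0" and sm: "summable (\<lambda>n. norm (a n) * real (Suc n) powr (-K))"
    and sums: "\<And>s. Re s \<ge> K \<Longrightarrow> (\<lambda>n. a n / (of_nat (Suc n) powr s)) sums f s"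
    by (rule Hinf_absolutely_convergent[OF assms]) (rule that; assumption)
  define b where "b = (\<lambda>n. norm (a n) * real (Suc n) powr (-K))"
  have b0: "b n \<ge> 0" for n by (simp add: b_def)
  have sb: "summable b" using sm by (simp add: b_def)
  have "\<exists>F. finite F \<and> (\<forall>x. \<exists>y\<in>F. \<forall>s. Re s \<ge> K \<longrightarrow>
      dist (f (s + \<i> * of_real x)) (f (s + \<i> * of_real y)) \<le> e)" if e: "e > 0" for e
  proof -
    obtain N where N: "(\<Sum>n. b (n + N)) < e / 4"
      using suminf_exist_split[of "e/4" b] e sb suminf_nonneg[OF summable_ignore_initial_segment[OF sb]] b0
      by (metis abs_of_nonneg real_norm_def less_eq_real_def order_refl zero_less_divide_iff zero_less_numeral)
    \<comment> \<open>The head receives e/2, like the tail after doubling e/4. The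
      \<open>+ 1\<close> keeps the quotient meaningful when all \<open>b n\<close> vanish.\<close>
    define d where "d = e / (2 * (suminf b + 1))"
    have sb0: "suminf b \<ge> 0" by (rule suminf_nonneg[OF sb b0])
    then have d: "d > 0" "d * suminf b \<le> e / 2" using e by (auto simp: d_def field_simps)
    obtain F where F: "finite F" "\<And>x. \<exists>y\<in>F. \<forall>l\<in>(\<lambda>n. - ln (real (Suc n))) ` {..<N}. dist (cis (x * l)) (cis (y * l)) < d"
      using finite_cis_net[of "(\<lambda>n. - ln (real (Suc n))) ` {..<N}" d] d by auto
    show ?thesis
    proof (intro exI[of _ F] conjI F(1) allI)
      fix x
      obtain y where y: "y \<in> F" "\<And>n. n < N \<Longrightarrow> dist (cis (x * - ln (real (Suc n)))) (cis (y * - ln (real (Suc n)))) < d"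
        using F(2)[of x] by (auto simp del: of_nat_Suc)
      define w where "w = (\<lambda>n. dist (cis (x * - ln (real (Suc n)))) (cis (y * - ln (real (Suc n)))))"
      have w2: "w n \<le> 2" for n
        unfolding w_def dist_norm by (rule order_trans[OF norm_triangle_ineq4]) simp
      have w0: "w n \<ge> 0" for n by (simp add: w_def)
      have sbw: "summable (\<lambda>n. b n * w n)"
        using b0 w0 w2 by (intro summable_comparison_test'[OF summable_mult[OF sb, of 2]])
          (auto simp: mult.commute[of 2] intro!: mult_left_mono)
      have tot: "(\<Sum>n. b n * w n) \<le> e"
      proof -
        have "(\<Sum>n. b n * w n) = (\<Sum>n. b (n + N) * w (n + N)) + (\<Sum>n<N. b n * w n)"
          by (rule suminf_split_initial_segment[OF sbw])
        moreover have "(\<Sum>n. b (n + N) * w (n + N)) \<le> (\<Sum>n. b (n + N) * 2)"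
          using b0 w2 by (intro suminf_le mult_left_mono summable_mult2
            summable_ignore_initial_segment[OF sbw] summable_ignore_initial_segment[OF sb])
        moreover have "(\<Sum>n. b (n + N) * 2) = (\<Sum>n. b (n + N)) * 2"
          using sb by (intro suminf_mult2[symmetric]) (simp add: summable_iff_shift)
        moreover have "(\<Sum>n<N. b n * w n) \<le> (\<Sum>n<N. b n * d)"
          using y(2) b0 by (intro sum_mono mult_left_mono) (auto simp: w_def less_imp_le simp del: of_nat_Suc)
        moreover have "(\<Sum>n<N. b n * d) \<le> d * suminf b"
          using d sum_le_suminf[OF sb, of "{..<N}"] b0
          by (simp add: mult.commute[of _ d] sum_distrib_left[symmetric] mult_left_mono)
        ultimately show ?thesis using N d by linarith
      qed
      have "dist (f (s + \<i> * of_real x)) (f (s + \<i> * of_real y)) \<le> e" if s: "Re s \<ge> K" for s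
      proof -
        define q where "q = (\<lambda>n. a n / of_nat (Suc n) powr (s + \<i> * of_real x) - a n / of_nat (Suc n) powr (s + \<i> * of_real y))"
        have q: "q sums (f (s + \<i> * of_real x) - f (s + \<i> * of_real y))"
          unfolding q_def using s by (intro sums_diff sums) auto
        have le: "norm (q n) \<le> b n * w n" for n
        proof -
          have "q n = a n / of_nat (Suc n) powr s * (cis (x * - ln (real (Suc n))) - cis (y * - ln (real (Suc n))))"
            unfolding q_def powr_translate by (simp add: field_simps cis_inverse[symmetric] del: of_nat_Suc)
          then have "norm (q n) = norm (a n) / norm (of_nat (Suc n) powr s :: complex) * w n"
            by (simp add: norm_mult norm_divide w_def dist_norm)
          also have "norm (of_nat (Suc n) powr s :: complex) = real (Suc n) powr Re s"
            using norm_powr_real_powr[of "of_nat (Suc n)" s] by simp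
          also have "norm (a n) / real (Suc n) powr Re s = norm (a n) * real (Suc n) powr (- Re s)"
            by (simp add: powr_minus divide_simps)
          also have "\<dots> * w n \<le> b n * w n"
            unfolding b_def using s w0 by (intro mult_right_mono mult_left_mono powr_mono) auto
          finally show ?thesis .
        qed
        have sq: "summable (\<lambda>n. norm (q n))"
          by (rule summable_comparison_test'[OF sbw, of 0]) (use le in auto)
        have "norm (suminf q) \<le> (\<Sum>n. norm (q n))" by (rule summable_norm[OF sq])
        also have "\<dots> \<le> (\<Sum>n. b n * w n)" by (rule suminf_le[OF le sq sbw])
        also have "\<dots> \<le> e" by (rule tot)
        finally show ?thesis using sums_unique[OF q] by (simp add: dist_norm)
      qed
      then show "\<exists>y\<in>F. \<forall>s. Re s \<ge> K \<longrightarrow> dist (f (s + \<i> * of_real x)) (f (s + \<i> * of_real y)) \<le> e"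
        using y(1) by blast
    qed
  qed
  then show thesis using that K by blast
qed

section \<open>Cauchy estimates and almost periodicity on every half-plane Re s >= \<kappa>\<close>

lemma Hinf_holomorphic: "f \<in> Hinf \<Longrightarrow> f holomorphic_on halfplane 0"
  by (simp add: Hinf_def)

lemma Hinf_bounded:
  assumes "f \<in> Hinf"
  obtains M where "M > 0" "\<And>s. Re s > 0 \<Longrightarrow> norm (f s) \<le> M"
  using assms unfolding Hinf_def bounded_pos by (auto simp: halfplane_def)

lemma norm_deriv_le_halfplane:
  assumes h: "h holomorphic_on halfplane 0" and r: "0 < r" "r < Re s"
    and B: "\<And>z. Re z \<ge> Re s - r \<Longrightarrow> norm (h z) \<le> B"
  shows "norm (deriv h s) \<le> B / r"
proof -
  have re: "Re z \<ge> Re s - r" if "dist s z \<le> r" for z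
    using abs_Re_le_cmod[of "s - z"] that by (simp add: dist_norm)
  then have sub: "cball s r \<subseteq> halfplane 0" using r by (fastforce simp: halfplane_def)
  have "norm ((deriv ^^ 1) h s) \<le> fact 1 * B / r ^ 1"
  proof (rule Cauchy_inequality)
    show "h holomorphic_on ball s r" using sub by (intro holomorphic_on_subset[OF h]) auto
    show "continuous_on (cball s r) h"
      using sub by (intro holomorphic_on_imp_continuous_on holomorphic_on_subset[OF h])
    show "norm (h x) \<le> B" if "norm (s - x) = r" for x
      using that re[of x] B by (simp add: dist_norm)
  qed (use r in auto)
  then show ?thesis by simp
qed

lemma Complex_add_imaginary: "Complex x (t + a) = Complex x t + \<i> * of_real a"
  by (simp add: complex_eq_iff)

lemma has_field_derivative_translate:
  assumes h: "h holomorphic_on halfplane 0" and s: "Re s > 0"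
  shows "((\<lambda>s. h (s + \<i> * of_real a)) has_field_derivative deriv h (s + \<i> * of_real a)) (at s)"
  using holomorphic_derivI[OF h open_halfplane, of "s + \<i> * of_real a" UNIV] s
  by (simp add: halfplane_def DERIV_shift)

text \<open>The net found far to the right is already a net here. The difference \<open>h\<close> of
  two translates is bounded by 2 M and at most \<eta> to the right of K, hence less than c on Re s
  >= \<kappa>/2; a Cauchy estimate on discs of radius \<kappa>/4 then handles the derivative. The
  number \<eta> depends only on M, K, \<kappa> and c, so it is fixed before the net is
  chosen.\<close>

lemma Hinf_unif_almost_periodic:
  assumes f: "f \<in> Hinf" and \<kappa>: "\<kappa> > 0"
  shows "unif_almost_periodic {\<kappa>..} (\<lambda>\<sigma> t. (f (Complex \<sigma> t), deriv f (Complex \<sigma> t)))"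
  unfolding unif_almost_periodic_def
proof (intro allI impI)
  fix e :: real assume e: "e > 0"
  obtain M where M: "\<And>s. Re s > 0 \<Longrightarrow> norm (f s) \<le> M" using Hinf_bounded[OF f] by blast
  obtain K where "K > 0" and net: "\<And>e. e > 0 \<Longrightarrow> \<exists>F. finite F \<and>
     (\<forall>x. \<exists>y\<in>F. \<forall>s. Re s \<ge> K \<longrightarrow> dist (f (s + \<i> * of_real x)) (f (s + \<i> * of_real y)) \<le> e)"
    by (rule Hinf_translates_net_right[OF f]) (rule that; assumption)
  \<comment> \<open>The second entry makes the Cauchy bound c / (\<kappa>/4) at most e/3.\<close>
  define c where "c = min (e / 3) (e * \<kappa> / 12)"
  have c: "c > 0" "c \<le> e / 3" "c / (\<kappa> / 4) \<le> e / 3"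
    using e \<kappa> by (auto simp: c_def field_simps min_def)
  obtain \<eta> where \<eta>: "\<eta> > 0" and small: "\<And>h s. h holomorphic_on halfplane 0 \<Longrightarrow>
    (\<And>s. s \<in> halfplane 0 \<Longrightarrow> norm (h s) \<le> 2 * M) \<Longrightarrow>
    (\<And>s. s \<in> halfplane K \<Longrightarrow> norm (h s) \<le> \<eta>) \<Longrightarrow> Re s \<ge> \<kappa> / 2 \<Longrightarrow> norm (h s) < c"
    using bounded_holomorphic_small[of "\<kappa>/2" c "2 * M" K] \<kappa> c(1) by (metis half_gt_zero)
  obtain F where F: "finite F"
    "\<And>x. \<exists>y\<in>F. \<forall>s. Re s \<ge> K \<longrightarrow> dist (f (s + \<i> * of_real x)) (f (s + \<i> * of_real y)) \<le> \<eta>"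
    using net[OF \<eta>] by blast
  show "\<exists>F. finite F \<and> (\<forall>a. \<exists>b\<in>F. \<forall>\<sigma>\<in>{\<kappa>..}. \<forall>t.
        dist (f (Complex \<sigma> (t + a)), deriv f (Complex \<sigma> (t + a)))
             (f (Complex \<sigma> (t + b)), deriv f (Complex \<sigma> (t + b))) < e)"
  proof (intro exI[of _ F] conjI F(1) allI)
    fix a
    obtain b where b: "b \<in> F"
      "\<And>s. Re s \<ge> K \<Longrightarrow> dist (f (s + \<i> * of_real a)) (f (s + \<i> * of_real b)) \<le> \<eta>"
      using F(2) by blast
    define h where "h = (\<lambda>s. f (s + \<i> * of_real a) - f (s + \<i> * of_real b))"
    have dh: "(h has_field_derivative deriv f (s + \<i> * of_real a) - deriv f (s + \<i> * of_real b)) (at s)"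
      if "Re s > 0" for s
      unfolding h_def using that Hinf_holomorphic[OF f]
      by (intro DERIV_diff has_field_derivative_translate)
    have hol: "h holomorphic_on halfplane 0"
      unfolding holomorphic_on_open[OF open_halfplane] using dh by (auto simp: halfplane_def)
    have hc: "norm (h s) < c" if "Re s \<ge> \<kappa> / 2" for s
    proof (rule small[OF hol _ _ that])
      show "norm (h s) \<le> 2 * M" if "s \<in> halfplane 0" for s
      proof -
        have "norm (h s) \<le> norm (f (s + \<i> * of_real a)) + norm (f (s + \<i> * of_real b))"
          unfolding h_def by (rule norm_triangle_ineq4)
        also have "\<dots> \<le> M + M" using that by (intro add_mono M) (auto simp: halfplane_def)
        finally show ?thesis by simp
      qed
      show "norm (h s) \<le> \<eta>" if "s \<in> halfplane K" for s
        using b(2)[of s] that by (simp add: h_def dist_norm halfplane_def)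
    qed
    have "dist (f (Complex \<sigma> (t + a)), deriv f (Complex \<sigma> (t + a)))
             (f (Complex \<sigma> (t + b)), deriv f (Complex \<sigma> (t + b))) < e" if "\<sigma> \<ge> \<kappa>" for \<sigma> t
    proof -
      let ?s = "Complex \<sigma> t"
      have "norm (deriv h ?s) \<le> c / (\<kappa> / 4)"
        using that \<kappa> by (intro norm_deriv_le_halfplane hol less_imp_le[OF hc]) auto
      then have "norm (deriv h ?s) \<le> e / 3" using c by linarith
      moreover have "deriv h ?s = deriv f (?s + \<i> * of_real a) - deriv f (?s + \<i> * of_real b)"
        using that \<kappa> by (intro DERIV_imp_deriv dh) auto
      moreover have "norm (h ?s) < e / 3" using hc[of ?s] c(2) that \<kappa> by auto
      ultimately have "dist (f (?s + \<i> * of_real a)) (f (?s + \<i> * of_real b)) < e / 3"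
        "dist (deriv f (?s + \<i> * of_real a)) (deriv f (?s + \<i> * of_real b)) \<le> e / 3"
        by (auto simp: h_def dist_norm)
      moreover have "dist (u, v) (u', v') < e" if "dist u u' < e / 3" "dist v v' \<le> e / 3"
        for u u' v v' :: complex
      proof -
        have "dist (u, v) (u', v') \<le> dist u u' + dist v v'"
          unfolding dist_Pair_Pair by (rule sqrt_sum_squares_le_sum) auto
        then show ?thesis using that e by linarith
      qed
      ultimately show ?thesis
        unfolding Complex_add_imaginary by blast
    qed
    then show "\<exists>b\<in>F. \<forall>\<sigma>\<in>{\<kappa>..}. \<forall>t.
        dist (f (Complex \<sigma> (t + a)), deriv f (Complex \<sigma> (t + a)))
             (f (Complex \<sigma> (t + b)), deriv f (Complex \<sigma> (t + b))) < e"
      using b(1) by auto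
  qed
qed

section \<open>Exponential decay of the derivatives\<close>

definition decays :: "(complex \<Rightarrow> complex) \<Rightarrow> bool" where
  "decays h \<longleftrightarrow> (\<forall>\<kappa>>0. \<exists>C>0. \<forall>s. Re s \<ge> \<kappa> \<longrightarrow> norm (h s) \<le> C * exp (- ln 2 * Re s))"

text \<open>Cauchy's estimate on discs of radius \<kappa>/2 costs only a constant factor in the
  exponential. This is why the constant in \<open>decays\<close> may depend on \<kappa>: derivatives
  need not stay bounded near Re s = 0.\<close>

lemma decays_deriv:
  assumes h: "h holomorphic_on halfplane 0" and d: "decays h"
  shows "decays (deriv h)"
  unfolding decays_def
proof (intro allI impI)
  fix \<kappa> :: real assume \<kappa>: "\<kappa> > 0"
  obtain C where C: "C > 0" "\<And>s. Re s \<ge> \<kappa> / 2 \<Longrightarrow> norm (h s) \<le> C * exp (- ln 2 * Re s)"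
    using d \<kappa> unfolding decays_def by (metis half_gt_zero)
  have "norm (deriv h s) \<le> (C * exp (ln 2 * (\<kappa> / 2)) / (\<kappa> / 2)) * exp (- ln 2 * Re s)" if s: "Re s \<ge> \<kappa>" for s
  proof -
    have "norm (deriv h s) \<le> (C * exp (- ln 2 * (Re s - \<kappa> / 2))) / (\<kappa> / 2)"
    proof (rule norm_deriv_le_halfplane[OF h])
      show "norm (h z) \<le> C * exp (- ln 2 * (Re s - \<kappa> / 2))" if "Re s - \<kappa> / 2 \<le> Re z" for z
      proof -
        have "norm (h z) \<le> C * exp (- ln 2 * Re z)" using that s by (intro C(2)) auto
        also have "\<dots> \<le> C * exp (- ln 2 * (Re s - \<kappa> / 2))" using C(1) that by simp
        finally show ?thesis .
      qed
    qed (use \<kappa> s in auto)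
    also have "exp (- ln 2 * (Re s - \<kappa> / 2)) = exp (ln 2 * (\<kappa> / 2)) * exp (- ln 2 * Re s)"
      by (simp add: algebra_simps flip: exp_add)
    finally show ?thesis by (simp add: field_simps)
  qed
  moreover have "C * exp (ln 2 * (\<kappa> / 2)) / (\<kappa> / 2) > 0" using C(1) \<kappa> by simp
  ultimately show "\<exists>C>0. \<forall>s. Re s \<ge> \<kappa> \<longrightarrow> norm (deriv h s) \<le> C * exp (- ln 2 * Re s)" by blast
qed

text \<open>The constant is the coefficient of 1^(-s). Every other term is a multiple of m^(-s) with
  m >= 2 and gains at least the factor 2^(-(Re s - K)) over its size at abscissa K, which is the
  origin of the rate ln 2. For 0 < Re s < K boundedness of f suffices, since the exponential is
  bounded below there. The two summands of \<open>C\<close> serve the two cases.\<close>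

lemma Hinf_decays:
  assumes f: "f \<in> Hinf"
  obtains c where "decays (\<lambda>s. f s - c)"
proof -
  obtain a :: "nat \<Rightarrow> complex" and K :: real where K: "K > 0"
    and sm: "summable (\<lambda>n. norm (a n) * real (Suc n) powr (-K))"
    and sums: "\<And>s. Re s \<ge> K \<Longrightarrow> (\<lambda>n. a n / (of_nat (Suc n) powr s)) sums f s"
    by (rule Hinf_absolutely_convergent[OF f]) (rule that; assumption)
  obtain M where M: "M > 0" "\<And>s. Re s > 0 \<Longrightarrow> norm (f s) \<le> M" using Hinf_bounded[OF f] by blast
  define b where "b = (\<lambda>n. norm (a n) * real (Suc n) powr (-K))"
  have sb: "summable (\<lambda>n. b (Suc n))" unfolding summable_Suc_iff using sm by (simp add: b_def)
  define B where "B = (\<Sum>n. b (Suc n)) * exp (ln 2 * K)"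
  have B0: "B \<ge> 0" unfolding B_def by (intro mult_nonneg_nonneg suminf_nonneg sb) (auto simp: b_def)
  define C where "C = B + (M + norm (a 0)) * exp (ln 2 * K)"
  have C0: "C > 0" unfolding C_def using B0 M(1) by (intro add_nonneg_pos mult_pos_pos add_pos_nonneg) auto
  have "norm (f s - a 0) \<le> C * exp (- ln 2 * Re s)" if s: "Re s > 0" for s
  proof (cases "Re s \<ge> K")
    case True
    let ?q = "\<lambda>n. a (Suc n) / (of_nat (Suc (Suc n)) powr s)"
    have q: "?q sums (f s - a 0)"
      using sums_Suc_iff[of "\<lambda>n. a n / (of_nat (Suc n) powr s)"] sums[OF True]
      by (simp add: sums_Suc_iff)
    have le: "norm (?q n) \<le> b (Suc n) * exp (- ln 2 * (Re s - K))" for n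
    proof -
      have "norm (?q n) = norm (a (Suc n)) / real (Suc (Suc n)) powr Re s"
        using norm_powr_real_powr[of "of_nat (Suc (Suc n))" s] by (simp add: norm_divide)
      also have "\<dots> = norm (a (Suc n)) * real (Suc (Suc n)) powr (- Re s)"
        by (simp add: powr_minus divide_simps)
      also have "real (Suc (Suc n)) powr (- Re s) = real (Suc (Suc n)) powr (-K) * real (Suc (Suc n)) powr (-(Re s - K))"
        by (simp flip: powr_add)
      also have "real (Suc (Suc n)) powr (-(Re s - K)) \<le> 2 powr (-(Re s - K))"
        using True by (intro powr_mono2') auto
      also have "2 powr (-(Re s - K)) = exp (- ln 2 * (Re s - K))"
        by (simp add: powr_def algebra_simps)
      finally show ?thesis by (simp add: b_def mult.assoc mult_left_mono)
    qed
    have sb': "summable (\<lambda>n. b (Suc n) * exp (- ln 2 * (Re s - K)))"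
      by (rule summable_mult2[OF sb])
    have sq: "summable (\<lambda>n. norm (?q n))"
      by (rule summable_comparison_test'[OF sb', of 0]) (use le in auto)
    have "norm (suminf ?q) \<le> (\<Sum>n. norm (?q n))" by (rule summable_norm[OF sq])
    also have "\<dots> \<le> (\<Sum>n. b (Suc n) * exp (- ln 2 * (Re s - K)))" by (rule suminf_le[OF le sq sb'])
    also have "\<dots> = (\<Sum>n. b (Suc n)) * exp (- ln 2 * (Re s - K))" by (rule suminf_mult2[OF sb, symmetric])
    also have "\<dots> = B * exp (- ln 2 * Re s)"
      by (simp add: B_def algebra_simps flip: exp_add)
    also have "\<dots> \<le> C * exp (- ln 2 * Re s)"
      using M(1) by (simp add: C_def)
    finally show ?thesis using sums_unique[OF q] by simp
  next
    case False
    have "norm (f s - a 0) \<le> M + norm (a 0)"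
      using norm_triangle_ineq4[of "f s" "a 0"] M(2)[OF s] by linarith
    also have "\<dots> \<le> (M + norm (a 0)) * exp (ln 2 * K - ln 2 * Re s)"
      using False M(1) by (auto simp: mult_le_cancel_left1 not_less intro!: add_nonneg_nonneg)
    also have "\<dots> = (M + norm (a 0)) * exp (ln 2 * K) * exp (- ln 2 * Re s)"
      by (simp flip: exp_add)
    also have "\<dots> \<le> C * exp (- ln 2 * Re s)"
      using B0 by (intro mult_right_mono) (auto simp: C_def)
    finally show ?thesis .
  qed
  then have "decays (\<lambda>s. f s - a 0)"
    unfolding decays_def using C0 by (metis less_le_trans)
  then show thesis by (rule that)
qed

lemma Hinf_deriv_decays:
  assumes f: "f \<in> Hinf"
  shows "decays (deriv f)" "decays (deriv (deriv f))"
proof -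
  note hol = Hinf_holomorphic[OF f]
  obtain c where c: "decays (\<lambda>s. f s - c)" by (rule Hinf_decays[OF f])
  have "decays (deriv (\<lambda>s. f s - c))"
    by (intro decays_deriv c holomorphic_intros hol)
  moreover have "deriv (\<lambda>s. f s - c) s = deriv f s" if "Re s > 0" for s
  proof -
    have "(f has_field_derivative deriv f s) (at s)"
      using that by (intro holomorphic_derivI[OF hol open_halfplane]) (simp add: halfplane_def)
    from DERIV_diff[OF this DERIV_const] show ?thesis by (auto intro: DERIV_imp_deriv)
  qed
  ultimately show 1: "decays (deriv f)"
    unfolding decays_def by (metis less_le_trans)
  show "decays (deriv (deriv f))"
    by (intro decays_deriv 1 holomorphic_deriv hol open_halfplane)
qed

section \<open>The regularised gradient\<close>

text \<open>With \<open>u = (\<bar>f\<bar>\<^sup>2 + e\<^sup>2)\<^bsup>p/2\<^esup>\<close>, the number \<open>reg_grad p e (f s) (f' s)\<close> equals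
  \<open>\<partial>\<^sub>\<sigma>u - \<i> \<partial>\<^sub>tu\<close>. For \<open>e = 0\<close> the convention \<open>0 powr x = 0\<close> gives the value \<open>0\<close> at the zeros of \<open>f\<close>,
  which is a junk value only for \<open>p = 1\<close>, where \<open>\<bar>f\<bar>\<close> is not differentiable at simple zeros.\<close>

definition reg_grad :: "real \<Rightarrow> real \<Rightarrow> complex \<Rightarrow> complex \<Rightarrow> complex" where
  "reg_grad p e z w = of_real (p * ((norm z)\<^sup>2 + e\<^sup>2) powr (p / 2 - 1)) * (cnj z * w)"

text \<open>Half a power of y = |z|^2 + e^2 absorbs |z| and leaves the exponent (p - 1)/2, which is
  nonnegative as p >= 1. Hence a bound uniform in e, including e = 0, with a factor |w| that will
  supply the decay. For y = 0 the convention \<open>0 powr x = 0\<close> makes the left side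
  vanish.\<close>

lemma norm_reg_grad_le:
  assumes p: "1 \<le> p" and B: "norm z \<le> B" and e: "0 \<le> e" "e \<le> 1"
  shows "norm (reg_grad p e z w) \<le> p * (B\<^sup>2 + 1) powr ((p - 1) / 2) * norm w"
proof -
  define y where "y = (norm z)\<^sup>2 + e\<^sup>2"
  have "y powr (p / 2 - 1) * norm z \<le> (B\<^sup>2 + 1) powr ((p - 1) / 2)"
  proof (cases "y = 0")
    case False
    then have y: "y > 0" by (simp add: y_def less_le)
    have "norm z \<le> sqrt y" by (intro real_le_rsqrt) (simp add: y_def)
    then have "y powr (p / 2 - 1) * norm z \<le> y powr (p / 2 - 1) * y powr (1 / 2)"
      using y by (intro mult_left_mono) (auto simp: powr_half_sqrt)
    also have "\<dots> = y powr ((p - 1) / 2)" by (simp add: field_simps flip: powr_add)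
    also have "\<dots> \<le> (B\<^sup>2 + 1) powr ((p - 1) / 2)"
    proof (rule powr_mono2)
      have "(norm z)\<^sup>2 \<le> B\<^sup>2" using B by (intro power_mono) auto
      moreover have "e\<^sup>2 \<le> 1" using e by (simp add: power_le_one)
      ultimately show "y \<le> B\<^sup>2 + 1" by (simp add: y_def)
    qed (use p y in auto)
    finally show ?thesis .
  qed simp
  then have "p * (y powr (p / 2 - 1) * norm z) * norm w \<le> p * (B\<^sup>2 + 1) powr ((p - 1) / 2) * norm w"
    using p by (intro mult_right_mono mult_left_mono) auto
  then show ?thesis
    using p by (simp add: reg_grad_def y_def[symmetric] norm_mult mult.assoc)
qed

lemma tendsto_reg_grad:
  assumes "(z \<longlongrightarrow> z') F" "(w \<longlongrightarrow> w') F" "(e \<longlongrightarrow> e') F" "(norm z')\<^sup>2 + e'\<^sup>2 \<noteq> 0"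
  shows "((\<lambda>k. reg_grad p (e k) (z k) (w k)) \<longlongrightarrow> reg_grad p e' z' w') F"
  unfolding reg_grad_def using assms by (intro tendsto_intros) auto

text \<open>If z' is nonzero, both terms have the same limit; if z' and w' both vanish, both terms
  are O(|w k|). In the remaining case p = 1 really fails: \<open>reg_grad 1 0 z w\<close> has
  modulus |w| for every nonzero z, while the regularised value is small once |z| is small compared
  with e.\<close>

lemma tendsto_reg_grad_diff_zero:
  fixes z w :: "nat \<Rightarrow> complex" and e :: "nat \<Rightarrow> real"
  assumes p: "1 \<le> p" and lim: "z \<longlonglongrightarrow> z'" "w \<longlonglongrightarrow> w'" "e \<longlonglongrightarrow> 0"
    and e: "\<And>k. 0 \<le> e k" "\<And>k. e k \<le> 1" and "z' \<noteq> 0 \<or> w' = 0"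
  shows "(\<lambda>k. reg_grad p (e k) (z k) (w k) - reg_grad p 0 (z k) (w k)) \<longlonglongrightarrow> 0"
proof (cases "z' = 0")
  case False
  have "(\<lambda>k. reg_grad p (e k) (z k) (w k) - reg_grad p 0 (z k) (w k)) \<longlonglongrightarrow> reg_grad p 0 z' w' - reg_grad p 0 z' w'"
    using False by (intro tendsto_diff tendsto_reg_grad lim tendsto_const) auto
  then show ?thesis by simp
next
  case True
  then have w': "w' = 0" using assms by simp
  obtain B where B: "\<And>k. norm (z k) \<le> B"
    using convergent_imp_Bseq[of z] lim(1) unfolding convergent_def Bseq_def by blast
  define C where "C = p * (B\<^sup>2 + 1) powr ((p - 1) / 2)"
  show ?thesis
  proof (rule Lim_null_comparison)
    have "norm (reg_grad p (e k) (z k) (w k) - reg_grad p 0 (z k) (w k)) \<le> 2 * C * norm (w k)" for k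
    proof -
      have "norm (reg_grad p (e k) (z k) (w k) - reg_grad p 0 (z k) (w k)) \<le> norm (reg_grad p (e k) (z k) (w k)) + norm (reg_grad p 0 (z k) (w k))"
        by (rule norm_triangle_ineq4)
      also have "\<dots> \<le> C * norm (w k) + C * norm (w k)"
        unfolding C_def using p e B by (intro add_mono norm_reg_grad_le) auto
      finally show ?thesis by simp
    qed
    then show "\<forall>\<^sub>F k in sequentially. norm (reg_grad p (e k) (z k) (w k) - reg_grad p 0 (z k) (w k)) \<le> 2 * C * norm (w k)" by simp
    show "(\<lambda>k. 2 * C * norm (w k)) \<longlonglongrightarrow> 0"
      using tendsto_mult_right_zero[OF tendsto_norm_zero, of w sequentially "2 * C"] lim(2) w' by simp
  qed
qed

lemma borel_measurable_reg_grad [measurable (raw)]: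
  assumes [measurable]: "u \<in> borel_measurable M" "v \<in> borel_measurable M"
  shows "(\<lambda>x. reg_grad p e (u x) (v x)) \<in> borel_measurable M"
proof -
  have [measurable]: "cnj \<in> borel_measurable borel"
    by (intro borel_measurable_continuous_onI continuous_intros)
  have [measurable]: "complex_of_real \<in> borel_measurable borel"
    by (intro borel_measurable_continuous_onI continuous_intros)
  show ?thesis unfolding reg_grad_def by measurable
qed

section \<open>Simple zeros, and closeness in mean of the regularised gradient\<close>

lemma countable_simple_zeros:
  assumes g: "g holomorphic_on S" and S: "open S" "connected S"
  shows "countable {z\<in>S. g z = 0 \<and> deriv g z \<noteq> 0}"
proof (cases "g constant_on S")
  \<comment> \<open>A constant g, in particular the zero function, has derivative 0 and contributes
    no points. This is why only zeros with nonzero derivative are counted.\<close>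
  case True
  then obtain c where c: "\<And>z. z \<in> S \<Longrightarrow> g z = c" by (auto simp: constant_on_def)
  have "deriv g z = 0" if "z \<in> S" for z
  proof -
    have "(g has_field_derivative 0) (at z)"
      by (rule has_field_derivative_transform_within_open[OF DERIV_const S(1) that]) (use c in auto)
    then show ?thesis by (rule DERIV_imp_deriv)
  qed
  then have "{z\<in>S. g z = 0 \<and> deriv g z \<noteq> 0} = {}" by blast
  then show ?thesis by (simp only: countable_empty)
next
  case False
  obtain C where "\<And>n::nat. compact (C n)" "\<Union>(range C) = S"
    by (rule open_Union_compact_subsets[OF S(1)]) (rule that; assumption)
  then have "fsigma S" unfolding fsigma_Union_compact by (intro exI[of _ C]) auto
  then have "countable {z\<in>S. g z = 0}"
    by (intro holomorphic_countable_zeros g S False)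
  then show ?thesis by (rule countable_subset[rotated]) auto
qed

lemma continuous_on_vertical_line:
  assumes "h holomorphic_on halfplane 0" and "\<sigma> > 0" and "continuous_on A v"
  shows "continuous_on A (\<lambda>t. h (Complex \<sigma> (v t)))"
  by (rule continuous_on_compose2[OF holomorphic_on_imp_continuous_on[OF assms(1)]])
    (use assms in \<open>auto simp: halfplane_def intro!: continuous_intros\<close>)

lemma AE_simple_zero_line:
  assumes g: "g holomorphic_on halfplane k" and \<sigma>: "\<sigma> > k"
  shows "AE t in lborel. g (Complex \<sigma> t) \<noteq> 0 \<or> deriv g (Complex \<sigma> t) = 0"
proof -
  have "countable {z\<in>halfplane k. g z = 0 \<and> deriv g z \<noteq> 0}"
    by (intro countable_simple_zeros g open_halfplane connected_halfplane)
  then have "countable (Im ` {z\<in>halfplane k. g z = 0 \<and> deriv g z \<noteq> 0})" by simp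
  then have "Im ` {z\<in>halfplane k. g z = 0 \<and> deriv g z \<noteq> 0} \<in> null_sets lborel"
    by (rule countable_imp_null_set_lborel)
  then show ?thesis
  proof (rule AE_I')
    show "{t \<in> space lborel. \<not> (g (Complex \<sigma> t) \<noteq> 0 \<or> deriv g (Complex \<sigma> t) = 0)}
      \<subseteq> Im ` {z\<in>halfplane k. g z = 0 \<and> deriv g z \<noteq> 0}"
    proof
      fix t assume "t \<in> {t \<in> space lborel. \<not> (g (Complex \<sigma> t) \<noteq> 0 \<or> deriv g (Complex \<sigma> t) = 0)}"
      then show "t \<in> Im ` {z\<in>halfplane k. g z = 0 \<and> deriv g z \<noteq> 0}"
        using \<sigma> by (intro image_eqI[of _ _ "Complex \<sigma> t"]) (auto simp: halfplane_def)
    qed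
  qed
qed

lemma decays_bounded:
  assumes "decays h" and "\<kappa> > 0"
  obtains C where "C > 0" "\<And>s. Re s \<ge> \<kappa> \<Longrightarrow> norm (h s) \<le> C * exp (- ln 2 * Re s)"
    "\<And>s. Re s \<ge> \<kappa> \<Longrightarrow> norm (h s) \<le> C"
proof -
  obtain C where C: "C > 0" "\<And>s. Re s \<ge> \<kappa> \<Longrightarrow> norm (h s) \<le> C * exp (- ln 2 * Re s)"
    using assms unfolding decays_def by blast
  moreover have "norm (h s) \<le> C" if "Re s \<ge> \<kappa>" for s
  proof -
    have "C * exp (- ln 2 * Re s) \<le> C * 1" using that assms(2) C(1) by (intro mult_left_mono) auto
    then show ?thesis using C(2)[OF that] by linarith
  qed
  ultimately show thesis using that by blast
qed

lemma set_integrable_bounded: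
  fixes q :: "real \<Rightarrow> 'a::{banach, second_countable_topology}"
  assumes "q \<in> borel_measurable borel" and "\<And>t. norm (q t) \<le> B"
  shows "set_integrable lborel {x..y} q"
  unfolding set_integrable_def
  by (rule integrableI_bounded_set_indicator[where B = B]) (use assms in \<open>auto simp: emeasure_lborel_Icc_eq\<close>)

text \<open>If windows at \<open>Complex (\<sigma> k) (a k)\<close> violated the bound with e k
  tending to 0, some translates of f would converge with their derivatives to a limit g. Almost
  every point of the window satisfies the condition of \<open>tendsto_reg_grad_diff_zero\<close>, so
  dominated convergence gives a contradiction. Compactness thus replaces a count of the zeros of f
  in windows, and yields uniformity in \<open>a\<close> and in the unbounded variable
  \<sigma>.\<close>

lemma reg_grad_unit_interval_small:
  assumes f: "f \<in> Hinf" and p: "1 \<le> p" and \<kappa>: "\<kappa> > 0" and \<eta>: "\<eta> > 0"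
  shows "\<exists>d>0. \<forall>e \<sigma> a. 0 < e \<longrightarrow> e < d \<longrightarrow> \<sigma> \<ge> \<kappa> \<longrightarrow> (LBINT t:{0..1}. norm
      (reg_grad p e (f (Complex \<sigma> (t + a))) (deriv f (Complex \<sigma> (t + a))) -
       reg_grad p 0 (f (Complex \<sigma> (t + a))) (deriv f (Complex \<sigma> (t + a))))) < \<eta>"
proof (rule ccontr)
  assume neg: "\<not> ?thesis"
  let ?q = "\<lambda>e \<sigma> a t. norm (reg_grad p e (f (Complex \<sigma> (t + a))) (deriv f (Complex \<sigma> (t + a))) -
       reg_grad p 0 (f (Complex \<sigma> (t + a))) (deriv f (Complex \<sigma> (t + a))))"
  define J where "J = (\<lambda>e \<sigma> a. LBINT t:{0..1}. ?q e \<sigma> a t)"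
  have "\<exists>e \<sigma> a. 0 < e \<and> e < inverse (real (Suc k)) \<and> \<sigma> \<ge> \<kappa> \<and> J e \<sigma> a \<ge> \<eta>" for k
  proof -
    have "inverse (real (Suc k)) > 0" by simp
    then show ?thesis using neg unfolding J_def by (meson not_le)
  qed
  then obtain e \<sigma> a where e: "\<And>k. 0 < e k" "\<And>k. e k < inverse (real (Suc k))" and \<sigma>: "\<And>k. \<sigma> k \<ge> \<kappa>"
    and ge: "\<And>k. J (e k) (\<sigma> k) (a k) \<ge> \<eta>" by metis
  have e1: "e k \<le> 1" for k
    using e(2)[of k] by (rule order.trans[OF less_imp_le]) (simp add: inverse_le_1_iff)
  have elim: "e \<longlonglongrightarrow> 0"
    by (rule tendsto_sandwich[OF _ _ tendsto_const LIMSEQ_inverse_real_of_nat])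
      (use e in \<open>auto intro!: always_eventually less_imp_le\<close>)
  note hol = Hinf_holomorphic[OF f]
  obtain M where M: "M > 0" "\<And>s. Re s > 0 \<Longrightarrow> norm (f s) \<le> M" using Hinf_bounded[OF f] by blast
  obtain C where C: "C > 0" "\<And>s. Re s \<ge> \<kappa> \<Longrightarrow> norm (deriv f s) \<le> C"
    using decays_bounded[OF Hinf_deriv_decays(1)[OF f] \<kappa>] by blast
  obtain g r where g: "g holomorphic_on halfplane (-\<kappa>)" and r: "strict_mono (r :: nat \<Rightarrow> nat)"
    and lim: "\<And>z. z \<in> halfplane (-\<kappa>) \<Longrightarrow> (\<lambda>k. f (z + Complex (\<sigma> (r k)) (a (r k)))) \<longlonglongrightarrow> g z"
    and lim': "\<And>z. z \<in> halfplane (-\<kappa>) \<Longrightarrow> (\<lambda>k. deriv f (z + Complex (\<sigma> (r k)) (a (r k)))) \<longlonglongrightarrow> deriv g z"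
  proof (rule Montel_translates[where h = "\<lambda>_. f" and c = "\<lambda>k. Complex (\<sigma> k) (a k)" and M = M and \<kappa> = \<kappa>])
    show "\<kappa> \<le> Re (Complex (\<sigma> k) (a k))" for k using \<sigma> by simp
    show "cmod (f s) \<le> M" if "s \<in> halfplane 0" for s using M that by (simp add: halfplane_def)
  qed (use hol in auto)
  define Q where "Q = (\<lambda>k. ?q (e (r k)) (\<sigma> (r k)) (a (r k)))"
  \<comment> \<open>The translation has moved every window to the segment from 0 to i, which lies
    inside the domain of g since \<kappa> > 0.\<close>
  have z: "Complex 0 t \<in> halfplane (-\<kappa>)" for t using \<kappa> by (simp add: halfplane_def)
  have shift: "Complex 0 t + Complex x y = Complex x (t + y)" for t x y by (simp add: complex_eq_iff)
  have [measurable]: "(\<lambda>t. f (Complex (\<sigma> k) (t + a k))) \<in> borel_measurable borel"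
    "(\<lambda>t. deriv f (Complex (\<sigma> k) (t + a k))) \<in> borel_measurable borel" for k
    using \<sigma>[of k] \<kappa> by (intro borel_measurable_continuous_onI continuous_on_vertical_line
        hol holomorphic_deriv[OF hol open_halfplane] continuous_intros; simp)+
  have [measurable]: "Q k \<in> borel_measurable borel" for k
    unfolding Q_def by measurable
  define D where "D = p * (M\<^sup>2 + 1) powr ((p - 1) / 2) * C"
  have W_le: "norm (reg_grad p x (f s) (deriv f s)) \<le> D" if "Re s \<ge> \<kappa>" "0 \<le> x" "x \<le> 1" for x s
  proof -
    have "norm (reg_grad p x (f s) (deriv f s)) \<le> p * (M\<^sup>2 + 1) powr ((p - 1) / 2) * norm (deriv f s)"
      using that \<kappa> by (intro norm_reg_grad_le p M) auto
    also have "\<dots> \<le> D" unfolding D_def using C(2)[OF that(1)] p by (intro mult_left_mono) auto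
    finally show ?thesis .
  qed
  have Q_le: "norm (Q k t) \<le> 2 * D" for k t
  proof -
    let ?s = "Complex (\<sigma> (r k)) (t + a (r k))"
    have "Q k t \<le> norm (reg_grad p (e (r k)) (f ?s) (deriv f ?s)) + norm (reg_grad p 0 (f ?s) (deriv f ?s))"
      unfolding Q_def by (rule norm_triangle_ineq4)
    also have "\<dots> \<le> D + D" using e1 less_imp_le[OF e(1)] \<sigma> by (intro add_mono W_le) auto
    finally show ?thesis by (simp add: Q_def)
  qed
  have "(\<lambda>k. LBINT t:{0..1}. Q k t) \<longlonglongrightarrow> (LBINT t:{0..1::real}. (0::real))"
    unfolding set_lebesgue_integral_def
  proof (rule integral_dominated_convergence[where f = "\<lambda>t::real. indicator {0..1} t *\<^sub>R (0::real)"
        and w = "\<lambda>t::real. indicator {0..1} t *\<^sub>R (2 * D)"])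
    show "integrable lborel (\<lambda>t::real. indicator {0..1} t *\<^sub>R (2 * D))"
      by (rule set_integrable_bounded[of "\<lambda>_. 2 * D" "\<bar>2 * D\<bar>" 0 1, unfolded set_integrable_def]) auto
    show "AE t in lborel. norm (indicator {0..1} t *\<^sub>R Q k t) \<le> indicator {0..1} t *\<^sub>R (2 * D)" for k
      using Q_le by (auto simp: indicator_def)
    have "AE t in lborel. g (Complex 0 t) \<noteq> 0 \<or> deriv g (Complex 0 t) = 0"
      by (rule AE_simple_zero_line[OF g]) (use \<kappa> in simp)
    then show "AE t in lborel. (\<lambda>k. indicator {0..1} t *\<^sub>R Q k t) \<longlonglongrightarrow> indicator {0..1} t *\<^sub>R 0"
    proof (rule AE_mp, intro AE_I2 impI)
      fix t assume nz: "g (Complex 0 t) \<noteq> 0 \<or> deriv g (Complex 0 t) = 0"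
      have "(\<lambda>k. reg_grad p (e (r k)) (f (Complex (\<sigma> (r k)) (t + a (r k)))) (deriv f (Complex (\<sigma> (r k)) (t + a (r k)))) -
         reg_grad p 0 (f (Complex (\<sigma> (r k)) (t + a (r k)))) (deriv f (Complex (\<sigma> (r k)) (t + a (r k))))) \<longlonglongrightarrow> 0"
      proof (rule tendsto_reg_grad_diff_zero[OF p _ _ _ _ _ nz])
        show "(\<lambda>k. e (r k)) \<longlonglongrightarrow> 0" using LIMSEQ_subseq_LIMSEQ[OF elim r] by (simp add: o_def)
      qed (use lim[OF z, of t] lim'[OF z, of t] e1 e(1) in \<open>auto simp: shift less_imp_le\<close>)
      then have "(\<lambda>k. Q k t) \<longlonglongrightarrow> 0" unfolding Q_def by (rule tendsto_norm_zero)
      then show "(\<lambda>k. indicator {0..1} t *\<^sub>R Q k t) \<longlonglongrightarrow> indicator {0..1} t *\<^sub>R 0"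
        by (intro tendsto_intros)
    qed
  qed auto
  then have "\<eta> \<le> (LBINT t:{0..1::real}. (0::real))"
    by (rule LIMSEQ_le_const) (use ge in \<open>auto simp: Q_def J_def\<close>)
  then show False using \<eta> by (simp add: set_lebesgue_integral_def)
qed

lemma integral_Icc_translate_unit:
  fixes q :: "real \<Rightarrow> real"
  shows "(LBINT t:{a..a + 1}. q t) = (LBINT t:{0..1}. q (t + a))"
proof -
  have "(LBINT t:{a..a + 1}. q t) = (\<integral>t. indicator {a..a + 1} (a + 1 * t) *\<^sub>R q (a + 1 * t) \<partial>lborel)"
    unfolding set_lebesgue_integral_def by (subst lborel_integral_real_affine[where c = 1 and t = a]) auto
  also have "\<dots> = (LBINT t:{0..1}. q (t + a))"
    unfolding set_lebesgue_integral_def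
    by (intro Bochner_Integration.integral_cong) (auto simp: indicator_def add.commute)
  finally show ?thesis .
qed

text \<open>Unit windows tile [-n, n], where n is the ceiling of T. Since T >= 1 gives n <= 2 T, the
  rounding costs the factor 2.\<close>

lemma mean_le_unit_interval:
  fixes q :: "real \<Rightarrow> real"
  assumes meas: "q \<in> borel_measurable borel" and q: "\<And>t. 0 \<le> q t" "\<And>t. q t \<le> B"
    and \<eta>: "\<And>a. (LBINT t:{0..1}. q (t + a)) \<le> \<eta>" and T: "T \<ge> 1"
  shows "mean T q \<le> 2 * \<eta>"
proof -
  have si: "set_integrable lborel {x..y} q" for x y
    using q by (intro set_integrable_bounded[where B = B] meas) auto
  note eq = set_borel_integral_eq_integral[OF si]
  have unit: "integral {a..a+1} q \<le> \<eta>" for a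
    using \<eta>[of a] integral_Icc_translate_unit[of a q] eq(2)[of a "a+1"] by simp
  have N: "integral {- real N..real N} q \<le> 2 * real N * \<eta>" for N
  proof (induction N)
    case 0
    then show ?case by simp
  next
    case (Suc N)
    have "integral {- real (Suc N)..- real N} q + integral {- real N..real N} q = integral {- real (Suc N)..real N} q"
      by (intro Henstock_Kurzweil_Integration.integral_combine eq) auto
    moreover have "integral {- real (Suc N)..real N} q + integral {real N..real (Suc N)} q
        = integral {- real (Suc N)..real (Suc N)} q"
      by (intro Henstock_Kurzweil_Integration.integral_combine eq) auto
    moreover have "integral {- real (Suc N)..- real N} q \<le> \<eta>"
      using unit[of "- real (Suc N)"] by simp
    moreover have "integral {real N..real (Suc N)} q \<le> \<eta>"
      using unit[of "real N"] by (simp add: add.commute)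
    ultimately have "integral {- real (Suc N)..real (Suc N)} q \<le> 2 * real N * \<eta> + 2 * \<eta>" using Suc by linarith
    then show ?case by (simp add: algebra_simps)
  qed
  have \<eta>0: "0 \<le> \<eta>"
    using q by (intro order.trans[OF _ \<eta>[of 0]]) (auto simp: set_lebesgue_integral_def intro!: Bochner_Integration.integral_nonneg)
  define n where "n = nat \<lceil>T\<rceil>"
  have n: "T \<le> real n" "real n \<le> 2 * T" using T unfolding n_def by linarith+
  have "integral {-T..T} q \<le> integral {- real n..real n} q"
    using n q by (intro integral_subset_le eq) auto
  also have "\<dots> \<le> 2 * real n * \<eta>" by (rule N)
  also have "\<dots> \<le> 2 * (2 * T) * \<eta>" using n \<eta>0 by (intro mult_right_mono) auto
  finally show ?thesis using T by (simp add: mean_def eq field_simps)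
qed

section \<open>Green's formula\<close>

lemma has_vector_derivative_horizontal:
  assumes h: "h holomorphic_on halfplane 0" and \<sigma>: "\<sigma> > 0"
  shows "((\<lambda>\<sigma>. h (Complex \<sigma> t)) has_vector_derivative deriv h (Complex \<sigma> t)) (at \<sigma>)"
proof -
  have "((\<lambda>\<sigma>. Complex \<sigma> t) has_vector_derivative 1) (at \<sigma>)"
    unfolding Complex_eq by (auto intro!: derivative_eq_intros)
  moreover have "(h has_field_derivative deriv h (Complex \<sigma> t)) (at (Complex \<sigma> t))"
    using \<sigma> by (intro holomorphic_derivI[OF h open_halfplane]) (simp add: halfplane_def)
  ultimately show ?thesis
    using field_vector_diff_chain_at[of "\<lambda>\<sigma>. Complex \<sigma> t" 1 \<sigma> h] by (simp add: o_def)
qed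

lemma has_vector_derivative_vertical:
  assumes h: "h holomorphic_on halfplane 0" and \<sigma>: "\<sigma> > 0"
  shows "((\<lambda>t. h (Complex \<sigma> t)) has_vector_derivative \<i> * deriv h (Complex \<sigma> t)) (at t)"
proof -
  have "((\<lambda>t. Complex \<sigma> t) has_vector_derivative \<i>) (at t)"
    unfolding Complex_eq by (auto intro!: derivative_eq_intros)
  moreover have "(h has_field_derivative deriv h (Complex \<sigma> t)) (at (Complex \<sigma> t))"
    using \<sigma> by (intro holomorphic_derivI[OF h open_halfplane]) (simp add: halfplane_def)
  ultimately show ?thesis
    using field_vector_diff_chain_at[of "\<lambda>t. Complex \<sigma> t" \<i> t h] by (simp add: o_def)
qed

text \<open>Derivative of \<open>reg_grad p e\<close> along a curve on which z and w have velocities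
  z' and w'. With z = f and w = f' the velocities are (f', f'') horizontally and (i f', i f'')
  vertically, so one formula serves both directions.\<close>

definition reg_grad_deriv :: "real \<Rightarrow> real \<Rightarrow> complex \<Rightarrow> complex \<Rightarrow> complex \<Rightarrow> complex \<Rightarrow> complex" where
  "reg_grad_deriv p e z z' w w' =
     of_real (p * ((p / 2 - 1) * ((norm z)\<^sup>2 + e\<^sup>2) powr (p / 2 - 2) * (2 * Re (cnj z * z')))) * (cnj z * w) +
     of_real (p * ((norm z)\<^sup>2 + e\<^sup>2) powr (p / 2 - 1)) * (cnj z' * w + cnj z * w')"

text \<open>The Laplacian of \<open>(\<bar>f\<bar>\<^sup>2 + e\<^sup>2)\<^bsup>p/2\<^esup>\<close> in terms of \<open>z = f s\<close> and \<open>w = f' s\<close>.\<close>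

definition reg_lapl :: "real \<Rightarrow> real \<Rightarrow> complex \<Rightarrow> complex \<Rightarrow> real" where
  "reg_lapl p e z w = (norm w)\<^sup>2 * ((norm z)\<^sup>2 + e\<^sup>2) powr (p / 2 - 2) * (p\<^sup>2 * (norm z)\<^sup>2 + 2 * p * e\<^sup>2)"

lemma has_real_derivative_norm_power2:
  assumes u: "(u has_vector_derivative u') (at x)"
  shows "((\<lambda>x. (norm (u x))\<^sup>2) has_real_derivative 2 * Re (cnj (u x) * u')) (at x)"
proof -
  have "((\<lambda>x. Re (u x)) has_real_derivative Re u') (at x)" "((\<lambda>x. Im (u x)) has_real_derivative Im u') (at x)"
    using bounded_linear.has_vector_derivative[OF bounded_linear_Re u]
      bounded_linear.has_vector_derivative[OF bounded_linear_Im u]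
    by (simp_all add: has_real_derivative_iff_has_vector_derivative)
  with u show ?thesis
    unfolding cmod_power2 by (auto intro!: derivative_eq_intros simp: algebra_simps)
qed

lemma has_real_derivative_reg_powr:
  assumes u: "(u has_vector_derivative u') (at x)" and e: "e > 0"
  shows "((\<lambda>x. ((norm (u x))\<^sup>2 + e\<^sup>2) powr q) has_real_derivative
     q * ((norm (u x))\<^sup>2 + e\<^sup>2) powr (q - 1) * (2 * Re (cnj (u x) * u'))) (at x)"
proof -
  have "(norm (u x))\<^sup>2 + e\<^sup>2 > 0" using e by (simp add: add_nonneg_pos)
  moreover have "((\<lambda>x. (norm (u x))\<^sup>2 + e\<^sup>2) has_real_derivative 2 * Re (cnj (u x) * u')) (at x)"
    using DERIV_add[OF has_real_derivative_norm_power2[OF u] DERIV_const] by simp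
  ultimately show ?thesis
    by (rule DERIV_chain2[OF has_real_derivative_powr, where g = "\<lambda>x. (norm (u x))\<^sup>2 + e\<^sup>2"])
qed

lemma has_vector_derivative_reg_grad:
  assumes u: "(u has_vector_derivative u') (at x)" and v: "(v has_vector_derivative v') (at x)" and e: "e > 0"
  shows "((\<lambda>x. reg_grad p e (u x) (v x)) has_vector_derivative reg_grad_deriv p e (u x) u' (v x) v') (at x)"
proof -
  let ?y = "\<lambda>x. (norm (u x))\<^sup>2 + e\<^sup>2"
  have "((\<lambda>x. p * ?y x powr (p / 2 - 1)) has_real_derivative
     p * ((p / 2 - 1) * ?y x powr (p / 2 - 2) * (2 * Re (cnj (u x) * u')))) (at x)"
    using DERIV_cmult[OF has_real_derivative_reg_powr[OF u e, of "p / 2 - 1"], of p] by simp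
  then have 1: "((\<lambda>x. complex_of_real (p * ?y x powr (p / 2 - 1))) has_vector_derivative
     of_real (p * ((p / 2 - 1) * ?y x powr (p / 2 - 2) * (2 * Re (cnj (u x) * u'))))) (at x)"
    by (rule has_vector_derivative_of_real)
  have "((\<lambda>x. cnj (u x)) has_vector_derivative cnj u') (at x)"
    by (rule bounded_linear.has_vector_derivative[OF bounded_linear_cnj u])
  then have 2: "((\<lambda>x. cnj (u x) * v x) has_vector_derivative cnj (u x) * v' + cnj u' * v x) (at x)"
    by (rule has_vector_derivative_mult[OF _ v])
  show ?thesis
    unfolding reg_grad_def reg_grad_deriv_def using has_vector_derivative_mult[OF 1 2] by (simp add: add_ac)
qed

text \<open>As \<open>reg_grad\<close> encodes the \<sigma>-derivative minus i times the
  t-derivative, the two pure second derivatives are the real part of its horizontal derivative and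
  minus the imaginary part of its vertical one. The terms with \<open>w2\<close> cancel because Im
  (i x) = Re x: the Laplacian of a function of |f|^2 does not see f''.\<close>

lemma reg_grad_deriv_eq_lapl:
  assumes e: "e > 0"
  shows "Re (reg_grad_deriv p e z w w w2) - Im (reg_grad_deriv p e z (\<i> * w) w (\<i> * w2)) = reg_lapl p e z w"
proof -
  define y where "y = (norm z)\<^sup>2 + e\<^sup>2"
  define Y where "Y = y powr (p / 2 - 2)"
  have y: "y > 0" using e by (simp add: y_def add_nonneg_pos)
  have Y: "y powr (p / 2 - 1) = Y * y" using powr_add[of y "p / 2 - 2" 1] y by (simp add: Y_def)
  have y2: "y = (Re z)\<^sup>2 + (Im z)\<^sup>2 + e\<^sup>2" by (simp add: y_def cmod_power2)
  show ?thesis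
    unfolding reg_grad_deriv_def reg_lapl_def
    unfolding y_def[symmetric]
    unfolding Y Y_def[symmetric]
    unfolding cmod_power2
    by (simp add: y2) (simp add: field_simps power2_eq_square)
qed

text \<open>\<open>powr\<close> is monotone in its base, in a direction that depends on the sign of
  q. The sum of the endpoint values serves both signs, as p/2 - 1 and p/2 - 2 may have
  either.\<close>

lemma powr_le_sum_endpoints:
  fixes a x b q :: real
  assumes "0 < a" "a \<le> x" "x \<le> b"
  shows "x powr q \<le> a powr q + b powr q"
proof (cases "q \<ge> 0")
  case True
  then have "x powr q \<le> b powr q" using assms by (intro powr_mono2) auto
  then show ?thesis by (simp add: add_increasing)
next
  case False
  then have "x powr q \<le> a powr q" using assms by (intro powr_mono2') auto
  then show ?thesis by (simp add: add_increasing2)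
qed

text \<open>The constant may blow up as e tends to 0; it serves integrability at fixed e. On the
  curves of interest the right side combines |f'|^2 and |f''|, which decay exponentially.\<close>

lemma norm_reg_grad_deriv_le:
  assumes e: "0 < e"
  obtains C where "C \<ge> 0" "\<And>z z' w w'. norm z \<le> B \<Longrightarrow> norm (reg_grad_deriv p e z z' w w') \<le> C * (norm z' * norm w + norm w')"
proof -
  define c where "c = (\<lambda>q. (e\<^sup>2) powr q + (B\<^sup>2 + e\<^sup>2) powr q)"
  have c0: "c q \<ge> 0" for q by (simp add: c_def)
  define C1 where "C1 = \<bar>p\<bar> * (\<bar>p / 2 - 1\<bar> * c (p / 2 - 2) * (2 * (\<bar>B\<bar> * \<bar>B\<bar>)))"
  define C2 where "C2 = \<bar>p\<bar> * c (p / 2 - 1)"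
  have C: "C1 \<ge> 0" "C2 \<ge> 0" using c0 by (auto simp: C1_def C2_def)
  have "norm (reg_grad_deriv p e z z' w w') \<le> (C1 + C2 + C2 * \<bar>B\<bar>) * (norm z' * norm w + norm w')" if z: "norm z \<le> B" for z z' w w'
  proof -
    let ?y = "(norm z)\<^sup>2 + e\<^sup>2"
    have y: "?y powr q \<le> c q" for q
      unfolding c_def using e z by (intro powr_le_sum_endpoints) (auto simp: power_mono)
    have B: "norm z \<le> \<bar>B\<bar>" using z by simp
    have re: "\<bar>2 * Re (cnj z * z')\<bar> \<le> 2 * (norm z * norm z')"
      using abs_Re_le_cmod[of "cnj z * z'"] by (simp add: norm_mult abs_mult del: times_complex.sel complex_cnj)
    have "norm (of_real (p * ((p / 2 - 1) * ?y powr (p / 2 - 2) * (2 * Re (cnj z * z')))) * (cnj z * w))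
       = \<bar>p\<bar> * (\<bar>p / 2 - 1\<bar> * ?y powr (p / 2 - 2) * \<bar>2 * Re (cnj z * z')\<bar>) * (norm z * norm w)"
      by (simp only: norm_mult norm_of_real abs_mult complex_mod_cnj) simp
    also have "\<dots> \<le> \<bar>p\<bar> * (\<bar>p / 2 - 1\<bar> * c (p / 2 - 2) * (2 * (\<bar>B\<bar> * norm z'))) * (\<bar>B\<bar> * norm w)"
    proof (intro mult_mono)
      show "\<bar>2 * Re (cnj z * z')\<bar> \<le> 2 * (\<bar>B\<bar> * norm z')"
        using re mult_right_mono[OF B, of "norm z'"] by auto
    qed (use y B c0 in auto)
    also have "\<dots> = C1 * (norm z' * norm w)" by (simp add: C1_def mult_ac)
    finally have 1: "norm (of_real (p * ((p / 2 - 1) * ?y powr (p / 2 - 2) * (2 * Re (cnj z * z')))) * (cnj z * w))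
       \<le> C1 * (norm z' * norm w)" .
    have "norm (of_real (p * ?y powr (p / 2 - 1)) * (cnj z' * w + cnj z * w')) =
       \<bar>p\<bar> * ?y powr (p / 2 - 1) * norm (cnj z' * w + cnj z * w')"
      by (simp add: norm_mult abs_mult)
    also have "\<dots> \<le> \<bar>p\<bar> * c (p / 2 - 1) * (norm z' * norm w + \<bar>B\<bar> * norm w')"
    proof (intro mult_mono)
      have "norm (cnj z' * w + cnj z * w') \<le> norm z' * norm w + norm z * norm w'"
        using norm_triangle_ineq[of "cnj z' * w" "cnj z * w'"] by (simp add: norm_mult)
      also have "\<dots> \<le> norm z' * norm w + \<bar>B\<bar> * norm w'" using B by (intro add_left_mono mult_right_mono) auto
      finally show "norm (cnj z' * w + cnj z * w') \<le> norm z' * norm w + \<bar>B\<bar> * norm w'" .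
    qed (use y c0 in auto)
    finally have 2: "norm (of_real (p * ?y powr (p / 2 - 1)) * (cnj z' * w + cnj z * w')) \<le>
       C2 * (norm z' * norm w + \<bar>B\<bar> * norm w')" by (simp add: C2_def)
    have "norm (reg_grad_deriv p e z z' w w') \<le> C1 * (norm z' * norm w) + C2 * (norm z' * norm w + \<bar>B\<bar> * norm w')"
      unfolding reg_grad_deriv_def by (rule norm_triangle_le[OF add_mono[OF 1 2]])
    also have "\<dots> \<le> (C1 + C2 + C2 * \<bar>B\<bar>) * (norm z' * norm w + norm w')"
    proof -
      have "0 \<le> C1 * norm w'" "0 \<le> C2 * norm w'" "0 \<le> C2 * \<bar>B\<bar> * (norm z' * norm w)" using C by auto
      then show ?thesis by (simp add: algebra_simps)
    qed
    finally show ?thesis .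
  qed
  moreover have "C1 + C2 + C2 * \<bar>B\<bar> \<ge> 0" using C by simp
  ultimately show thesis using that by blast
qed

section \<open>Integrability and decay on half-strips\<close>

lemma set_integrable_exp_Ioi: "set_integrable lborel {\<kappa><..} (\<lambda>\<sigma>. exp (- ln 2 * \<sigma>) :: real)"
proof -
  have "(\<lambda>\<sigma>. exp (- ln 2 * \<sigma>) :: real) absolutely_integrable_on {\<kappa>..}"
    by (intro nonnegative_absolutely_integrable_1 integrable_on_exp_minus_to_infinity) auto
  then have "integrable lebesgue (\<lambda>\<sigma>. indicator {\<kappa>..} \<sigma> *\<^sub>R (exp (- ln 2 * \<sigma>) :: real))"
    unfolding set_integrable_def .
  then have "integrable lborel (\<lambda>\<sigma>. indicator {\<kappa>..} \<sigma> *\<^sub>R (exp (- ln 2 * \<sigma>) :: real))"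
    by (subst (asm) integrable_completion) auto
  then have "set_integrable lborel {\<kappa>..} (\<lambda>\<sigma>. exp (- ln 2 * \<sigma>) :: real)"
    unfolding set_integrable_def .
  then show ?thesis by (rule set_integrable_subset) auto
qed

lemma integrable_strip_exp:
  "integrable lborel (\<lambda>x :: real \<times> real. indicator ({\<kappa><..} \<times> {-T..T}) x *\<^sub>R (C * exp (- ln 2 * fst x)))"
proof -
  have 1: "integrable lborel (\<lambda>\<sigma>. indicator {\<kappa><..} \<sigma> *\<^sub>R (exp (- ln 2 * \<sigma>) :: real))"
    using set_integrable_exp_Ioi unfolding set_integrable_def .
  have 2: "integrable lborel (indicator {-T..T} :: real \<Rightarrow> real)"
    by (simp add: integrable_indicator_iff emeasure_lborel_Icc_eq)
  have "integrable (lborel \<Otimes>\<^sub>M lborel) (\<lambda>x :: real \<times> real. indicator ({\<kappa><..} \<times> {-T..T}) x *\<^sub>R (C * exp (- ln 2 * fst x)))"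
  proof (rule lborel_pair.Fubini_integrable)
    have ind: "indicator ({\<kappa><..} \<times> {-T..T}) (\<sigma>, t) = (indicator {\<kappa><..} \<sigma> * indicator {-T..T} t :: real)" for \<sigma> t
      by (simp add: indicator_def)
    show "integrable lborel (\<lambda>\<sigma>. LBINT t. norm (indicator ({\<kappa><..} \<times> {-T..T}) (\<sigma>, t) *\<^sub>R (C * exp (- ln 2 * fst (\<sigma>, t)))))"
    proof -
      have "(\<lambda>\<sigma>. LBINT t. norm (indicator ({\<kappa><..} \<times> {-T..T}) (\<sigma>, t) *\<^sub>R (C * exp (- ln 2 * fst (\<sigma>, t))))) =
        (\<lambda>\<sigma>. (\<bar>C\<bar> * (LBINT t. indicator {-T..T} t)) * (indicator {\<kappa><..} \<sigma> *\<^sub>R exp (- ln 2 * \<sigma>)))"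
        by (rule ext) (simp add: ind abs_mult mult_ac)
      then show ?thesis using 1 by simp
    qed
    show "AE \<sigma> in lborel. integrable lborel (\<lambda>t. indicator ({\<kappa><..} \<times> {-T..T}) (\<sigma>, t) *\<^sub>R (C * exp (- ln 2 * fst (\<sigma>, t))))"
      using 2 by (simp add: ind)
  qed measurable
  then show ?thesis unfolding lborel_prod .
qed

lemma integrable_strip:
  fixes A :: "real \<times> real \<Rightarrow> real"
  assumes cont: "continuous_on ({0<..} \<times> UNIV) A" and \<kappa>: "\<kappa> > 0"
    and bd: "\<And>\<sigma> t. \<sigma> \<ge> \<kappa> \<Longrightarrow> \<bar>A (\<sigma>, t)\<bar> \<le> C * exp (- ln 2 * \<sigma>)"
  shows "integrable lborel (\<lambda>x. indicator ({\<kappa><..} \<times> {-T..T}) x *\<^sub>R A x)"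
proof (rule Bochner_Integration.integrable_bound[OF integrable_strip_exp[of \<kappa> T C]])
  have "{\<kappa><..} \<times> {-T..T} \<in> sets (borel :: (real \<times> real) measure)" by (intro borel_Times) auto
  moreover have "{\<kappa><..} \<times> {-T..T} \<subseteq> {0<..} \<times> UNIV" using \<kappa> by auto
  ultimately show "(\<lambda>x. indicator ({\<kappa><..} \<times> {-T..T}) x *\<^sub>R A x) \<in> borel_measurable lborel"
    using borel_measurable_continuous_on_indicator[of "{\<kappa><..} \<times> {-T..T}" A]
      continuous_on_subset[OF cont, of "{\<kappa><..} \<times> {-T..T}"] \<kappa> by auto
  show "AE x in lborel. norm (indicator ({\<kappa><..} \<times> {-T..T}) x *\<^sub>R A x)
      \<le> norm (indicator ({\<kappa><..} \<times> {-T..T}) x *\<^sub>R (C * exp (- ln 2 * fst x)))"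
    using bd by (intro AE_I2) (auto simp: indicator_def intro!: order.trans[OF bd] abs_ge_self)
qed

lemma integral_Ioi_FTC:
  fixes F A :: "real \<Rightarrow> real"
  assumes F: "\<And>x. x \<ge> \<kappa> \<Longrightarrow> (F has_real_derivative A x) (at x)"
    and A: "\<And>x. x > \<kappa> \<Longrightarrow> isCont A x" and int: "set_integrable lborel {\<kappa><..} A"
    and lim: "(F \<longlongrightarrow> 0) at_top"
  shows "(LBINT x:{\<kappa><..}. A x) = - F \<kappa>"
proof -
  have "(LBINT x=ereal \<kappa>..\<infinity>. A x) = 0 - F \<kappa>"
  proof (rule interval_integral_FTC_integrable)
    show "(F has_vector_derivative A x) (at x)" if "ereal \<kappa> < ereal x" for x
      using F[of x] that by (simp add: has_real_derivative_iff_has_vector_derivative)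
    show "isCont A x" if "ereal \<kappa> < ereal x" for x using A that by simp
    show "set_integrable lborel (einterval (ereal \<kappa>) \<infinity>) A" using int by simp
    have "isCont F \<kappa>" using F[of \<kappa>] by (simp add: DERIV_isCont)
    then have "(F \<longlongrightarrow> F \<kappa>) (at_right \<kappa>)"
      unfolding isCont_def by (rule tendsto_within_subset) auto
    then show "((F \<circ> real_of_ereal) \<longlongrightarrow> F \<kappa>) (at_right (ereal \<kappa>))" by (simp add: ereal_tendsto_simps)
    show "((F \<circ> real_of_ereal) \<longlongrightarrow> 0) (at_left \<infinity>)" using lim by (simp add: ereal_tendsto_simps)
  qed simp
  then show ?thesis by (simp add: interval_integral_to_infinity_eq)
qed

lemma continuous_on_strip:
  assumes h: "h holomorphic_on halfplane 0"
  shows "continuous_on ({0<..} \<times> UNIV) (\<lambda>x. h (Complex (fst x) (snd x)))"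
  by (rule continuous_on_compose2[OF holomorphic_on_imp_continuous_on[OF h]])
    (auto simp: halfplane_def intro!: continuous_intros)

lemma continuous_on_reg_grad_deriv:
  assumes "e > 0" "continuous_on A z" "continuous_on A z'" "continuous_on A w" "continuous_on A w'"
  shows "continuous_on A (\<lambda>x. reg_grad_deriv p e (z x) (z' x) (w x) (w' x))"
proof -
  have "(norm (z x))\<^sup>2 + e\<^sup>2 \<noteq> 0" for x using assms(1) by (simp add: sum_power2_eq_zero_iff)
  then show ?thesis unfolding reg_grad_deriv_def using assms by (intro continuous_intros) auto
qed

lemma set_integrable_Ioi:
  fixes A :: "real \<Rightarrow> real"
  assumes meas: "set_borel_measurable borel {\<kappa><..} A"
    and bd: "\<And>\<sigma>. \<sigma> > \<kappa> \<Longrightarrow> \<bar>A \<sigma>\<bar> \<le> C * exp (- ln 2 * \<sigma>)"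
  shows "set_integrable lborel {\<kappa><..} A"
  unfolding set_integrable_def
proof (rule Bochner_Integration.integrable_bound)
  show "integrable lborel (\<lambda>\<sigma>. C * (indicator {\<kappa><..} \<sigma> *\<^sub>R exp (- ln 2 * \<sigma>) :: real))"
    using set_integrable_exp_Ioi[of \<kappa>] unfolding set_integrable_def by (rule integrable_mult_right)
  show "AE \<sigma> in lborel. norm (indicator {\<kappa><..} \<sigma> *\<^sub>R A \<sigma>) \<le> norm (C * (indicator {\<kappa><..} \<sigma> *\<^sub>R exp (- ln 2 * \<sigma>)))"
    using bd by (intro AE_I2) (auto simp: indicator_def intro!: order.trans[OF bd] abs_ge_self)
qed (use meas in \<open>simp add: set_borel_measurable_def\<close>)

lemma tendsto_zero_exp_bound:
  fixes F :: "real \<Rightarrow> real"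
  assumes "\<And>\<sigma>. \<sigma> \<ge> \<kappa> \<Longrightarrow> \<bar>F \<sigma>\<bar> \<le> C * exp (- ln 2 * \<sigma>)"
  shows "(F \<longlongrightarrow> 0) at_top"
proof (rule Lim_null_comparison)
  show "\<forall>\<^sub>F \<sigma> in at_top. norm (F \<sigma>) \<le> C * exp (- ln 2 * \<sigma>)"
    by (rule eventually_mono[OF eventually_ge_at_top[of \<kappa>]]) (use assms in simp)
  have "((\<lambda>\<sigma>::real. exp (- ln 2 * \<sigma>)) \<longlongrightarrow> 0) at_top"
  proof (rule filterlim_compose[OF exp_at_bot])
    have "filterlim (\<lambda>\<sigma>::real. ln 2 * \<sigma>) at_top at_top"
      by (rule filterlim_tendsto_pos_mult_at_top[OF tendsto_const _ filterlim_ident]) simp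
    then show "filterlim (\<lambda>\<sigma>::real. - ln 2 * \<sigma>) at_bot at_top" by (simp add: filterlim_uminus_at_top)
  qed
  then show "((\<lambda>\<sigma>. C * exp (- ln 2 * \<sigma>)) \<longlongrightarrow> 0) at_top" by (rule tendsto_mult_right_zero)
qed

text \<open>At a simple zero the claim can fail: there \<open>reg_lapl\<close> equals 2 p |w|^2
  e^(p-2) for e > 0, which blows up for p < 2, but it is 0 for e = 0.\<close>

lemma tendsto_reg_lapl:
  assumes "(e \<longlongrightarrow> 0) F" "z \<noteq> 0 \<or> w = 0"
  shows "((\<lambda>k. reg_lapl p (e k) z w) \<longlongrightarrow> reg_lapl p 0 z w) F"
proof (cases "z = 0")
  case False
  have "((\<lambda>k. reg_lapl p (e k) z w) \<longlongrightarrow>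
     (norm w)\<^sup>2 * ((norm z)\<^sup>2 + 0\<^sup>2) powr (p / 2 - 2) * (p\<^sup>2 * (norm z)\<^sup>2 + 2 * p * 0\<^sup>2)) F"
    unfolding reg_lapl_def using False assms(1) by (intro tendsto_intros) auto
  then show ?thesis by (simp add: reg_lapl_def)
qed (use assms in \<open>simp add: reg_lapl_def\<close>)

text \<open>This is the density of the theorem. At z = 0 both sides are 0 by the convention for
  \<open>powr\<close>, even for p = 2, where |z|^0 would usually be read as 1.\<close>

lemma reg_lapl_zero: "reg_lapl p 0 z w = p\<^sup>2 * (norm z powr (p - 2) * (norm w)\<^sup>2)"
proof (cases "z = 0")
  case False
  then have z: "norm z > 0" by simp
  have "((norm z)\<^sup>2) powr (p / 2 - 2) * (norm z)\<^sup>2 = (norm z powr 2) powr (p / 2 - 2) * norm z powr 2"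
    using z by (simp add: powr_numeral)
  also have "\<dots> = norm z powr (2 * (p / 2 - 2) + 2)" by (simp only: powr_powr powr_add)
  also have "2 * (p / 2 - 2) + 2 = p - 2" by simp
  finally show ?thesis by (simp add: reg_lapl_def mult_ac)
qed (simp add: reg_lapl_def)

lemma reg_lapl_nonneg: "0 \<le> p \<Longrightarrow> 0 \<le> reg_lapl p e z w"
  by (simp add: reg_lapl_def)

text \<open>For p < 2 the density blows up at simple zeros, so no constant multiple of |w|^2
  dominates the regularised densities. But x + e^2 lies between x and x + 1: the endpoint x returns
  the limit density itself and the other one is bounded, which gives a majorant independent of e.
  The factor p^2 + 2 p comes from p^2 x + 2 p e^2 <= (p^2 + 2 p)(x + e^2), the division by p^2 from
  the coefficient of the limit density.\<close>

lemma reg_lapl_le: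
  assumes p: "1 \<le> p" and e: "0 < e" "e \<le> 1" and z: "norm z \<le> B" "z \<noteq> 0 \<or> w = 0"
  shows "reg_lapl p e z w \<le> (p\<^sup>2 + 2 * p) / p\<^sup>2 * reg_lapl p 0 z w +
     (p\<^sup>2 + 2 * p) * (1 + (B\<^sup>2 + 1) powr (p / 2 - 1)) * (norm w)\<^sup>2"
proof (cases "w = 0")
  case False
  define x where "x = (norm z)\<^sup>2"
  have x: "x > 0" using z False by (simp add: x_def)
  have e2: "e\<^sup>2 \<le> 1" "e\<^sup>2 > 0" using e by (auto simp: power_le_one)
  have B: "x \<le> B\<^sup>2" using z by (simp add: x_def power_mono)
  let ?q = "p / 2 - 1"
  have "(x + e\<^sup>2) powr (p / 2 - 2) * (p\<^sup>2 * x + 2 * p * e\<^sup>2) \<le> (x + e\<^sup>2) powr (p / 2 - 2) * ((p\<^sup>2 + 2 * p) * (x + e\<^sup>2))"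
    using x e2 p by (intro mult_left_mono) (auto simp: algebra_simps)
  also have "\<dots> = (p\<^sup>2 + 2 * p) * (x + e\<^sup>2) powr ?q"
    using powr_add[of "x + e\<^sup>2" "p / 2 - 2" 1] x by simp
  also have "\<dots> \<le> (p\<^sup>2 + 2 * p) * (x powr ?q + (1 powr ?q + (B\<^sup>2 + 1) powr ?q))"
  proof (intro mult_left_mono)
    have "(x + e\<^sup>2) powr ?q \<le> x powr ?q + (x + 1) powr ?q" using x e2 by (intro powr_le_sum_endpoints) auto
    moreover have "(x + 1) powr ?q \<le> 1 powr ?q + (B\<^sup>2 + 1) powr ?q"
      using x B by (intro powr_le_sum_endpoints) auto
    ultimately show "(x + e\<^sup>2) powr ?q \<le> x powr ?q + (1 powr ?q + (B\<^sup>2 + 1) powr ?q)" by linarith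
  qed (use p in auto)
  finally have "(norm w)\<^sup>2 * ((x + e\<^sup>2) powr (p / 2 - 2) * (p\<^sup>2 * x + 2 * p * e\<^sup>2)) \<le>
     (norm w)\<^sup>2 * ((p\<^sup>2 + 2 * p) * (x powr ?q + (1 + (B\<^sup>2 + 1) powr ?q)))"
    by (intro mult_left_mono) auto
  moreover have "reg_lapl p 0 z w = p\<^sup>2 * (norm w)\<^sup>2 * x powr ?q"
    using powr_add[of x "p / 2 - 2" 1] x unfolding reg_lapl_def by (simp add: x_def[symmetric] mult_ac)
  then have "(p\<^sup>2 + 2 * p) / p\<^sup>2 * reg_lapl p 0 z w = (p\<^sup>2 + 2 * p) * (norm w)\<^sup>2 * x powr ?q"
    using p by simp
  moreover have "reg_lapl p e z w = (norm w)\<^sup>2 * ((x + e\<^sup>2) powr (p / 2 - 2) * (p\<^sup>2 * x + 2 * p * e\<^sup>2))"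
    by (simp add: reg_lapl_def x_def mult.assoc)
  ultimately show ?thesis by (simp add: algebra_simps)
qed (simp add: reg_lapl_def)

section \<open>Green's formula for the regularised power\<close>

locale Hinf_mean =
  fixes f :: "complex \<Rightarrow> complex" and p :: real
  assumes f: "f \<in> Hinf" and p: "1 \<le> p"
begin

lemmas hol = Hinf_holomorphic[OF f]
lemmas hol1 = holomorphic_deriv[OF hol open_halfplane]
lemmas hol2 = holomorphic_deriv[OF hol1 open_halfplane]

abbreviation grad_f :: "real \<Rightarrow> real \<Rightarrow> real \<Rightarrow> complex" where
  "grad_f e \<sigma> t \<equiv> reg_grad p e (f (Complex \<sigma> t)) (deriv f (Complex \<sigma> t))"

abbreviation lapl_f :: "real \<Rightarrow> real \<times> real \<Rightarrow> real" where
  "lapl_f e x \<equiv> reg_lapl p e (f (Complex (fst x) (snd x))) (deriv f (Complex (fst x) (snd x)))"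

lemma grad_f_bound:
  assumes "\<kappa> > 0"
  obtains C where "C > 0" "\<And>e \<sigma> t. 0 \<le> e \<Longrightarrow> e \<le> 1 \<Longrightarrow> \<sigma> \<ge> \<kappa> \<Longrightarrow> norm (grad_f e \<sigma> t) \<le> C * exp (- ln 2 * \<sigma>)"
    "\<And>e \<sigma> t. 0 \<le> e \<Longrightarrow> e \<le> 1 \<Longrightarrow> \<sigma> \<ge> \<kappa> \<Longrightarrow> norm (grad_f e \<sigma> t) \<le> C"
proof -
  obtain M where M: "M > 0" "\<And>s. Re s > 0 \<Longrightarrow> norm (f s) \<le> M" using Hinf_bounded[OF f] by blast
  obtain C where C: "C > 0" "\<And>s. Re s \<ge> \<kappa> \<Longrightarrow> norm (deriv f s) \<le> C * exp (- ln 2 * Re s)"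
    "\<And>s. Re s \<ge> \<kappa> \<Longrightarrow> norm (deriv f s) \<le> C"
    by (rule decays_bounded[OF Hinf_deriv_decays(1)[OF f] assms]) (rule that; assumption)
  define D where "D = p * (M\<^sup>2 + 1) powr ((p - 1) / 2)"
  have "M\<^sup>2 + 1 > 0" by (simp add: add_nonneg_pos)
  then have D: "D > 0" using p by (simp add: D_def)
  have le: "norm (grad_f e \<sigma> t) \<le> D * norm (deriv f (Complex \<sigma> t))" if "0 \<le> e" "e \<le> 1" "\<sigma> \<ge> \<kappa>" for e \<sigma> t
    unfolding D_def using that assms by (intro norm_reg_grad_le p M) auto
  show thesis
  proof (rule that[of "D * C"])
    fix e \<sigma> t :: real assume *: "0 \<le> e" "e \<le> 1" "\<sigma> \<ge> \<kappa>"
    show "norm (grad_f e \<sigma> t) \<le> D * C * exp (- ln 2 * \<sigma>)"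
      by (rule order.trans[OF le[OF *]]) (use C(2)[of "Complex \<sigma> t"] * D in \<open>simp add: mult.assoc\<close>)
    show "norm (grad_f e \<sigma> t) \<le> D * C"
      by (rule order.trans[OF le[OF *]]) (use C(3)[of "Complex \<sigma> t"] * D in simp)
  qed (use C D in auto)
qed

text \<open>\<open>A1\<close> and \<open>A2\<close> are the pure second derivatives in \<sigma> and
  in t. Each is integrable over the half-strip by itself, so Fubini may be applied in opposite
  orders: \<open>A1\<close> is integrated in \<sigma> first and leaves the side Re s = \<kappa>,
  because the gradient vanishes at infinity; \<open>A2\<close> is integrated in t first and leaves
  the two horizontal sides.\<close>

lemma green_reg:
  assumes e: "e > 0" "e \<le> 1" and \<kappa>: "\<kappa> > 0" and T: "T \<ge> 0"
  shows "integrable lborel (\<lambda>x. indicator ({\<kappa><..} \<times> {-T..T}) x *\<^sub>R lapl_f e x)"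
    and "(\<integral>x. indicator ({\<kappa><..} \<times> {-T..T}) x *\<^sub>R lapl_f e x \<partial>lborel) =
      - (LBINT t:{-T..T}. Re (grad_f e \<kappa> t)) - (LBINT \<sigma>:{\<kappa><..}. Im (grad_f e \<sigma> T) - Im (grad_f e \<sigma> (-T)))"
proof -
  define A1 where "A1 = (\<lambda>x. Re (reg_grad_deriv p e (f (Complex (fst x) (snd x))) (deriv f (Complex (fst x) (snd x)))
     (deriv f (Complex (fst x) (snd x))) (deriv (deriv f) (Complex (fst x) (snd x)))))"
  define A2 where "A2 = (\<lambda>x. - Im (reg_grad_deriv p e (f (Complex (fst x) (snd x))) (\<i> * deriv f (Complex (fst x) (snd x)))
     (deriv f (Complex (fst x) (snd x))) (\<i> * deriv (deriv f) (Complex (fst x) (snd x)))))"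
  have L: "lapl_f e x = A1 x + A2 x" for x
    unfolding A1_def A2_def using reg_grad_deriv_eq_lapl[OF e(1)] by simp
  obtain M where M: "M > 0" "\<And>s. Re s > 0 \<Longrightarrow> norm (f s) \<le> M" using Hinf_bounded[OF f] by blast
  obtain C1 where C1: "C1 > 0" "\<And>s. Re s \<ge> \<kappa> \<Longrightarrow> norm (deriv f s) \<le> C1 * exp (- ln 2 * Re s)"
    "\<And>s. Re s \<ge> \<kappa> \<Longrightarrow> norm (deriv f s) \<le> C1"
    by (rule decays_bounded[OF Hinf_deriv_decays(1)[OF f] \<kappa>]) (rule that; assumption)
  obtain C2 where C2: "C2 > 0" "\<And>s. Re s \<ge> \<kappa> \<Longrightarrow> norm (deriv (deriv f) s) \<le> C2 * exp (- ln 2 * Re s)"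
    "\<And>s. Re s \<ge> \<kappa> \<Longrightarrow> norm (deriv (deriv f) s) \<le> C2"
    by (rule decays_bounded[OF Hinf_deriv_decays(2)[OF f] \<kappa>]) (rule that; assumption)
  obtain C0 where C0: "C0 \<ge> 0" "\<And>z z' w w'. norm z \<le> M \<Longrightarrow> norm (reg_grad_deriv p e z z' w w') \<le> C0 * (norm z' * norm w + norm w')"
    by (rule norm_reg_grad_deriv_le[OF e(1)]) (rule that; assumption)
  \<comment> \<open>Of the two factors |f'| one is bounded by \<open>C1\<close>, and only the other
    keeps its exponential.\<close>
  define C where "C = C0 * (C1 * C1 + C2)"
  have dW_le: "norm (reg_grad_deriv p e (f s) (c * deriv f s) (deriv f s) (c * deriv (deriv f) s)) \<le> C * exp (- ln 2 * Re s)"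
    if "Re s \<ge> \<kappa>" "norm c = 1" for s c
  proof -
    have "norm (reg_grad_deriv p e (f s) (c * deriv f s) (deriv f s) (c * deriv (deriv f) s)) \<le>
      C0 * (norm (c * deriv f s) * norm (deriv f s) + norm (c * deriv (deriv f) s))"
      using that \<kappa> by (intro C0 M) auto
    also have "\<dots> = C0 * (norm (deriv f s) * norm (deriv f s) + norm (deriv (deriv f) s))"
      using that by (simp add: norm_mult)
    also have "\<dots> \<le> C0 * (C1 * (C1 * exp (- ln 2 * Re s)) + C2 * exp (- ln 2 * Re s))"
      using C0(1) C1 C2 that by (intro mult_left_mono add_mono mult_mono) auto
    also have "\<dots> = C * exp (- ln 2 * Re s)" by (simp add: C_def algebra_simps)
    finally show ?thesis .
  qed
  have b1: "\<bar>A1 (\<sigma>, t)\<bar> \<le> C * exp (- ln 2 * \<sigma>)" if "\<sigma> \<ge> \<kappa>" for \<sigma> t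
    using order.trans[OF abs_Re_le_cmod dW_le[of "Complex \<sigma> t" 1]] that by (simp add: A1_def)
  have b2: "\<bar>A2 (\<sigma>, t)\<bar> \<le> C * exp (- ln 2 * \<sigma>)" if "\<sigma> \<ge> \<kappa>" for \<sigma> t
    using order.trans[OF abs_Im_le_cmod dW_le[of "Complex \<sigma> t" \<i>]] that by (simp add: A2_def)
  have c1: "continuous_on ({0<..} \<times> UNIV) A1" unfolding A1_def
    by (intro continuous_intros continuous_on_reg_grad_deriv e continuous_on_strip hol hol1 hol2)
  have c2: "continuous_on ({0<..} \<times> UNIV) A2" unfolding A2_def
    by (intro continuous_intros continuous_on_reg_grad_deriv e continuous_on_strip hol hol1 hol2)
  note i1 = integrable_strip[OF c1 \<kappa> b1, of T] and i2 = integrable_strip[OF c2 \<kappa> b2, of T]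
  show "integrable lborel (\<lambda>x. indicator ({\<kappa><..} \<times> {-T..T}) x *\<^sub>R lapl_f e x)"
    unfolding L scaleR_add_right by (intro Bochner_Integration.integrable_add i1 i2)
  have ind: "indicator ({\<kappa><..} \<times> {-T..T}) (\<sigma>, t) *\<^sub>R x = indicator {-T..T} t *\<^sub>R (indicator {\<kappa><..} \<sigma> *\<^sub>R x)"
    "indicator ({\<kappa><..} \<times> {-T..T}) (\<sigma>, t) *\<^sub>R x = indicator {\<kappa><..} \<sigma> *\<^sub>R (indicator {-T..T} t *\<^sub>R x)"
    for \<sigma> t x :: real
    by (auto simp: indicator_def)
  have horizontal: "(LBINT \<sigma>:{\<kappa><..}. A1 (\<sigma>, t)) = - Re (grad_f e \<kappa> t)" for t
  proof (rule integral_Ioi_FTC)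
    have cont: "continuous_on {0<..} (\<lambda>\<sigma>. A1 (\<sigma>, t))"
      by (rule continuous_on_compose2[OF c1]) (auto intro!: continuous_intros)
    show "((\<lambda>\<sigma>. Re (grad_f e \<sigma> t)) has_real_derivative A1 (x, t)) (at x)" if "x \<ge> \<kappa>" for x
    proof -
      have "((\<lambda>\<sigma>. grad_f e \<sigma> t) has_vector_derivative reg_grad_deriv p e (f (Complex x t)) (deriv f (Complex x t))
          (deriv f (Complex x t)) (deriv (deriv f) (Complex x t))) (at x)"
        using that \<kappa> by (intro has_vector_derivative_reg_grad has_vector_derivative_horizontal hol hol1 e) auto
      from bounded_linear.has_vector_derivative[OF bounded_linear_Re this]
      show ?thesis by (simp add: has_real_derivative_iff_has_vector_derivative A1_def)
    qed
    show "isCont (\<lambda>\<sigma>. A1 (\<sigma>, t)) x" if "x > \<kappa>" for x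
      using cont that \<kappa> by (simp add: continuous_on_eq_continuous_at)
    have "continuous_on {\<kappa><..} (\<lambda>\<sigma>. A1 (\<sigma>, t))" using \<kappa> by (intro continuous_on_subset[OF cont]) auto
    then have "set_borel_measurable borel {\<kappa><..} (\<lambda>\<sigma>. A1 (\<sigma>, t))"
      unfolding set_borel_measurable_def by (intro borel_measurable_continuous_on_indicator) auto
    then show "set_integrable lborel {\<kappa><..} (\<lambda>\<sigma>. A1 (\<sigma>, t))"
      by (rule set_integrable_Ioi) (rule b1, simp)
    obtain C' where C': "\<And>e \<sigma> t. 0 \<le> e \<Longrightarrow> e \<le> 1 \<Longrightarrow> \<sigma> \<ge> \<kappa> \<Longrightarrow> norm (grad_f e \<sigma> t) \<le> C' * exp (- ln 2 * \<sigma>)"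
      using grad_f_bound[OF \<kappa>] by metis
    show "((\<lambda>\<sigma>. Re (grad_f e \<sigma> t)) \<longlongrightarrow> 0) at_top"
      using e by (intro tendsto_zero_exp_bound[where C = C' and \<kappa> = \<kappa>] order.trans[OF abs_Re_le_cmod C']) auto
  qed
  have vertical: "(LBINT t:{-T..T}. A2 (\<sigma>, t)) = - (Im (grad_f e \<sigma> T) - Im (grad_f e \<sigma> (-T)))" if \<sigma>: "\<sigma> > \<kappa>" for \<sigma>
  proof -
    have "(LBINT t:{-T..T}. A2 (\<sigma>, t)) = (- Im (grad_f e \<sigma> T)) - (- Im (grad_f e \<sigma> (-T)))"
      unfolding set_lebesgue_integral_def
    proof (rule integral_FTC_atLeastAtMost)
      show "((\<lambda>t. - Im (grad_f e \<sigma> t)) has_vector_derivative A2 (\<sigma>, t)) (at t within {-T..T})" for t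
      proof -
        have "((\<lambda>t. grad_f e \<sigma> t) has_vector_derivative reg_grad_deriv p e (f (Complex \<sigma> t)) (\<i> * deriv f (Complex \<sigma> t))
            (deriv f (Complex \<sigma> t)) (\<i> * deriv (deriv f) (Complex \<sigma> t))) (at t)"
          using \<sigma> \<kappa> by (intro has_vector_derivative_reg_grad has_vector_derivative_vertical hol hol1 e) auto
        from has_vector_derivative_minus[OF bounded_linear.has_vector_derivative[OF bounded_linear_Im this]]
        have "((\<lambda>t. - Im (grad_f e \<sigma> t)) has_vector_derivative A2 (\<sigma>, t)) (at t)" by (simp add: A2_def)
        then show ?thesis by (rule has_vector_derivative_at_within)
      qed
      show "continuous_on {-T..T} (\<lambda>t. A2 (\<sigma>, t))"
        using \<sigma> \<kappa> by (intro continuous_on_compose2[OF c2]) (auto intro!: continuous_intros)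
    qed (use T in auto)
    then show ?thesis by simp
  qed
  have I1: "(\<integral>x. indicator ({\<kappa><..} \<times> {-T..T}) x *\<^sub>R A1 x \<partial>lborel) = - (LBINT t:{-T..T}. Re (grad_f e \<kappa> t))"
  proof -
    have "integrable (lborel \<Otimes>\<^sub>M lborel) (case_prod (\<lambda>\<sigma> t. indicator ({\<kappa><..} \<times> {-T..T}) (\<sigma>, t) *\<^sub>R A1 (\<sigma>, t)))"
      using i1 by (simp only: lborel_prod case_prod_beta' prod.collapse)
    from lborel_pair.integral_snd[OF this]
    have "(\<integral>x. indicator ({\<kappa><..} \<times> {-T..T}) x *\<^sub>R A1 x \<partial>lborel) =
      (LBINT t. LBINT \<sigma>. indicator ({\<kappa><..} \<times> {-T..T}) (\<sigma>, t) *\<^sub>R A1 (\<sigma>, t))"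
      by (simp only: lborel_prod case_prod_beta' prod.collapse)
    also have "\<dots> = (LBINT t. indicator {-T..T} t *\<^sub>R (LBINT \<sigma>:{\<kappa><..}. A1 (\<sigma>, t)))"
      unfolding set_lebesgue_integral_def ind(1) by (simp only: integral_scaleR_right)
    also have "\<dots> = - (LBINT t:{-T..T}. Re (grad_f e \<kappa> t))"
      unfolding horizontal
      unfolding set_lebesgue_integral_def by simp
    finally show ?thesis .
  qed
  have I2: "(\<integral>x. indicator ({\<kappa><..} \<times> {-T..T}) x *\<^sub>R A2 x \<partial>lborel) =
      - (LBINT \<sigma>:{\<kappa><..}. Im (grad_f e \<sigma> T) - Im (grad_f e \<sigma> (-T)))"
  proof -
    have "integrable (lborel \<Otimes>\<^sub>M lborel) (case_prod (\<lambda>\<sigma> t. indicator ({\<kappa><..} \<times> {-T..T}) (\<sigma>, t) *\<^sub>R A2 (\<sigma>, t)))"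
      using i2 by (simp only: lborel_prod case_prod_beta' prod.collapse)
    from lborel_pair.integral_fst[OF this]
    have "(\<integral>x. indicator ({\<kappa><..} \<times> {-T..T}) x *\<^sub>R A2 x \<partial>lborel) =
      (LBINT \<sigma>. LBINT t. indicator ({\<kappa><..} \<times> {-T..T}) (\<sigma>, t) *\<^sub>R A2 (\<sigma>, t))"
      by (simp only: lborel_prod case_prod_beta' prod.collapse)
    also have "\<dots> = (LBINT \<sigma>. indicator {\<kappa><..} \<sigma> *\<^sub>R (LBINT t:{-T..T}. A2 (\<sigma>, t)))"
      unfolding set_lebesgue_integral_def ind(2) by (simp only: integral_scaleR_right)
    also have "\<dots> = (LBINT \<sigma>. - (indicator {\<kappa><..} \<sigma> *\<^sub>R (Im (grad_f e \<sigma> T) - Im (grad_f e \<sigma> (-T)))))"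
      by (intro Bochner_Integration.integral_cong) (auto simp: indicator_def vertical)
    finally show ?thesis unfolding set_lebesgue_integral_def by simp
  qed
  show "(\<integral>x. indicator ({\<kappa><..} \<times> {-T..T}) x *\<^sub>R lapl_f e x \<partial>lborel) =
      - (LBINT t:{-T..T}. Re (grad_f e \<kappa> t)) - (LBINT \<sigma>:{\<kappa><..}. Im (grad_f e \<sigma> T) - Im (grad_f e \<sigma> (-T)))"
    unfolding L scaleR_add_right using Bochner_Integration.integral_add[OF i1 i2] I1 I2 by simp
qed

end

section \<open>Removing the regularisation in Green's formula\<close>

lemma borel_measurable_reg_lapl [measurable (raw)]:
  assumes [measurable]: "u \<in> borel_measurable M" "v \<in> borel_measurable M"
  shows "(\<lambda>x. reg_lapl p e (u x) (v x)) \<in> borel_measurable M"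
  unfolding reg_lapl_def by measurable

text \<open>A sequence rather than a real parameter, since the limit theorems for integrals are
  applied along sequences. Its values stay in (0, 1], where the bounds on the gradient are
  uniform.\<close>

definition eps :: "nat \<Rightarrow> real" where "eps n = inverse (real (Suc n))"

lemma eps: "0 < eps n" "eps n \<le> 1" "0 \<le> eps n" "eps \<longlonglongrightarrow> 0"
proof -
  show "eps \<longlonglongrightarrow> 0" unfolding eps_def[abs_def] by (rule LIMSEQ_inverse_real_of_nat)
qed (auto simp: eps_def inverse_le_1_iff)

context Hinf_mean
begin

text \<open>At a zero of f the factor \<open>cnj z\<close> makes every term 0, so zeros are no
  exception. They obstruct only uniformity in the point.\<close>

lemma grad_f_tendsto: "(\<lambda>n. grad_f (eps n) \<sigma> t) \<longlonglongrightarrow> grad_f 0 \<sigma> t"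
proof (cases "f (Complex \<sigma> t) = 0")
  case False
  then show ?thesis by (intro tendsto_reg_grad tendsto_const eps) auto
qed (simp add: reg_grad_def)

lemma grad_f_measurable:
  assumes "\<sigma> > 0"
  shows "(\<lambda>t. grad_f e \<sigma> t) \<in> borel_measurable borel"
proof -
  have [measurable]: "(\<lambda>t. f (Complex \<sigma> t)) \<in> borel_measurable borel"
    "(\<lambda>t. deriv f (Complex \<sigma> t)) \<in> borel_measurable borel"
    using assms by (intro borel_measurable_continuous_onI continuous_on_vertical_line
        hol hol1 continuous_intros; simp)+
  show ?thesis by measurable
qed

text \<open>Nothing is known about f outside Re s > 0, so the cut-off is moved inside both
  arguments; this changes nothing because \<open>reg_grad p e 0 0 = 0\<close>.\<close>

lemma grad_f_measurable_horizontal: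
  assumes "\<kappa> \<ge> 0"
  shows "(\<lambda>\<sigma>. indicator {\<kappa><..} \<sigma> *\<^sub>R grad_f e \<sigma> t) \<in> borel_measurable borel"
proof -
  have meas: "(\<lambda>\<sigma>. indicator {\<kappa><..} \<sigma> *\<^sub>R h (Complex \<sigma> t)) \<in> borel_measurable borel"
    if "h holomorphic_on halfplane 0" for h
  proof (rule borel_measurable_continuous_on_indicator)
    show "continuous_on {\<kappa><..} (\<lambda>\<sigma>. h (Complex \<sigma> t))"
      using assms by (intro continuous_on_compose2[OF holomorphic_on_imp_continuous_on[OF that]])
        (auto simp: halfplane_def intro!: continuous_intros)
  qed auto
  note [measurable] = meas[OF hol] meas[OF hol1]
  have "(\<lambda>\<sigma>. indicator {\<kappa><..} \<sigma> *\<^sub>R grad_f e \<sigma> t) =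
    (\<lambda>\<sigma>. reg_grad p e (indicator {\<kappa><..} \<sigma> *\<^sub>R f (Complex \<sigma> t)) (indicator {\<kappa><..} \<sigma> *\<^sub>R deriv f (Complex \<sigma> t)))"
    by (auto simp: indicator_def reg_grad_def fun_eq_iff)
  then show ?thesis by simp
qed

lemma Im_grad_f_measurable_horizontal:
  assumes "\<kappa> \<ge> 0"
  shows "(\<lambda>\<sigma>. indicator {\<kappa><..} \<sigma> *\<^sub>R Im (grad_f e \<sigma> t)) \<in> borel_measurable borel"
proof -
  have "(\<lambda>\<sigma>. Im (indicator {\<kappa><..} \<sigma> *\<^sub>R grad_f e \<sigma> t)) \<in> borel_measurable borel"
    by (rule measurable_compose[OF grad_f_measurable_horizontal[OF assms]])
      (intro borel_measurable_continuous_onI continuous_intros)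
  then show ?thesis by simp
qed

lemma lapl_f_measurable:
  assumes "\<kappa> \<ge> 0"
  shows "(\<lambda>x. indicator ({\<kappa><..} \<times> {-T..T}) x *\<^sub>R lapl_f e x) \<in> borel_measurable borel"
proof -
  let ?Q = "{\<kappa><..} \<times> {-T..T}"
  have meas: "(\<lambda>x. indicator ?Q x *\<^sub>R h (Complex (fst x) (snd x))) \<in> borel_measurable borel"
    if "h holomorphic_on halfplane 0" for h
  proof (rule borel_measurable_continuous_on_indicator)
    show "?Q \<in> sets borel" by (intro borel_Times) auto
    show "continuous_on ?Q (\<lambda>x. h (Complex (fst x) (snd x)))"
      using assms by (intro continuous_on_subset[OF continuous_on_strip[OF that]]) auto
  qed
  note [measurable] = meas[OF hol] meas[OF hol1]
  have "(\<lambda>x. indicator ?Q x *\<^sub>R lapl_f e x) =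
    (\<lambda>x. reg_lapl p e (indicator ?Q x *\<^sub>R f (Complex (fst x) (snd x))) (indicator ?Q x *\<^sub>R deriv f (Complex (fst x) (snd x))))"
    by (auto simp: indicator_def reg_lapl_def fun_eq_iff)
  then show ?thesis by simp
qed

lemma AE_simple_zero_strip:
  "AE x in lborel. fst x > 0 \<longrightarrow> f (Complex (fst x) (snd x)) \<noteq> 0 \<or> deriv f (Complex (fst x) (snd x)) = 0"
proof -
  let ?Z = "{z\<in>halfplane 0. f z = 0 \<and> deriv f z \<noteq> 0}"
  have "countable ((\<lambda>z. (Re z, Im z)) ` ?Z)"
    by (intro countable_image countable_simple_zeros hol open_halfplane connected_halfplane)
  then have "(\<lambda>z. (Re z, Im z)) ` ?Z \<in> null_sets lborel"
    by (rule countable_imp_null_set_lborel)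
  then show ?thesis
  proof (rule AE_I', intro subsetI)
    fix x :: "real \<times> real"
    assume "x \<in> {x \<in> space lborel. \<not> (fst x > 0 \<longrightarrow> f (Complex (fst x) (snd x)) \<noteq> 0 \<or> deriv f (Complex (fst x) (snd x)) = 0)}"
    then show "x \<in> (\<lambda>z. (Re z, Im z)) ` ?Z"
      by (intro image_eqI[of _ _ "Complex (fst x) (snd x)"]) (auto simp: halfplane_def)
  qed
qed

lemma horizontal_set_integrable:
  assumes \<kappa>: "\<kappa> > 0" and e: "0 \<le> e" "e \<le> 1"
  shows "set_integrable lborel {\<kappa><..} (\<lambda>\<sigma>. Im (grad_f e \<sigma> t))"
proof -
  obtain C where C: "\<And>e \<sigma> t. 0 \<le> e \<Longrightarrow> e \<le> 1 \<Longrightarrow> \<sigma> \<ge> \<kappa> \<Longrightarrow> norm (grad_f e \<sigma> t) \<le> C * exp (- ln 2 * \<sigma>)"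
    using grad_f_bound[OF \<kappa>] by metis
  have "set_borel_measurable borel {\<kappa><..} (\<lambda>\<sigma>. Im (grad_f e \<sigma> t))"
    unfolding set_borel_measurable_def using \<kappa> by (intro Im_grad_f_measurable_horizontal) auto
  then show ?thesis
    by (rule set_integrable_Ioi[where C = C]) (rule order.trans[OF abs_Im_le_cmod C]; use e in simp)
qed

lemma boundary_tendsto:
  assumes \<kappa>: "\<kappa> > 0"
  shows "(\<lambda>n. LBINT t:{-T..T}. Re (grad_f (eps n) \<kappa> t)) \<longlonglongrightarrow> (LBINT t:{-T..T}. Re (grad_f 0 \<kappa> t))"
    and "(\<lambda>n. LBINT \<sigma>:{\<kappa><..}. Im (grad_f (eps n) \<sigma> T) - Im (grad_f (eps n) \<sigma> (-T))) \<longlonglongrightarrow>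
       (LBINT \<sigma>:{\<kappa><..}. Im (grad_f 0 \<sigma> T) - Im (grad_f 0 \<sigma> (-T)))"
proof -
  obtain C where C: "C > 0" "\<And>e \<sigma> t. 0 \<le> e \<Longrightarrow> e \<le> 1 \<Longrightarrow> \<sigma> \<ge> \<kappa> \<Longrightarrow> norm (grad_f e \<sigma> t) \<le> C * exp (- ln 2 * \<sigma>)"
    "\<And>e \<sigma> t. 0 \<le> e \<Longrightarrow> e \<le> 1 \<Longrightarrow> \<sigma> \<ge> \<kappa> \<Longrightarrow> norm (grad_f e \<sigma> t) \<le> C"
    by (rule grad_f_bound[OF \<kappa>]) (rule that; assumption)
  note [measurable] = grad_f_measurable[OF \<kappa>]
  show "(\<lambda>n. LBINT t:{-T..T}. Re (grad_f (eps n) \<kappa> t)) \<longlonglongrightarrow> (LBINT t:{-T..T}. Re (grad_f 0 \<kappa> t))"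
    unfolding set_lebesgue_integral_def
  proof (rule integral_dominated_convergence[where w = "\<lambda>t. indicator {-T..T} t *\<^sub>R C"])
    show "integrable lborel (\<lambda>t::real. indicator {-T..T} t *\<^sub>R C)"
      by (rule set_integrable_bounded[of "\<lambda>_. C" C "-T" T, unfolded set_integrable_def]) (use C in auto)
    show "AE t in lborel. (\<lambda>n. indicator {-T..T} t *\<^sub>R Re (grad_f (eps n) \<kappa> t)) \<longlonglongrightarrow> indicator {-T..T} t *\<^sub>R Re (grad_f 0 \<kappa> t)"
      by (intro AE_I2 tendsto_intros grad_f_tendsto)
    show "AE t in lborel. norm (indicator {-T..T} t *\<^sub>R Re (grad_f (eps n) \<kappa> t)) \<le> indicator {-T..T} t *\<^sub>R C" for n
      using eps by (intro AE_I2) (auto simp: indicator_def intro!: order.trans[OF abs_Re_le_cmod C(3)])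
  qed measurable
  have meas: "(\<lambda>\<sigma>. indicator {\<kappa><..} \<sigma> *\<^sub>R (Im (grad_f e \<sigma> T) - Im (grad_f e \<sigma> (-T)))) \<in> borel_measurable lborel" for e
    unfolding scaleR_diff_right using \<kappa>
    by (intro borel_measurable_diff) (simp_all add: Im_grad_f_measurable_horizontal[unfolded real_scaleR_def])
  show "(\<lambda>n. LBINT \<sigma>:{\<kappa><..}. Im (grad_f (eps n) \<sigma> T) - Im (grad_f (eps n) \<sigma> (-T))) \<longlonglongrightarrow>
       (LBINT \<sigma>:{\<kappa><..}. Im (grad_f 0 \<sigma> T) - Im (grad_f 0 \<sigma> (-T)))"
    unfolding set_lebesgue_integral_def
  proof (rule integral_dominated_convergence[where w = "\<lambda>\<sigma>. 2 * C * (indicator {\<kappa><..} \<sigma> *\<^sub>R exp (- ln 2 * \<sigma>))", OF meas meas])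
    show "integrable lborel (\<lambda>\<sigma>. 2 * C * (indicator {\<kappa><..} \<sigma> *\<^sub>R exp (- ln 2 * \<sigma>) :: real))"
      using set_integrable_exp_Ioi[of \<kappa>] unfolding set_integrable_def by (rule integrable_mult_right)
    show "AE \<sigma> in lborel. (\<lambda>n. indicator {\<kappa><..} \<sigma> *\<^sub>R (Im (grad_f (eps n) \<sigma> T) - Im (grad_f (eps n) \<sigma> (-T)))) \<longlonglongrightarrow>
        indicator {\<kappa><..} \<sigma> *\<^sub>R (Im (grad_f 0 \<sigma> T) - Im (grad_f 0 \<sigma> (-T)))"
      by (intro AE_I2 tendsto_intros grad_f_tendsto)
    show "AE \<sigma> in lborel. norm (indicator {\<kappa><..} \<sigma> *\<^sub>R (Im (grad_f (eps n) \<sigma> T) - Im (grad_f (eps n) \<sigma> (-T))))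
        \<le> 2 * C * (indicator {\<kappa><..} \<sigma> *\<^sub>R exp (- ln 2 * \<sigma>))" for n
    proof (intro AE_I2)
      fix \<sigma> :: real
      have "\<bar>Im (grad_f (eps n) \<sigma> t)\<bar> \<le> C * exp (- ln 2 * \<sigma>)" if "\<sigma> > \<kappa>" for t
        using that eps by (intro order.trans[OF abs_Im_le_cmod C(2)]) auto
      from this[of T] this[of "-T"]
      show "norm (indicator {\<kappa><..} \<sigma> *\<^sub>R (Im (grad_f (eps n) \<sigma> T) - Im (grad_f (eps n) \<sigma> (-T))))
        \<le> 2 * C * (indicator {\<kappa><..} \<sigma> *\<^sub>R exp (- ln 2 * \<sigma>))"
        by (auto simp: indicator_def)
    qed
  qed
qed

text \<open>The boundary terms converge by dominated convergence at once. For the area term the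
  limit density must be known to be integrable before \<open>reg_lapl_le\<close> can use it as part
  of the majorant \<open>w\<close>; with that majorant equality, and not just an inequality, passes
  to the limit.\<close>

lemma green:
  assumes \<kappa>: "\<kappa> > 0" and T: "T \<ge> 0"
  shows "integrable lborel (\<lambda>x. indicator ({\<kappa><..} \<times> {-T..T}) x *\<^sub>R lapl_f 0 x)"
    and "(\<integral>x. indicator ({\<kappa><..} \<times> {-T..T}) x *\<^sub>R lapl_f 0 x \<partial>lborel) =
      - (LBINT t:{-T..T}. Re (grad_f 0 \<kappa> t)) - (LBINT \<sigma>:{\<kappa><..}. Im (grad_f 0 \<sigma> T) - Im (grad_f 0 \<sigma> (-T)))"
proof -
  let ?Q = "{\<kappa><..} \<times> {-T..T}"
  define X where "X = (\<lambda>e x. indicator ?Q x *\<^sub>R lapl_f e x)"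
  define B where "B = (\<lambda>e. - (LBINT t:{-T..T}. Re (grad_f e \<kappa> t)) - (LBINT \<sigma>:{\<kappa><..}. Im (grad_f e \<sigma> T) - Im (grad_f e \<sigma> (-T))))"
  have [measurable]: "X e \<in> borel_measurable borel" for e
    unfolding X_def using \<kappa> by (intro lapl_f_measurable) auto
  have X0: "X e x \<ge> 0" for e x
    using p by (simp add: X_def reg_lapl_nonneg)
  have reg: "integrable lborel (X (eps n))" "integral\<^sup>L lborel (X (eps n)) = B (eps n)" for n
    unfolding X_def B_def using green_reg[OF eps(1,2) \<kappa> T] by auto
  have Blim: "(\<lambda>n. B (eps n)) \<longlonglongrightarrow> B 0"
    unfolding B_def using boundary_tendsto[OF \<kappa>] by (intro tendsto_intros) auto
  have lim: "AE x in lborel. (\<lambda>n. X (eps n) x) \<longlonglongrightarrow> X 0 x"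
    using AE_simple_zero_strip
  proof (rule AE_mp, intro AE_I2 impI)
    fix x :: "real \<times> real"
    assume *: "fst x > 0 \<longrightarrow> f (Complex (fst x) (snd x)) \<noteq> 0 \<or> deriv f (Complex (fst x) (snd x)) = 0"
    show "(\<lambda>n. X (eps n) x) \<longlonglongrightarrow> X 0 x"
    proof (cases "x \<in> ?Q")
      case True
      then have "fst x > 0" using \<kappa> by auto
      then show ?thesis unfolding X_def using * by (intro tendsto_intros tendsto_reg_lapl eps) auto
    qed (simp add: X_def)
  qed
  txt \<open>Integrability of the limit comes for free from Fatou's lemma, since the boundary terms stay bounded.\<close>
  have "(\<integral>\<^sup>+x. ennreal (X 0 x) \<partial>lborel) = (\<integral>\<^sup>+x. liminf (\<lambda>n. ennreal (X (eps n) x)) \<partial>lborel)"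
  proof (rule nn_integral_cong_AE)
    show "AE x in lborel. ennreal (X 0 x) = liminf (\<lambda>n. ennreal (X (eps n) x))"
      using lim by eventually_elim (auto intro!: lim_imp_Liminf[symmetric] tendsto_ennrealI)
  qed
  also have "\<dots> \<le> liminf (\<lambda>n. \<integral>\<^sup>+x. ennreal (X (eps n) x) \<partial>lborel)"
    by (rule nn_integral_liminf) measurable
  also have "\<dots> = liminf (\<lambda>n. ennreal (B (eps n)))"
    using reg X0 by (simp add: nn_integral_eq_integral)
  also have "\<dots> = ennreal (B 0)"
    by (intro lim_imp_Liminf tendsto_ennrealI Blim) simp
  finally have fin: "(\<integral>\<^sup>+x. ennreal (X 0 x) \<partial>lborel) < \<infinity>"
    using le_less_trans ennreal_less_top by (metis infinity_ennreal_def)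
  have int: "integrable lborel (X 0)"
    using X0 fin by (intro integrableI_nonneg) auto
  then show "integrable lborel (\<lambda>x. indicator ?Q x *\<^sub>R lapl_f 0 x)" by (simp add: X_def)
  obtain M where M: "M > 0" "\<And>s. Re s > 0 \<Longrightarrow> norm (f s) \<le> M" using Hinf_bounded[OF f] by blast
  obtain C where C: "C > 0" "\<And>s. Re s \<ge> \<kappa> \<Longrightarrow> norm (deriv f s) \<le> C * exp (- ln 2 * Re s)"
    "\<And>s. Re s \<ge> \<kappa> \<Longrightarrow> norm (deriv f s) \<le> C"
    by (rule decays_bounded[OF Hinf_deriv_decays(1)[OF f] \<kappa>]) (rule that; assumption)
  define c where "c = (p\<^sup>2 + 2 * p) / p\<^sup>2"
  define d where "d = (p\<^sup>2 + 2 * p) * (1 + (M\<^sup>2 + 1) powr (p / 2 - 1))"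
  have d0: "d \<ge> 0" using p by (simp add: d_def)
  define w where "w = (\<lambda>x. c * X 0 x + indicator ?Q x *\<^sub>R (d * C * C * exp (- ln 2 * fst x)))"
  have "(\<lambda>n. integral\<^sup>L lborel (X (eps n))) \<longlonglongrightarrow> integral\<^sup>L lborel (X 0)"
  proof (rule integral_dominated_convergence[where w = w])
    show "integrable lborel w"
      unfolding w_def by (intro Bochner_Integration.integrable_add integrable_mult_right int integrable_strip_exp)
    show "AE x in lborel. norm (X (eps n) x) \<le> w x" for n
      using AE_simple_zero_strip
    proof (rule AE_mp, intro AE_I2 impI)
      fix x :: "real \<times> real"
      assume *: "fst x > 0 \<longrightarrow> f (Complex (fst x) (snd x)) \<noteq> 0 \<or> deriv f (Complex (fst x) (snd x)) = 0"
      show "norm (X (eps n) x) \<le> w x"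
      proof (cases "x \<in> ?Q")
        case True
        then have x: "fst x > 0" "fst x > \<kappa>" using \<kappa> by auto
        let ?s = "Complex (fst x) (snd x)"
        have "lapl_f (eps n) x \<le> c * lapl_f 0 x + d * (norm (deriv f ?s))\<^sup>2"
          unfolding c_def d_def using * x by (intro reg_lapl_le p eps M) auto
        also have "(norm (deriv f ?s))\<^sup>2 \<le> C * (C * exp (- ln 2 * fst x))"
          unfolding power2_eq_square using C(1) C(2)[of ?s] C(3)[of ?s] x by (intro mult_mono) auto
        finally have "lapl_f (eps n) x \<le> c * lapl_f 0 x + d * (C * (C * exp (- ln 2 * fst x)))"
          using d0 by (simp add: mult_left_mono)
        then show ?thesis using True X0[of "eps n" x] by (simp add: X_def w_def mult.assoc)
      qed (simp add: X_def w_def)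
    qed
  qed (use lim in auto)
  then have "integral\<^sup>L lborel (X 0) = B 0" using Blim LIMSEQ_unique unfolding reg by blast
  then show "(\<integral>x. indicator ?Q x *\<^sub>R lapl_f 0 x \<partial>lborel) =
      - (LBINT t:{-T..T}. Re (grad_f 0 \<kappa> t)) - (LBINT \<sigma>:{\<kappa><..}. Im (grad_f 0 \<sigma> T) - Im (grad_f 0 \<sigma> (-T)))"
    by (simp add: X_def B_def)
qed

end

section \<open>Convergence of the means\<close>

text \<open>It is used twice: for the means over [-n, n] at fixed e > 0, and for their limits as e
  tends to 0.\<close>

lemma has_real_derivative_uniform_limit:
  fixes F :: "nat \<Rightarrow> real \<Rightarrow> real"
  assumes S: "open S" "convex S" and F: "\<And>n x. x \<in> S \<Longrightarrow> (F n has_real_derivative F' n x) (at x)"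
    and unif: "uniform_limit S F' G sequentially" and lim: "\<And>x. x \<in> S \<Longrightarrow> (\<lambda>n. F n x) \<longlonglongrightarrow> L x"
    and x: "x \<in> S"
  shows "(L has_real_derivative G x) (at x)"
proof -
  have "\<exists>g. \<forall>x\<in>S. (\<lambda>n. F n x) \<longlonglongrightarrow> g x \<and> (g has_derivative (*) (G x)) (at x within S)"
  proof (rule has_derivative_sequence[where f = F and f' = "\<lambda>n x. (*) (F' n x)" and g' = "\<lambda>x. (*) (G x)"])
    show "(F n has_derivative (*) (F' n x)) (at x within S)" if "x \<in> S" for n x
      using F[OF that, of n] by (simp add: has_field_derivative_def has_derivative_at_withinI)
    show "\<forall>\<^sub>F n in sequentially. \<forall>x\<in>S. \<forall>h. norm (F' n x * h - G x * h) \<le> e * norm h" if "e > 0" for e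
      using uniform_limitD[OF unif that]
    proof eventually_elim
      case (elim n)
      show ?case
      proof (intro ballI allI)
        fix x h assume "x \<in> S"
        then have "\<bar>F' n x - G x\<bar> \<le> e" using elim by (auto simp: dist_real_def less_imp_le)
        then show "norm (F' n x * h - G x * h) \<le> e * norm h"
          by (simp add: left_diff_distrib[symmetric] abs_mult mult_right_mono)
      qed
    qed
  qed (fact S(2) x lim[OF x])+
  then obtain g where g: "\<And>x. x \<in> S \<Longrightarrow> (\<lambda>n. F n x) \<longlonglongrightarrow> g x"
    "\<And>x. x \<in> S \<Longrightarrow> (g has_derivative (*) (G x)) (at x within S)" by blast
  have "(g has_real_derivative G x) (at x)"
    using g(2)[OF x] unfolding at_within_open[OF x S(1)] has_field_derivative_def .
  then show ?thesis
    by (rule has_field_derivative_transform_within_open[OF _ S(1) x]) (use g(1) lim LIMSEQ_unique in blast)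
qed

lemma uniform_limit_at_top_real:
  assumes "uniform_limit S Y L (at_top :: real filter)"
  shows "uniform_limit S (\<lambda>n. Y (real n)) L sequentially"
  using assms filterlim_real_sequentially unfolding uniform_limit_iff filterlim_iff by blast

lemma Lim_close:
  fixes a b :: "real \<Rightarrow> real"
  assumes "(a \<longlongrightarrow> A) at_top" "(b \<longlongrightarrow> B) at_top" "\<And>T. T \<ge> 1 \<Longrightarrow> \<bar>a T - b T\<bar> \<le> \<eta>"
  shows "\<bar>A - B\<bar> \<le> \<eta>"
proof (rule tendsto_upperbound)
  show "((\<lambda>T. \<bar>a T - b T\<bar>) \<longlongrightarrow> \<bar>A - B\<bar>) at_top" by (intro tendsto_intros assms)
  show "\<forall>\<^sub>F T in at_top. \<bar>a T - b T\<bar> \<le> \<eta>"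
    by (rule eventually_mono[OF eventually_ge_at_top[of 1]]) (rule assms(3))
qed simp

lemma mean_diff_le:
  assumes h: "set_integrable lborel {-T..T} h" and k: "set_integrable lborel {-T..T} k"
    and q: "set_integrable lborel {-T..T} q" and le: "\<And>t. \<bar>h t - k t\<bar> \<le> q t" and T: "T > 0"
  shows "\<bar>mean T h - mean T k\<bar> \<le> mean T q"
proof -
  have "(LBINT t:{-T..T}. h t) - (LBINT t:{-T..T}. k t) = (LBINT t:{-T..T}. h t - k t)"
    by (rule set_integral_diff(2)[OF h k, symmetric])
  moreover have "\<bar>LBINT t:{-T..T}. h t - k t\<bar> \<le> (LBINT t:{-T..T}. q t)"
  proof -
    have "\<bar>LBINT t:{-T..T}. h t - k t\<bar> \<le> (LBINT t. \<bar>indicator {-T..T} t *\<^sub>R (h t - k t)\<bar>)"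
      unfolding set_lebesgue_integral_def by (rule integral_abs_bound)
    also have "\<dots> \<le> (LBINT t:{-T..T}. q t)"
      unfolding set_lebesgue_integral_def
    proof (rule integral_mono)
      show "integrable lborel (\<lambda>t. \<bar>indicator {-T..T} t *\<^sub>R (h t - k t)\<bar>)"
        using set_integral_diff(1)[OF h k] unfolding set_integrable_def by (rule integrable_abs)
    qed (use q le in \<open>auto simp: set_integrable_def indicator_def\<close>)
    finally show ?thesis .
  qed
  ultimately have "\<bar>(LBINT t:{-T..T}. h t) - (LBINT t:{-T..T}. k t)\<bar> \<le> (LBINT t:{-T..T}. q t)" by simp
  then have "1 / (2 * T) * \<bar>(LBINT t:{-T..T}. h t) - (LBINT t:{-T..T}. k t)\<bar> \<le> mean T q"
    unfolding mean_def using T by (intro mult_left_mono) auto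
  moreover have "mean T h - mean T k = 1 / (2 * T) * ((LBINT t:{-T..T}. h t) - (LBINT t:{-T..T}. k t))"
    by (simp add: mean_def right_diff_distrib)
  ultimately show ?thesis using T by (simp add: abs_mult)
qed

context Hinf_mean
begin

text \<open>On Re s >= \<kappa> the pair (f, f') stays in a product of two closed discs, so a
  continuous \<Phi> is bounded and uniformly continuous along it, and almost periodicity passes to
  the composition.\<close>

lemma mean_uniform_limit:
  fixes \<Phi> :: "complex \<times> complex \<Rightarrow> real"
  assumes \<Phi>: "continuous_on UNIV \<Phi>" and \<kappa>: "\<kappa> > 0"
  shows "uniform_limit {\<kappa>..} (\<lambda>T \<sigma>. mean T (\<lambda>t. \<Phi> (f (Complex \<sigma> t), deriv f (Complex \<sigma> t))))
    (\<lambda>\<sigma>. Lim at_top (\<lambda>T. mean T (\<lambda>t. \<Phi> (f (Complex \<sigma> t), deriv f (Complex \<sigma> t))))) at_top"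
proof (rule uniform_limit_Lim_at_top)
  fix e :: real assume e: "e > 0"
  obtain M where M: "M > 0" "\<And>s. Re s > 0 \<Longrightarrow> norm (f s) \<le> M" using Hinf_bounded[OF f] by blast
  obtain C where C: "C > 0" "\<And>s. Re s \<ge> \<kappa> \<Longrightarrow> norm (deriv f s) \<le> C"
    using decays_bounded[OF Hinf_deriv_decays(1)[OF f] \<kappa>] by metis
  let ?K = "cball (0::complex) M \<times> cball (0::complex) C"
  have K: "(f (Complex \<sigma> t), deriv f (Complex \<sigma> t)) \<in> ?K" if "\<sigma> \<in> {\<kappa>..}" for \<sigma> t
    using that M C \<kappa> by auto
  have comp: "compact ?K" by (intro compact_Times compact_cball)
  have cont: "continuous_on ?K \<Phi>" by (rule continuous_on_subset[OF \<Phi>]) auto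
  have "compact (\<Phi> ` ?K)" by (intro compact_continuous_image comp cont)
  then have "bounded (\<Phi> ` ?K)" by (rule compact_imp_bounded)
  then obtain B where B: "\<And>x. x \<in> ?K \<Longrightarrow> \<bar>\<Phi> x\<bar> \<le> B"
    unfolding bounded_iff by (metis imageI real_norm_def)
  show "\<exists>T0. \<forall>T\<ge>T0. \<forall>T'\<ge>T0. \<forall>\<sigma>\<in>{\<kappa>..}.
    dist (mean T (\<lambda>t. \<Phi> (f (Complex \<sigma> t), deriv f (Complex \<sigma> t))))
         (mean T' (\<lambda>t. \<Phi> (f (Complex \<sigma> t), deriv f (Complex \<sigma> t)))) < e"
  proof (rule unif_almost_periodic_mean_Cauchy[OF _ _ _ e])
    show "unif_almost_periodic {\<kappa>..} (\<lambda>\<sigma> t. \<Phi> (f (Complex \<sigma> t), deriv f (Complex \<sigma> t)))"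
      by (rule unif_almost_periodic_compose[OF Hinf_unif_almost_periodic[OF f \<kappa>] K comp cont])
    show "continuous_on UNIV (\<lambda>t. \<Phi> (f (Complex \<sigma> t), deriv f (Complex \<sigma> t)))" if "\<sigma> \<in> {\<kappa>..}" for \<sigma>
      using that \<kappa> by (intro continuous_on_compose2[OF \<Phi>] continuous_intros continuous_on_vertical_line hol hol1) auto
    show "\<bar>\<Phi> (f (Complex \<sigma> t), deriv f (Complex \<sigma> t))\<bar> \<le> B" if "\<sigma> \<in> {\<kappa>..}" for \<sigma> t
      by (rule B[OF K[OF that]])
  qed
qed

definition mean_grad :: "real \<Rightarrow> real \<Rightarrow> real \<Rightarrow> real" where
  "mean_grad e T \<sigma> = mean T (\<lambda>t. Re (grad_f e \<sigma> t))"

definition mean_pow :: "real \<Rightarrow> real \<Rightarrow> real \<Rightarrow> real" where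
  "mean_pow e T \<sigma> = mean T (\<lambda>t. ((norm (f (Complex \<sigma> t)))\<^sup>2 + e\<^sup>2) powr (p / 2))"

lemma continuous_on_reg_grad:
  assumes "e > 0" "continuous_on A z" "continuous_on A w"
  shows "continuous_on A (\<lambda>x. reg_grad p e (z x) (w x))"
proof -
  have "(norm (z x))\<^sup>2 + e\<^sup>2 \<noteq> 0" for x using assms(1) by (simp add: sum_power2_eq_zero_iff)
  then show ?thesis unfolding reg_grad_def using assms by (intro continuous_intros) auto
qed

lemma mean_grad_uniform_limit:
  assumes "e > 0" "\<kappa> > 0"
  shows "uniform_limit {\<kappa>..} (mean_grad e) (\<lambda>\<sigma>. Lim at_top (\<lambda>T. mean_grad e T \<sigma>)) at_top"
proof -
  have "continuous_on UNIV (\<lambda>x. Re (reg_grad p e (fst x) (snd x)))"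
    by (intro continuous_intros continuous_on_reg_grad assms)
  from mean_uniform_limit[OF this assms(2)] show ?thesis by (simp add: mean_grad_def[abs_def])
qed

lemma mean_pow_uniform_limit:
  assumes "\<kappa> > 0"
  shows "uniform_limit {\<kappa>..} (mean_pow e) (\<lambda>\<sigma>. Lim at_top (\<lambda>T. mean_pow e T \<sigma>)) at_top"
proof -
  have "continuous_on UNIV (\<lambda>x::complex \<times> complex. ((norm (fst x))\<^sup>2 + e\<^sup>2) powr (p / 2))"
    using p by (intro continuous_on_powr' continuous_intros) auto
  from mean_uniform_limit[OF this assms] show ?thesis by (simp add: mean_pow_def[abs_def])
qed

text \<open>One threshold for n serves all T >= 1 and all \<sigma> >= \<kappa>; this is what allows
  the limits in T and in e to be exchanged. The window bound is taken with \<eta>/2 to pay for the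
  factor 2 of \<open>mean_le_unit_interval\<close>.\<close>

lemma mean_grad_close:
  assumes \<kappa>: "\<kappa> > 0" and \<eta>: "\<eta> > 0"
  shows "\<forall>\<^sub>F n in sequentially. \<forall>\<sigma>\<ge>\<kappa>. \<forall>T\<ge>1. \<bar>mean_grad (eps n) T \<sigma> - mean_grad 0 T \<sigma>\<bar> \<le> \<eta>"
proof -
  obtain d where d: "d > 0" "\<And>e \<sigma> a. 0 < e \<Longrightarrow> e < d \<Longrightarrow> \<sigma> \<ge> \<kappa> \<Longrightarrow>
     (LBINT t:{0..1}. norm (grad_f e \<sigma> (t + a) - grad_f 0 \<sigma> (t + a))) < \<eta> / 2"
    using reg_grad_unit_interval_small[OF f p \<kappa>, of "\<eta> / 2"] \<eta> by auto
  obtain C where C: "C > 0" "\<And>e \<sigma> t. 0 \<le> e \<Longrightarrow> e \<le> 1 \<Longrightarrow> \<sigma> \<ge> \<kappa> \<Longrightarrow> norm (grad_f e \<sigma> t) \<le> C"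
    using grad_f_bound[OF \<kappa>] by metis
  have "\<bar>mean_grad (eps n) T \<sigma> - mean_grad 0 T \<sigma>\<bar> \<le> \<eta>" if n: "eps n < d" and \<sigma>: "\<sigma> \<ge> \<kappa>" and T: "T \<ge> 1" for n \<sigma> T
  proof -
    have [measurable]: "(\<lambda>t. grad_f e \<sigma> t) \<in> borel_measurable borel" for e
      using \<sigma> \<kappa> by (intro grad_f_measurable) auto
    define q where "q = (\<lambda>t. norm (grad_f (eps n) \<sigma> t - grad_f 0 \<sigma> t))"
    have [measurable]: "q \<in> borel_measurable borel" unfolding q_def by measurable
    have q: "q t \<le> 2 * C" for t
    proof -
      have "q t \<le> norm (grad_f (eps n) \<sigma> t) + norm (grad_f 0 \<sigma> t)" unfolding q_def by (rule norm_triangle_ineq4)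
      also have "\<dots> \<le> C + C" using eps \<sigma> by (intro add_mono C) auto
      finally show ?thesis by simp
    qed
    have "\<bar>mean_grad (eps n) T \<sigma> - mean_grad 0 T \<sigma>\<bar> \<le> mean T q"
      unfolding mean_grad_def
    proof (rule mean_diff_le)
      show "set_integrable lborel {-T..T} (\<lambda>t. Re (grad_f (eps n) \<sigma> t))" "set_integrable lborel {-T..T} (\<lambda>t. Re (grad_f 0 \<sigma> t))"
        by (rule set_integrable_bounded[where B = C], measurable,
            use \<sigma> eps in \<open>auto intro!: order.trans[OF abs_Re_le_cmod C(2)]\<close>)+
      show "set_integrable lborel {-T..T} q"
        by (rule set_integrable_bounded[where B = "2 * C"]) (use q in \<open>auto simp: q_def\<close>)
      show "\<bar>Re (grad_f (eps n) \<sigma> t) - Re (grad_f 0 \<sigma> t)\<bar> \<le> q t" for t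
        using abs_Re_le_cmod[of "grad_f (eps n) \<sigma> t - grad_f 0 \<sigma> t"] by (simp add: q_def)
    qed (use T in auto)
    also have "\<dots> \<le> 2 * (\<eta> / 2)"
    proof (rule mean_le_unit_interval[where B = "2 * C"])
      show "(LBINT t:{0..1}. q (t + a)) \<le> \<eta> / 2" for a
        using d(2)[OF eps(1) n \<sigma>, of a] by (simp add: q_def)
    qed (use q T in \<open>auto simp: q_def\<close>)
    finally show ?thesis by simp
  qed
  then show ?thesis using order_tendstoD(2)[OF eps(4) d(1)] by (auto elim!: eventually_mono)
qed

text \<open>For p = 1 the integrand at e = 0 is not continuous in (f, f'), so
  \<open>mean_uniform_limit\<close> does not apply. The Cauchy property is inherited from a single
  regularised mean instead: two comparisons at T and two at T', hence four errors of at most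
  e/6.\<close>

lemma mean_grad_zero_uniform_limit:
  assumes \<kappa>: "\<kappa> > 0"
  shows "uniform_limit {\<kappa>..} (mean_grad 0) (\<lambda>\<sigma>. Lim at_top (\<lambda>T. mean_grad 0 T \<sigma>)) at_top"
proof (rule uniform_limit_Lim_at_top)
  fix e :: real assume e: "e > 0"
  have "\<forall>\<^sub>F n in sequentially. \<forall>\<sigma>\<ge>\<kappa>. \<forall>T\<ge>1. \<bar>mean_grad (eps n) T \<sigma> - mean_grad 0 T \<sigma>\<bar> \<le> e / 6"
    using e by (intro mean_grad_close \<kappa>) auto
  from eventually_happens'[OF sequentially_bot this]
  obtain n where n: "\<And>\<sigma> T. \<sigma> \<ge> \<kappa> \<Longrightarrow> T \<ge> 1 \<Longrightarrow> \<bar>mean_grad (eps n) T \<sigma> - mean_grad 0 T \<sigma>\<bar> \<le> e / 6"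
    by blast
  have "\<forall>\<^sub>F T in at_top. \<forall>\<sigma>\<in>{\<kappa>..}. dist (mean_grad (eps n) T \<sigma>) (Lim at_top (\<lambda>T. mean_grad (eps n) T \<sigma>)) < e / 6"
    using e by (intro uniform_limitD[OF mean_grad_uniform_limit] eps \<kappa>) auto
  then obtain T0 where T0: "\<And>T \<sigma>. T \<ge> T0 \<Longrightarrow> \<sigma> \<ge> \<kappa> \<Longrightarrow> \<bar>mean_grad (eps n) T \<sigma> - Lim at_top (\<lambda>T. mean_grad (eps n) T \<sigma>)\<bar> < e / 6"
    by (auto simp: eventually_at_top_linorder dist_real_def)
  have "dist (mean_grad 0 T \<sigma>) (mean_grad 0 T' \<sigma>) < e" if "T \<ge> max 1 T0" "T' \<ge> max 1 T0" "\<sigma> \<ge> \<kappa>" for T T' \<sigma>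
    using n[of \<sigma> T] n[of \<sigma> T'] T0[of T \<sigma>] T0[of T' \<sigma>] that e unfolding dist_real_def by linarith
  then show "\<exists>T0. \<forall>T\<ge>T0. \<forall>T'\<ge>T0. \<forall>\<sigma>\<in>{\<kappa>..}. dist (mean_grad 0 T \<sigma>) (mean_grad 0 T' \<sigma>) < e"
    by (intro exI[of _ "max 1 T0"]) auto
qed

definition mean_grad_lim :: "real \<Rightarrow> real \<Rightarrow> real" where "mean_grad_lim e \<sigma> = Lim at_top (\<lambda>T. mean_grad e T \<sigma>)"

lemma mean_grad_tendsto:
  assumes "e \<ge> 0" "\<sigma> > 0"
  shows "((\<lambda>T. mean_grad e T \<sigma>) \<longlongrightarrow> mean_grad_lim e \<sigma>) at_top"
proof -
  have "uniform_limit {\<sigma>..} (mean_grad e) (\<lambda>\<sigma>. Lim at_top (\<lambda>T. mean_grad e T \<sigma>)) at_top"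
    using mean_grad_uniform_limit mean_grad_zero_uniform_limit assms by (cases "e = 0") auto
  then show ?thesis unfolding mean_grad_lim_def by (rule tendsto_uniform_limitI) simp
qed

text \<open>The estimate of \<open>mean_grad_close\<close> does not involve T and therefore survives
  the limit in T.\<close>

lemma mean_grad_lim_uniform_limit:
  assumes \<kappa>: "\<kappa> > 0"
  shows "uniform_limit {\<kappa>..} (\<lambda>n. mean_grad_lim (eps n)) (mean_grad_lim 0) sequentially"
proof (rule uniform_limitI)
  fix e :: real assume e: "e > 0"
  have "\<forall>\<^sub>F n in sequentially. \<forall>\<sigma>\<ge>\<kappa>. \<forall>T\<ge>1. \<bar>mean_grad (eps n) T \<sigma> - mean_grad 0 T \<sigma>\<bar> \<le> e / 2"
    using e by (intro mean_grad_close \<kappa>) auto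
  then show "\<forall>\<^sub>F n in sequentially. \<forall>\<sigma>\<in>{\<kappa>..}. dist (mean_grad_lim (eps n) \<sigma>) (mean_grad_lim 0 \<sigma>) < e"
  proof eventually_elim
    case (elim n)
    have "\<bar>mean_grad_lim (eps n) \<sigma> - mean_grad_lim 0 \<sigma>\<bar> \<le> e / 2" if "\<sigma> \<ge> \<kappa>" for \<sigma>
      by (rule Lim_close[OF mean_grad_tendsto mean_grad_tendsto]) (use that \<kappa> eps elim in auto)
    then show ?case using e by (fastforce simp: dist_real_def)
  qed
qed

section \<open>The derivative of the mean and its continuity\<close>

lemma has_real_derivative_mean_pow:
  assumes e: "e > 0" and \<sigma>: "\<sigma> > 0"
  shows "(mean_pow e T has_real_derivative mean_grad e T \<sigma>) (at \<sigma>)"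
proof -
  let ?u = "\<lambda>\<sigma> t. ((norm (f (Complex \<sigma> t)))\<^sup>2 + e\<^sup>2) powr (p / 2)"
  let ?v = "\<lambda>\<sigma> t. Re (grad_f e \<sigma> t)"
  have nz: "(norm z)\<^sup>2 + e\<^sup>2 \<noteq> 0" for z :: complex using e by (simp add: sum_power2_eq_zero_iff)
  have cu: "continuous_on UNIV (?u x)" if "x > 0" for x
    using that nz by (intro continuous_intros continuous_on_vertical_line hol) auto
  have cv: "continuous_on UNIV (?v x)" if "x > 0" for x
    using that by (intro continuous_intros continuous_on_reg_grad continuous_on_vertical_line hol hol1 e)
  have "((\<lambda>x. integral (cbox (-T) T) (?u x)) has_real_derivative integral (cbox (-T) T) (?v \<sigma>)) (at \<sigma> within {0<..})"
  proof (rule leibniz_rule_field_derivative)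
    show "((\<lambda>x. ?u x t) has_real_derivative ?v x t) (at x within {0<..})" if "x \<in> {0<..}" for x t
    proof -
      have "((\<lambda>x. ?u x t) has_real_derivative p / 2 * ((norm (f (Complex x t)))\<^sup>2 + e\<^sup>2) powr (p / 2 - 1) *
          (2 * Re (cnj (f (Complex x t)) * deriv f (Complex x t)))) (at x)"
        using that by (intro has_real_derivative_reg_powr has_vector_derivative_horizontal hol e) auto
      moreover have "p / 2 * ((norm (f (Complex x t)))\<^sup>2 + e\<^sup>2) powr (p / 2 - 1) *
          (2 * Re (cnj (f (Complex x t)) * deriv f (Complex x t))) = ?v x t"
        unfolding reg_grad_def by (simp add: algebra_simps)
      ultimately show ?thesis by (simp add: has_field_derivative_at_within)
    qed
    show "?u x integrable_on cbox (-T) T" if "x \<in> {0<..}" for x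
      using that by (intro integrable_continuous continuous_on_subset[OF cu]) auto
    have "continuous_on ({0<..} \<times> UNIV) (\<lambda>x. ?v (fst x) (snd x))"
      by (intro continuous_intros continuous_on_reg_grad continuous_on_strip hol hol1 e)
    then show "continuous_on ({0<..} \<times> cbox (-T) T) (\<lambda>(x, t). ?v x t)"
      unfolding case_prod_beta' by (rule continuous_on_subset) auto
  qed (use \<sigma> in auto)
  then have "((\<lambda>x. integral {-T..T} (?u x)) has_real_derivative integral {-T..T} (?v \<sigma>)) (at \<sigma>)"
    using \<sigma> at_within_open[of \<sigma> "{0<..}"] by simp
  then have "((\<lambda>x. integral {-T..T} (?u x) / (2 * T)) has_real_derivative integral {-T..T} (?v \<sigma>) / (2 * T)) (at \<sigma>)"
    by (rule DERIV_cdivide)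
  then have "(mean_pow e T has_real_derivative integral {-T..T} (?v \<sigma>) / (2 * T)) (at \<sigma>)"
    by (rule has_field_derivative_transform_within_open[of _ _ _ "{0<..}"])
      (use \<sigma> cu in \<open>auto simp: mean_pow_def mean_eq_integral\<close>)
  then show ?thesis using \<sigma> cv by (simp add: mean_grad_def mean_eq_integral)
qed

definition mean_pow_lim :: "real \<Rightarrow> real \<Rightarrow> real" where "mean_pow_lim e \<sigma> = Lim at_top (\<lambda>T. mean_pow e T \<sigma>)"

lemma mean_pow_tendsto:
  assumes "\<sigma> > 0"
  shows "((\<lambda>T. mean_pow e T \<sigma>) \<longlongrightarrow> mean_pow_lim e \<sigma>) at_top"
  unfolding mean_pow_lim_def by (rule tendsto_uniform_limitI[OF mean_pow_uniform_limit[OF assms]]) simp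

lemma mean_pow_lim_zero: "mean_pow_lim 0 \<sigma> = Mpp p f \<sigma>"
proof -
  have "((norm z)\<^sup>2 + 0\<^sup>2) powr (p / 2) = norm z powr p" for z :: complex
  proof (cases "z = 0")
    case False
    then have "((norm z)\<^sup>2) powr (p / 2) = (norm z powr 2) powr (p / 2)" by (simp add: powr_numeral)
    also have "\<dots> = norm z powr p" unfolding powr_powr by simp
    finally show ?thesis by simp
  qed simp
  then show ?thesis by (simp add: mean_pow_lim_def Mpp_def mean_pow_def mean_def)
qed

text \<open>Uniform convergence is available on the half-line from \<kappa> for each \<kappa> > 0,
  but not up to 0; hence the open half-line beyond \<sigma>/2 as domain of differentiation.\<close>

lemma has_real_derivative_mean_pow_lim:
  assumes e: "e > 0" and \<sigma>: "\<sigma> > 0"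
  shows "(mean_pow_lim e has_real_derivative mean_grad_lim e \<sigma>) (at \<sigma>)"
proof (rule has_real_derivative_uniform_limit[where S = "{\<sigma>/2<..}"])
  show "(mean_pow e (real n) has_real_derivative mean_grad e (real n) x) (at x)" if "x \<in> {\<sigma>/2<..}" for n x
    using that \<sigma> by (intro has_real_derivative_mean_pow e) auto
  have "uniform_limit {\<sigma>/2..} (mean_grad e) (mean_grad_lim e) at_top"
    using mean_grad_uniform_limit[of e "\<sigma>/2"] e \<sigma> by (simp add: mean_grad_lim_def[abs_def])
  then show "uniform_limit {\<sigma>/2<..} (\<lambda>n. mean_grad e (real n)) (mean_grad_lim e) sequentially"
    by (intro uniform_limit_at_top_real) (rule uniform_limit_on_subset, auto)
  show "(\<lambda>n. mean_pow e (real n) x) \<longlonglongrightarrow> mean_pow_lim e x" if "x \<in> {\<sigma>/2<..}" for x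
    using that \<sigma> by (intro filterlim_compose[OF mean_pow_tendsto filterlim_real_sequentially]) auto
qed (use \<sigma> in auto)

text \<open>Unlike the gradient for p = 1, the function (r^2 + e^2)^(p/2) of (r, e) is continuous at
  the origin. It is uniformly continuous on [0, M] x [0, 1], so the regularised powers converge
  uniformly on the whole line and the estimate is free of T.\<close>

lemma mean_pow_lim_tendsto:
  assumes \<sigma>: "\<sigma> > 0"
  shows "(\<lambda>n. mean_pow_lim (eps n) \<sigma>) \<longlonglongrightarrow> mean_pow_lim 0 \<sigma>"
proof (rule tendstoI)
  fix e :: real assume e: "e > 0"
  obtain M where M: "M > 0" "\<And>s. Re s > 0 \<Longrightarrow> norm (f s) \<le> M" using Hinf_bounded[OF f] by blast
  let ?K = "{0..M} \<times> {0..1::real}" and ?\<phi> = "\<lambda>x::real \<times> real. ((fst x)\<^sup>2 + (snd x)\<^sup>2) powr (p / 2)"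
  have "uniformly_continuous_on ?K ?\<phi>"
    using p by (intro compact_uniformly_continuous compact_Times continuous_on_powr' continuous_intros) auto
  then obtain d where d: "d > 0" "\<And>x y. x \<in> ?K \<Longrightarrow> y \<in> ?K \<Longrightarrow> dist y x < d \<Longrightarrow> dist (?\<phi> y) (?\<phi> x) < e / 2"
    using e unfolding uniformly_continuous_on_def by (metis half_gt_zero)
  have "dist (mean_pow_lim (eps n) \<sigma>) (mean_pow_lim 0 \<sigma>) < e" if n: "eps n < d" for n
  proof -
    have "\<bar>mean_pow_lim (eps n) \<sigma> - mean_pow_lim 0 \<sigma>\<bar> \<le> e / 2"
    proof (rule Lim_close[OF mean_pow_tendsto[OF \<sigma>] mean_pow_tendsto[OF \<sigma>]])
      fix T :: real assume T: "T \<ge> 1"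
      have ci: "set_integrable lborel {-T..T} (\<lambda>t. ((norm (f (Complex \<sigma> t)))\<^sup>2 + x\<^sup>2) powr (p / 2))" for x
        using p \<sigma> by (intro borel_integrable_atLeastAtMost' continuous_on_powr' continuous_intros
            continuous_on_vertical_line hol) auto
      have cc: "set_integrable lborel {-T..T} (\<lambda>t. e / 2)"
        by (intro borel_integrable_atLeastAtMost' continuous_intros)
      have "\<bar>mean_pow (eps n) T \<sigma> - mean_pow 0 T \<sigma>\<bar> \<le> mean T (\<lambda>_. e / 2)"
        unfolding mean_pow_def
      proof (rule mean_diff_le[OF ci ci cc])
        fix t
        have "dist (?\<phi> (norm (f (Complex \<sigma> t)), eps n)) (?\<phi> (norm (f (Complex \<sigma> t)), 0)) < e / 2"
          using M \<sigma> eps(1)[of n] eps(2)[of n] n by (intro d(2)) (auto simp: dist_Pair_Pair)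
        then show "\<bar>((norm (f (Complex \<sigma> t)))\<^sup>2 + (eps n)\<^sup>2) powr (p / 2) - ((norm (f (Complex \<sigma> t)))\<^sup>2 + 0\<^sup>2) powr (p / 2)\<bar> \<le> e / 2"
          by (simp add: dist_real_def)
      qed (use T in auto)
      also have "\<dots> = e / 2" using T by (simp add: mean_eq_integral[OF continuous_on_const])
      finally show "\<bar>mean_pow (eps n) T \<sigma> - mean_pow 0 T \<sigma>\<bar> \<le> e / 2" .
    qed
    then show ?thesis using e by (simp add: dist_real_def)
  qed
  then show "\<forall>\<^sub>F n in sequentially. dist (mean_pow_lim (eps n) \<sigma>) (mean_pow_lim 0 \<sigma>) < e"
    using order_tendstoD(2)[OF eps(4) d(1)] by (auto elim!: eventually_mono)
qed

text \<open>The limit in T has been taken at fixed e; here e tends to 0. The derivative comes out as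
  the limit mean of the unregularised gradient, which is the quantity that Green's formula produces
  on the line Re s = \<sigma>.\<close>

lemma has_real_derivative_Mpp:
  assumes \<sigma>: "\<sigma> > 0"
  shows "(Mpp p f has_real_derivative mean_grad_lim 0 \<sigma>) (at \<sigma>)"
proof (rule has_real_derivative_uniform_limit[where S = "{\<sigma>/2<..}"])
  show "(mean_pow_lim (eps n) has_real_derivative mean_grad_lim (eps n) x) (at x)" if "x \<in> {\<sigma>/2<..}" for n x
    using that \<sigma> by (intro has_real_derivative_mean_pow_lim eps) auto
  show "uniform_limit {\<sigma>/2<..} (\<lambda>n. mean_grad_lim (eps n)) (mean_grad_lim 0) sequentially"
    by (rule uniform_limit_on_subset[OF mean_grad_lim_uniform_limit[of "\<sigma>/2"]]) (use \<sigma> in auto)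
  show "(\<lambda>n. mean_pow_lim (eps n) x) \<longlonglongrightarrow> Mpp p f x" if "x \<in> {\<sigma>/2<..}" for x
    using that \<sigma> mean_pow_lim_tendsto[of x] by (simp add: mean_pow_lim_zero)
qed (use \<sigma> in auto)

lemma continuous_on_mean_grad:
  assumes e: "e > 0" and \<kappa>: "\<kappa> > 0"
  shows "continuous_on {\<kappa>..} (mean_grad e T)"
proof -
  have "continuous_on ({0<..} \<times> UNIV) (\<lambda>x. Re (grad_f e (fst x) (snd x)))"
    by (intro continuous_intros continuous_on_reg_grad continuous_on_strip hol hol1 e)
  then have "continuous_on ({\<kappa>..} \<times> cbox (-T) T) (\<lambda>(x, t). Re (grad_f e x t))"
    unfolding case_prod_beta' by (rule continuous_on_subset) (use \<kappa> in auto)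
  then have "continuous_on {\<kappa>..} (\<lambda>x. integral (cbox (-T) T) (\<lambda>t. Re (grad_f e x t)))"
    by (rule integral_continuous_on_param)
  then have "continuous_on {\<kappa>..} (\<lambda>x. integral {-T..T} (\<lambda>t. Re (grad_f e x t)) * (1 / (2 * T)))"
    by (intro continuous_intros) auto
  then show ?thesis
  proof (rule continuous_on_eq)
    show "integral {-T..T} (\<lambda>t. Re (grad_f e x t)) * (1 / (2 * T)) = mean_grad e T x" if "x \<in> {\<kappa>..}" for x
  proof -
    have "continuous_on UNIV (\<lambda>t. Re (grad_f e x t))"
      using that \<kappa> by (intro continuous_intros continuous_on_reg_grad continuous_on_vertical_line hol hol1 e) auto
    then show ?thesis by (simp add: mean_grad_def mean_eq_integral)
  qed
  qed
qed

text \<open>For p = 1 the gradient at e = 0 jumps at simple zeros. Continuity therefore comes from e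
  > 0 through two uniform limits, in T and then in e.\<close>

lemma continuous_on_mean_grad_lim: "continuous_on {0<..} (mean_grad_lim 0)"
proof -
  have *: "continuous_on {\<kappa>..} (mean_grad_lim 0)" if \<kappa>: "\<kappa> > 0" for \<kappa>
  proof (rule uniform_limit_theorem[OF _ mean_grad_lim_uniform_limit[OF \<kappa>]])
    have "continuous_on {\<kappa>..} (mean_grad_lim (eps n))" for n
    proof (rule uniform_limit_theorem)
      show "uniform_limit {\<kappa>..} (mean_grad (eps n)) (mean_grad_lim (eps n)) at_top"
        using mean_grad_uniform_limit[OF eps(1) \<kappa>, of n] by (simp add: mean_grad_lim_def[abs_def])
    qed (use continuous_on_mean_grad[OF eps(1) \<kappa>] in auto)
    then show "\<forall>\<^sub>F n in sequentially. continuous_on {\<kappa>..} (mean_grad_lim (eps n))" by simp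
  qed simp
  show ?thesis
    unfolding continuous_on_eq_continuous_at[OF open_greaterThan]
  proof
    fix x :: real assume x: "x \<in> {0<..}"
    have "continuous_on {x/2<..} (mean_grad_lim 0)" by (rule continuous_on_subset[OF *[of "x/2"]]) (use x in auto)
    then show "isCont (mean_grad_lim 0) x" using x by (simp add: continuous_on_eq_continuous_at)
  qed
qed

section \<open>The area integral of the theorem\<close>

lemma area_integral_eq:
  assumes \<kappa>: "\<kappa> > 0" and T: "T > 0"
  shows "p\<^sup>2 / (2 * T) * (LBINT \<sigma>:{\<kappa><..}. (LBINT t:{-T..T}.
          norm (f (Complex \<sigma> t)) powr (p - 2) * (norm (deriv f (Complex \<sigma> t)))\<^sup>2)) =
     - mean_grad 0 T \<kappa> - (LBINT \<sigma>:{\<kappa><..}. Im (grad_f 0 \<sigma> T) - Im (grad_f 0 \<sigma> (-T))) / (2 * T)"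
proof -
  let ?Q = "{\<kappa><..} \<times> {-T..T}"
  have T0: "T \<ge> 0" using T by simp
  \<comment> \<open>Integrability over the half-strip justifies Fubini, which turns the plane
    integral of \<open>green\<close> into the iterated integral of the theorem.\<close>
  have "integrable (lborel \<Otimes>\<^sub>M lborel) (case_prod (\<lambda>\<sigma> t. indicator ?Q (\<sigma>, t) *\<^sub>R lapl_f 0 (\<sigma>, t)))"
    using green(1)[OF \<kappa> T0] by (simp only: lborel_prod case_prod_beta' prod.collapse)
  from lborel_pair.integral_fst[OF this]
  have "(\<integral>x. indicator ?Q x *\<^sub>R lapl_f 0 x \<partial>lborel) = (LBINT \<sigma>. LBINT t. indicator ?Q (\<sigma>, t) *\<^sub>R lapl_f 0 (\<sigma>, t))"
    by (simp only: lborel_prod case_prod_beta' prod.collapse)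
  also have "(\<lambda>\<sigma>. LBINT t. indicator ?Q (\<sigma>, t) *\<^sub>R lapl_f 0 (\<sigma>, t)) = (\<lambda>\<sigma>. p\<^sup>2 *\<^sub>R (indicator {\<kappa><..} \<sigma> *\<^sub>R
      (LBINT t:{-T..T}. norm (f (Complex \<sigma> t)) powr (p - 2) * (norm (deriv f (Complex \<sigma> t)))\<^sup>2)))"
  proof
    fix \<sigma>
    have "(\<lambda>t. indicator ?Q (\<sigma>, t) *\<^sub>R lapl_f 0 (\<sigma>, t)) = (\<lambda>t. p\<^sup>2 *\<^sub>R (indicator {\<kappa><..} \<sigma> *\<^sub>R (indicator {-T..T} t *\<^sub>R
        (norm (f (Complex \<sigma> t)) powr (p - 2) * (norm (deriv f (Complex \<sigma> t)))\<^sup>2))))"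
      by (auto simp: indicator_def reg_lapl_zero)
    then show "(LBINT t. indicator ?Q (\<sigma>, t) *\<^sub>R lapl_f 0 (\<sigma>, t)) = p\<^sup>2 *\<^sub>R (indicator {\<kappa><..} \<sigma> *\<^sub>R
      (LBINT t:{-T..T}. norm (f (Complex \<sigma> t)) powr (p - 2) * (norm (deriv f (Complex \<sigma> t)))\<^sup>2))"
      unfolding set_lebesgue_integral_def by (simp only: integral_scaleR_right)
  qed
  also have "integral\<^sup>L lborel \<dots> = p\<^sup>2 * (LBINT \<sigma>:{\<kappa><..}. (LBINT t:{-T..T}.
          norm (f (Complex \<sigma> t)) powr (p - 2) * (norm (deriv f (Complex \<sigma> t)))\<^sup>2))"
    unfolding set_lebesgue_integral_def[of lborel "{\<kappa><..}"]
    by (subst integral_scaleR_right) (simp only: real_scaleR_def)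
  finally have "p\<^sup>2 * (LBINT \<sigma>:{\<kappa><..}. (LBINT t:{-T..T}.
          norm (f (Complex \<sigma> t)) powr (p - 2) * (norm (deriv f (Complex \<sigma> t)))\<^sup>2)) =
      - (LBINT t:{-T..T}. Re (grad_f 0 \<kappa> t)) - (LBINT \<sigma>:{\<kappa><..}. Im (grad_f 0 \<sigma> T) - Im (grad_f 0 \<sigma> (-T)))"
    using green(2)[OF \<kappa> T0] by simp
  then show ?thesis using T by (simp add: mean_grad_def mean_def field_simps)
qed

text \<open>Integrating the exponential majorant from \<open>\<kappa>0\<close> on bounds the
  horizontal sides independently of \<kappa> and T. After division by 2 T they disappear in the
  limit, uniformly in \<kappa>.\<close>

lemma side_integral_bound:
  assumes \<kappa>0: "\<kappa>0 > 0"
  obtains R where "\<And>\<kappa> T. \<kappa> \<ge> \<kappa>0 \<Longrightarrow> \<bar>LBINT \<sigma>:{\<kappa><..}. Im (grad_f 0 \<sigma> T) - Im (grad_f 0 \<sigma> (-T))\<bar> \<le> R"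
proof -
  obtain C where C: "C > 0" "\<And>e \<sigma> t. 0 \<le> e \<Longrightarrow> e \<le> 1 \<Longrightarrow> \<sigma> \<ge> \<kappa>0 \<Longrightarrow> norm (grad_f e \<sigma> t) \<le> C * exp (- ln 2 * \<sigma>)"
    using grad_f_bound[OF \<kappa>0] by metis
  have "\<bar>LBINT \<sigma>:{\<kappa><..}. Im (grad_f 0 \<sigma> T) - Im (grad_f 0 \<sigma> (-T))\<bar> \<le>
     (LBINT \<sigma>. 2 * C * (indicator {\<kappa>0<..} \<sigma> *\<^sub>R exp (- ln 2 * \<sigma>)))" if \<kappa>: "\<kappa> \<ge> \<kappa>0" for \<kappa> T
  proof -
    have "\<bar>LBINT \<sigma>:{\<kappa><..}. Im (grad_f 0 \<sigma> T) - Im (grad_f 0 \<sigma> (-T))\<bar> \<le>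
      (LBINT \<sigma>. \<bar>indicator {\<kappa><..} \<sigma> *\<^sub>R (Im (grad_f 0 \<sigma> T) - Im (grad_f 0 \<sigma> (-T)))\<bar>)"
      unfolding set_lebesgue_integral_def by (rule integral_abs_bound)
    also have "\<dots> \<le> (LBINT \<sigma>. 2 * C * (indicator {\<kappa>0<..} \<sigma> *\<^sub>R exp (- ln 2 * \<sigma>)))"
    proof (rule integral_mono)
      have "set_integrable lborel {\<kappa><..} (\<lambda>\<sigma>. Im (grad_f 0 \<sigma> T) - Im (grad_f 0 \<sigma> (-T)))"
        using \<kappa> \<kappa>0 by (intro set_integral_diff horizontal_set_integrable) auto
      then show "integrable lborel (\<lambda>\<sigma>. \<bar>indicator {\<kappa><..} \<sigma> *\<^sub>R (Im (grad_f 0 \<sigma> T) - Im (grad_f 0 \<sigma> (-T)))\<bar>)"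
        unfolding set_integrable_def by (rule integrable_abs)
      show "integrable lborel (\<lambda>\<sigma>. 2 * C * (indicator {\<kappa>0<..} \<sigma> *\<^sub>R exp (- ln 2 * \<sigma>) :: real))"
        using set_integrable_exp_Ioi[of \<kappa>0] unfolding set_integrable_def by (rule integrable_mult_right)
      fix \<sigma> :: real
      have "\<bar>Im (grad_f 0 \<sigma> t)\<bar> \<le> C * exp (- ln 2 * \<sigma>)" if "\<sigma> > \<kappa>" for t
        using that \<kappa> by (intro order.trans[OF abs_Im_le_cmod C(2)]) auto
      from this[of T] this[of "-T"]
      show "\<bar>indicator {\<kappa><..} \<sigma> *\<^sub>R (Im (grad_f 0 \<sigma> T) - Im (grad_f 0 \<sigma> (-T)))\<bar>
        \<le> 2 * C * (indicator {\<kappa>0<..} \<sigma> *\<^sub>R exp (- ln 2 * \<sigma>))"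
        using \<kappa> C(1) by (auto simp: indicator_def)
    qed
    finally show ?thesis .
  qed
  then show thesis by (rule that)
qed

lemma area_integral_uniform_limit:
  assumes \<kappa>0: "\<kappa>0 > 0"
  shows "uniform_limit {\<kappa>0..} (\<lambda>T \<kappa>. p\<^sup>2 / (2 * T) * (LBINT \<sigma>:{\<kappa><..}. (LBINT t:{-T..T}.
          norm (f (Complex \<sigma> t)) powr (p - 2) * (norm (deriv f (Complex \<sigma> t)))\<^sup>2))) (\<lambda>\<kappa>. - mean_grad_lim 0 \<kappa>) at_top"
proof (rule uniform_limitI)
  fix e :: real assume e: "e > 0"
  obtain R where R: "\<And>\<kappa> T. \<kappa> \<ge> \<kappa>0 \<Longrightarrow> \<bar>LBINT \<sigma>:{\<kappa><..}. Im (grad_f 0 \<sigma> T) - Im (grad_f 0 \<sigma> (-T))\<bar> \<le> R"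
    using side_integral_bound[OF \<kappa>0] by blast
  have "\<forall>\<^sub>F T in at_top. \<forall>\<kappa>\<in>{\<kappa>0..}. dist (mean_grad 0 T \<kappa>) (mean_grad_lim 0 \<kappa>) < e / 2"
    using uniform_limitD[OF mean_grad_zero_uniform_limit[OF \<kappa>0], of "e / 2"] e by (simp add: mean_grad_lim_def)
  \<comment> \<open>From R/e on, the horizontal sides contribute at most e/2.\<close>
  moreover have "\<forall>\<^sub>F T in at_top. T \<ge> max 1 (R / e)" by (rule eventually_ge_at_top)
  ultimately show "\<forall>\<^sub>F T in at_top. \<forall>\<kappa>\<in>{\<kappa>0..}. dist (p\<^sup>2 / (2 * T) * (LBINT \<sigma>:{\<kappa><..}. (LBINT t:{-T..T}.
          norm (f (Complex \<sigma> t)) powr (p - 2) * (norm (deriv f (Complex \<sigma> t)))\<^sup>2))) (- mean_grad_lim 0 \<kappa>) < e"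
  proof eventually_elim
    case (elim T)
    then have T: "T > 0" "R / e \<le> T" by auto
    show ?case
    proof
      fix \<kappa> assume \<kappa>: "\<kappa> \<in> {\<kappa>0..}"
      let ?S = "LBINT \<sigma>:{\<kappa><..}. Im (grad_f 0 \<sigma> T) - Im (grad_f 0 \<sigma> (-T))"
      have "\<bar>?S\<bar> \<le> R" using R \<kappa> by simp
      also have "\<dots> \<le> T * e" using T(2) e by (simp add: divide_le_eq)
      finally have "\<bar>?S / (2 * T)\<bar> \<le> e / 2" using T(1) by (simp add: abs_divide field_simps)
      moreover have "\<bar>mean_grad 0 T \<kappa> - mean_grad_lim 0 \<kappa>\<bar> < e / 2" using elim(1) \<kappa> by (simp add: dist_real_def)
      ultimately have "\<bar>(- mean_grad 0 T \<kappa> - ?S / (2 * T)) - (- mean_grad_lim 0 \<kappa>)\<bar> < e" by linarith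
      then show "dist (p\<^sup>2 / (2 * T) * (LBINT \<sigma>:{\<kappa><..}. (LBINT t:{-T..T}.
          norm (f (Complex \<sigma> t)) powr (p - 2) * (norm (deriv f (Complex \<sigma> t)))\<^sup>2))) (- mean_grad_lim 0 \<kappa>) < e"
        using area_integral_eq[of \<kappa> T] \<kappa> \<kappa>0 T(1) by (simp add: dist_real_def)
    qed
  qed
qed

end

theorem theorem1p1:
  fixes p :: real and f :: "complex \<Rightarrow> complex"
  assumes "1 \<le> p" and "f \<in> Hinf"
  defines "I \<equiv> (\<lambda>T \<kappa>::real. p\<^sup>2 / (2 * T) *
      (LBINT \<sigma>:{\<kappa><..}. (LBINT t:{-T..T}.
          norm (f (Complex \<sigma> t)) powr (p - 2) * (norm (deriv f (Complex \<sigma> t)))\<^sup>2)))"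
  shows "\<exists>D :: real \<Rightarrow> real.
     (\<forall>\<kappa>>0. ((\<lambda>k. Mpp p f k) has_real_derivative D \<kappa>) (at \<kappa>)) \<and>
     continuous_on {0<..} D \<and>
     (\<forall>\<kappa>>0. ((\<lambda>T. I T \<kappa>) \<longlongrightarrow> - D \<kappa>) at_top) \<and>
     (\<forall>\<kappa>0>0. uniform_limit {\<kappa>0<..} I (\<lambda>\<kappa>. - D \<kappa>) at_top)"
proof -
  interpret Hinf_mean f p by unfold_locales (use assms in auto)
  have unif: "uniform_limit {\<kappa>..} I (\<lambda>\<kappa>. - mean_grad_lim 0 \<kappa>) at_top" if "\<kappa> > 0" for \<kappa>
    unfolding I_def by (rule area_integral_uniform_limit[OF that])
  show ?thesis
  \<comment> \<open>The witness is the limit mean of the unregularised gradient. Uniformity on the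
    closed half-line from \<kappa> includes the pointwise limit at \<kappa> itself.\<close>
  proof (intro exI[of _ "mean_grad_lim 0"] conjI allI impI)
    show "((\<lambda>k. Mpp p f k) has_real_derivative mean_grad_lim 0 \<kappa>) (at \<kappa>)" if "\<kappa> > 0" for \<kappa>
      by (rule has_real_derivative_Mpp[OF that])
    show "continuous_on {0<..} (mean_grad_lim 0)" by (rule continuous_on_mean_grad_lim)
    show "((\<lambda>T. I T \<kappa>) \<longlongrightarrow> - mean_grad_lim 0 \<kappa>) at_top" if "\<kappa> > 0" for \<kappa>
      by (rule tendsto_uniform_limitI[OF unif[OF that]]) simp
    show "uniform_limit {\<kappa>0<..} I (\<lambda>\<kappa>. - mean_grad_lim 0 \<kappa>) at_top" if "\<kappa>0 > 0" for \<kappa>0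
      by (rule uniform_limit_on_subset[OF unif[OF that]]) auto
  qed
qed

end
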